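(* Let $z,z',\xi\in\mathbb C$ with $\xi\neq1$. Upon the identification of $\mathrm{Sym}_{\mathbb C}$ with the (complexified) algebra of polynomial functions on $\mathbb Y$, the Meixner operator $\mathfrak D^{\mathsf M}$ with parameters $(z,z',\xi)$ is implemented by the following operator in the space of functions $f$ on $\mathbb Y$, which can be written in two equivalent forms: $$ \begin{aligned} \mathfrak D^{\mathsf M}f(\lambda)&=\sum_{\square\in\lambda^+}A(\lambda,\square)f(\lambda\cup\square)+\sum_{\square\in\lambda^-}B(\lambda,\square)f(\lambda\setminus\square)-C(\lambda)f(\lambda)\\ &=\sum_{\square\in\lambda^+}A(\lambda,\square)\big(f(\lambda\cup\square)-f(\lambda)\big)+\sum_{\square\in\lambda^-}B(\lambda,\square)\big(f(\lambda\setminus\square)-f(\lambda)\big), \end{aligned} $$ where $$ \begin{aligned} A(\lambda,\square)&=\frac{\xi}{1-\xi}(z+c(\square))(z'+c(\square))\frac{\dim(\lambda\cup\square)}{(|\lambda|+1)\dim\lambda},\quad\square\in\lambda^+,\\ B(\lambda,\square)&=\frac{1}{1-\xi}\,\frac{|\lambda|\dim(\lambda\setminus\square)}{\dim\lambda},\quad\square\in\lambda^-,\\ C(\lambda)&=\frac1{1-\xi}\big((1+\xi)|\lambda|+\xi zz'\big). \end{aligned} $$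
   Context: $\mathbb Y$ is the set of all partitions, identified with Young diagrams; $|\nu|$ is the number of boxes and $\ell(\nu)$ the number of nonzero rows of $\nu$; $\dim\lambda$ is the number of standard tableaux of shape $\lambda$ ($\dim\varnothing=1$). For a box $\square=(i,j)$ (row $i$, column $j$) its content is $c(\square)=j-i$. $\lambda^-$ is the set of boxes $\square\in\lambda$ such that $\lambda\setminus\square$ is a Young diagram; $\lambda^+$ is the set of boxes $\square\notin\lambda$ such that $\lambda\cup\square$ is a Young diagram. $\mathrm{Sym}$ is the algebra of symmetric functions over $\mathbb R$, freely generated by the power sums $p_k$; $\mathrm{Sym}_{\mathbb C}=\mathrm{Sym}\otimes_{\mathbb R}\mathbb C$. Identification of $\mathrm{Sym}$ with functions on $\mathbb Y$: for $\lambda\in\mathbb Y$ with $d$ diagonal boxes, the modified Frobenius coordinates are $a_i=\lambda_i-i+\frac12$, $b_i=\lambda'_i-i+\frac12$, $1\le i\le d$ ($\lambda'$ the transposed diagram). The functions $p_k(\lambda)=\sum_{i=1}^d[a_i^k-(-b_i)^k]$, $k\ge1$, are algebraically independent, and the algebra $\mathbb A$ of polynomial functions on $\mathbb Y$ is the algebra they generate with $1$. The isomorphism $\mathrm{Sym}\to\mathbb A$ sends the generator $p_k$ to the function $p_k(\lambda)$. Frobenius–Schur functions. Put $x^{\downarrow n}=x(x-1)\cdots(x-n+1)$. The factorial Schur polynomial is $S^{\mathsf f}_{\nu\mid N}(x_1,\dots,x_N)=\det[x_j^{\downarrow(\nu_i+N-i)}]_{i,j=1}^N/\prod_{i<j}(x_i-x_j)$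 for $\ell(\nu)\le N$ (and $0$ if $\ell(\nu)>N$). The shifted Schur polynomial is $S^*_{\nu\mid N}(y_1,\dots,y_N)=S^{\mathsf f}_{\nu\mid N}(y_1+N-1,y_2+N-2,\dots,y_N)$; it satisfies $S^*_{\nu\mid N}|_{y_N=0}=S^*_{\nu\mid N-1}$. A polynomial in $y_1,\dots,y_N$ is shifted symmetric if it is symmetric in the variables $y_i+N-i$; $\mathrm{Sym}^*$ is the algebra of sequences $(f_N)_{N\ge1}$ of shifted symmetric polynomials in $N$ variables with $f_N|_{y_N=0}=f_{N-1}$ and $\sup_N\deg f_N<\infty$. Thus $S^*_\nu=(S^*_{\nu\mid N})_N\in\mathrm{Sym}^*$. The algebra $\mathrm{Sym}^*$ is freely generated by $p_k^*=\sum_{i\ge1}[(y_i-i+\frac12)^k-(-i+\frac12)^k]$, $k\ge1$, and $FS_\nu\in\mathrm{Sym}$ is the image of $S^*_\nu$ under the algebra isomorphism $\mathrm{Sym}^*\to\mathrm{Sym}$, $p^*_k\mapsto p_k$. The $FS_\nu$ form a basis of $\mathrm{Sym}$. The Meixner operator with parameters $(z,z',\xi)$ is the linear operator on $\mathrm{Sym}_{\mathbb C}$ defined by $$\mathfrak D^{\mathsf M}FS_\nu=-|\nu|FS_\nu+\frac{\xi}{1-\xi}\sum_{\square\in\nu^-}(z+c(\square))(z'+c(\square))FS_{\nu\setminus\square},\qquad\nu\in\mathbb Y.$$ *)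

theory Defs
  imports
    Complex_Main
    "HOL-Library.FuncSet"
    "HOL-Library.Poly_Mapping"
    "Jordan_Normal_Form.Determinant"
begin

section \<open>Young diagrams\<close>

text \<open>A diagram is the finite set of its boxes \<open>(i, j)\<close> (row \<open>i\<close>, column \<open>j\<close>), both counted from 1.\<close>

type_synonym box = "nat \<times> nat"

definition young_diagrams :: "box set set" where
  "young_diagrams = {\<nu>. finite \<nu> \<and> \<nu> \<subseteq> {1..} \<times> {1..} \<and>
     (\<forall>i j i' j'. (i, j) \<in> \<nu> \<longrightarrow> 1 \<le> i' \<longrightarrow> i' \<le> i \<longrightarrow> 1 \<le> j' \<longrightarrow> j' \<le> j \<longrightarrow> (i', j') \<in> \<nu>)}"

definition row_len :: "box set \<Rightarrow> nat \<Rightarrow> nat" where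
  "row_len \<nu> i = card {j. (i, j) \<in> \<nu>}"

definition num_rows :: "box set \<Rightarrow> nat" where
  "num_rows \<nu> = card {i. row_len \<nu> i \<noteq> 0}"

definition transposed :: "box set \<Rightarrow> box set" where
  "transposed \<nu> = {(j, i) | i j. (i, j) \<in> \<nu>}"

definition content :: "box \<Rightarrow> int" where
  "content b = int (snd b) - int (fst b)"

definition removable :: "box set \<Rightarrow> box set" where
  "removable \<nu> = {b. b \<in> \<nu> \<and> \<nu> - {b} \<in> young_diagrams}"

definition addable :: "box set \<Rightarrow> box set" where
  "addable \<nu> = {b. b \<notin> \<nu> \<and> insert b \<nu> \<in> young_diagrams}"

definition standard_tableaux :: "box set \<Rightarrow> (box \<Rightarrow> nat) set" where
  "standard_tableaux \<nu> = {T \<in> \<nu> \<rightarrow>\<^sub>E {1..card \<nu>}. bij_betw T \<nu> {1..card \<nu>} \<and>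
     (\<forall>i j. (i, j) \<in> \<nu> \<longrightarrow> (i, Suc j) \<in> \<nu> \<longrightarrow> T (i, j) < T (i, Suc j)) \<and>
     (\<forall>i j. (i, j) \<in> \<nu> \<longrightarrow> (Suc i, j) \<in> \<nu> \<longrightarrow> T (i, j) < T (Suc i, j))}"

definition dim_young :: "box set \<Rightarrow> nat" where
  "dim_young \<nu> = card (standard_tableaux \<nu>)"


section \<open>Polynomials in countably many indeterminates\<close>

type_synonym 'a poly_ring = "(nat \<Rightarrow>\<^sub>0 nat) \<Rightarrow>\<^sub>0 'a"

definition pconst :: "'a \<Rightarrow> 'a::comm_ring_1 poly_ring" where
  "pconst c = Poly_Mapping.single 0 c"

definition pvar :: "nat \<Rightarrow> 'a::comm_ring_1 poly_ring" where
  "pvar n = Poly_Mapping.single (Poly_Mapping.single n 1) 1"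

text \<open>\<open>peval h \<sigma>\<close> is the ring homomorphism that maps constants by \<open>h\<close> and
  the \<open>n\<close>-th indeterminate to \<open>\<sigma> n\<close>.\<close>

definition peval :: "('a::comm_ring_1 \<Rightarrow> 'b::comm_ring_1) \<Rightarrow> (nat \<Rightarrow> 'b) \<Rightarrow> 'a poly_ring \<Rightarrow> 'b" where
  "peval h \<sigma> p = (\<Sum>m\<in>Poly_Mapping.keys p. h (Poly_Mapping.lookup p m) *
     (\<Prod>n\<in>Poly_Mapping.keys m. \<sigma> n ^ Poly_Mapping.lookup m n))"


section \<open>Symmetric functions as functions on diagrams\<close>

text \<open>\<open>Sym\<close> is the polynomial ring freely generated by \<open>p\<^sub>1, p\<^sub>2, \<dots>\<close>; the \<open>n\<close>-th indeterminate
  (\<open>n = 0, 1, \<dots>\<close>) stands for the power sum \<open>p\<^bsub>n+1\<^esub>\<close>.\<close>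

type_synonym sym = "real poly_ring"
type_synonym sym_complex = "complex poly_ring"

definition complexify :: "sym \<Rightarrow> sym_complex" where
  "complexify = peval (\<lambda>c. pconst (complex_of_real c)) pvar"

definition diag_len :: "box set \<Rightarrow> nat" where
  "diag_len \<nu> = card {i. (i, i) \<in> \<nu>}"

definition frobenius_a :: "box set \<Rightarrow> nat \<Rightarrow> real" where
  "frobenius_a \<nu> i = real (row_len \<nu> i) - real i + 1/2"

definition frobenius_b :: "box set \<Rightarrow> nat \<Rightarrow> real" where
  "frobenius_b \<nu> i = real (row_len (transposed \<nu>) i) - real i + 1/2"

definition power_sum_fun :: "nat \<Rightarrow> box set \<Rightarrow> real" where
  "power_sum_fun k \<nu> = (\<Sum>i=1..diag_len \<nu>. frobenius_a \<nu> i ^ k - (- frobenius_b \<nu> i) ^ k)"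

definition fun_on_young :: "sym_complex \<Rightarrow> box set \<Rightarrow> complex" where
  "fun_on_young F \<nu> = peval id (\<lambda>n. complex_of_real (power_sum_fun (n + 1) \<nu>)) F"


section \<open>Frobenius--Schur functions\<close>

text \<open>Here the indeterminate with index \<open>i \<ge> 1\<close> is the variable \<open>x\<^sub>i\<close> (resp. \<open>y\<^sub>i\<close>).\<close>

definition falling :: "'a::comm_ring_1 \<Rightarrow> nat \<Rightarrow> 'a" where
  "falling x n = (\<Prod>k<n. x - of_nat k)"

text \<open>The quotient of the determinant by the Vandermonde product is taken in the polynomial ring,
  which is an integral domain; the matrix entries are indexed from 0.\<close>

definition factorial_schur :: "box set \<Rightarrow> nat \<Rightarrow> real poly_ring" where
  "factorial_schur \<nu> N = (if num_rows \<nu> \<le> N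
     then (THE q. q * (\<Prod>i=1..N. \<Prod>j=Suc i..N. (pvar i - pvar j)) =
       det (mat N N (\<lambda>(i, j). falling (pvar (j + 1)) (row_len \<nu> (i + 1) + N - (i + 1)))))
     else 0)"

definition shifted_schur :: "box set \<Rightarrow> nat \<Rightarrow> real poly_ring" where
  "shifted_schur \<nu> N =
     peval pconst (\<lambda>i. pvar i + pconst (real N - real i)) (factorial_schur \<nu> N)"

definition shifted_power_sum :: "nat \<Rightarrow> nat \<Rightarrow> real poly_ring" where
  "shifted_power_sum k N =
     (\<Sum>i=1..N. (pvar i - pconst (real i) + pconst (1/2)) ^ k - pconst ((- real i + 1/2) ^ k))"

text \<open>The algebra homomorphism from \<open>Sym\<close> to \<open>Sym*\<close> with \<open>p\<^sub>k \<mapsto> p\<^sub>k*\<close>; an element of \<open>Sym*\<close> is the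
  sequence of its restrictions to \<open>N \<ge> 1\<close> variables.\<close>

definition to_shifted_sym :: "sym \<Rightarrow> nat \<Rightarrow> real poly_ring" where
  "to_shifted_sym F N = peval pconst (\<lambda>n. shifted_power_sum (n + 1) N) F"

text \<open>The inverse isomorphism. It exists since \<open>Sym*\<close> is freely generated by the \<open>p\<^sub>k*\<close>.\<close>

definition from_shifted_sym :: "(nat \<Rightarrow> real poly_ring) \<Rightarrow> sym" where
  "from_shifted_sym f = (THE F. \<forall>N\<ge>1. to_shifted_sym F N = f N)"

definition FS :: "box set \<Rightarrow> sym" where
  "FS \<nu> = from_shifted_sym (shifted_schur \<nu>)"


section \<open>The Meixner operator\<close>

definition sym_scale :: "complex \<Rightarrow> sym_complex \<Rightarrow> sym_complex" where
  "sym_scale c F = pconst c * F"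

text \<open>A linear operator is determined by its values on the basis \<open>FS \<nu>\<close>.\<close>

definition meixner_operator ::
    "complex \<Rightarrow> complex \<Rightarrow> complex \<Rightarrow> sym_complex \<Rightarrow> sym_complex" where
  "meixner_operator z z' \<xi> = (THE D. Vector_Spaces.linear sym_scale sym_scale D \<and>
     (\<forall>\<nu>\<in>young_diagrams. D (complexify (FS \<nu>)) =
        - sym_scale (of_nat (card \<nu>)) (complexify (FS \<nu>)) +
        sym_scale (\<xi> / (1 - \<xi>))
          (\<Sum>b\<in>removable \<nu>. sym_scale ((z + of_int (content b)) * (z' + of_int (content b)))
             (complexify (FS (\<nu> - {b}))))))"

definition coeff_A :: "complex \<Rightarrow> complex \<Rightarrow> complex \<Rightarrow> box set \<Rightarrow> box \<Rightarrow> complex" where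
  "coeff_A z z' \<xi> \<mu> b = \<xi> / (1 - \<xi>) * (z + of_int (content b)) * (z' + of_int (content b)) *
     (of_nat (dim_young (insert b \<mu>)) / ((of_nat (card \<mu>) + 1) * of_nat (dim_young \<mu>)))"

definition coeff_B :: "complex \<Rightarrow> box set \<Rightarrow> box \<Rightarrow> complex" where
  "coeff_B \<xi> \<mu> b = 1 / (1 - \<xi>) *
     (of_nat (card \<mu>) * of_nat (dim_young (\<mu> - {b})) / of_nat (dim_young \<mu>))"

definition coeff_C :: "complex \<Rightarrow> complex \<Rightarrow> complex \<Rightarrow> box set \<Rightarrow> complex" where
  "coeff_C z z' \<xi> \<mu> = 1 / (1 - \<xi>) * ((1 + \<xi>) * of_nat (card \<mu>) + \<xi> * z * z')"

end

theory Submission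
  imports Defs
begin

text \<open>Write \<open>m\<^sub>j = \<mu>\<^sub>j - j\<close> and \<open>k\<^sub>i = \<nu>\<^sub>i - i\<close> for the shifted rows of two diagrams, and let
  \<open>\<Phi> (\<mu>, \<nu>)\<close> be the determinant of the matrix with entries \<open>1 / (m\<^sub>j - k\<^sub>i)!\<close> (zero for a negative argument).
  The size of the matrix is irrelevant as soon as it is at least the number of rows of both diagrams (\<open>Phi_stable\<close>).

  Differentiating a determinant along a second matrix column by column or row by row gives the same
  result (\<open>det_deriv_cols\<close>, \<open>det_deriv_rows\<close>). Shifting one \<open>m\<^sub>j\<close> or \<open>k\<^sub>i\<close> by one adds or removes a box, or
  makes the determinant vanish (except for one boundary term), so this yields two identities. First,
  \<open>\<Sum> \<Phi> (\<mu> - \<box>, \<nu>) = (|\<mu>| - |\<nu>|) \<Phi> (\<mu>, \<nu>)\<close> over the removable boxes of \<open>\<mu>\<close> (\<open>Phi_remove_boxes\<close>). Second, with weight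
  \<open>w c = (z + c) (z' + c)\<close>,
  \<open>\<Sum> w(c(\<box>)) \<Phi> (\<mu> + \<box>, \<nu>) - \<Sum> w(c(\<box>)) \<Phi> (\<mu>, \<nu> - \<box>) = (|\<mu>| + |\<nu>| + z z') \<Phi> (\<mu>, \<nu>)\<close>, where the first sum is over
  the addable boxes of \<open>\<mu>\<close> and the second over the removable boxes of \<open>\<nu>\<close> (\<open>Phi_add_boxes\<close>).
  The first identity for empty \<open>\<nu>\<close> is the branching rule up to normalization, so \<open>dim \<mu> = |\<mu>|! \<Phi> (\<mu>, \<emptyset>)\<close> (\<open>dim_young_eq_Phi\<close>).
  The shifted Schur polynomial is a quotient of alternants, so its value at \<open>\<mu>\<close> is
  \<open>\<Phi> (\<mu>, \<nu>) / \<Phi> (\<mu>, \<emptyset>)\<close>. After multiplication by \<open>\<Phi> (\<mu>, \<emptyset>)\<close>, the difference operator applied to the function of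
  \<open>FS\<^sub>\<nu>\<close> becomes a combination of the two identities, and it reduces to the formula that defines the Meixner
  operator (\<open>meixner_difference_schur\<close>). For empty \<open>\<nu>\<close> this says that the coefficients \<open>A\<close> and \<open>B\<close> sum to \<open>C\<close>,
  whence the second form of the operator.

  It remains to see that the \<open>FS\<^sub>\<nu>\<close> exist and span, and that a symmetric function is determined by its
  values on diagrams. The last point is \<open>sym_eq_0_if_vanishes\<close>: a polynomial of degree at most \<open>N\<close> in \<open>p\<^sub>1, p\<^sub>2, \<dots>\<close>
  that vanishes on all diagrams with at most \<open>N\<close> rows vanishes identically on the sums of \<open>N\<close> points of the
  moment curve \<open>(s, s\<^sup>2, s\<^sup>3, \<dots>)\<close>, up to a fixed translation. Differences in the direction of two points of the curve
  lower the degree and \<open>N\<close> together, so by induction the polynomial is invariant under translation by points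
  of the curve; these generate a dense group of translations, so it is constant and therefore zero.

  For existence, multiplying the Vandermonde determinant by a monomial in the power sums gives a combination
  of alternants (\<open>alternant_span_monomial\<close>). So the monomials of weight at most \<open>d\<close> are combinations of the
  shifted Schur functions \<open>S\<^sub>\<nu>\<close> with \<open>|\<nu>| \<le> d\<close>. The monomials are linearly independent, and there is one of weight
  \<open>|\<nu>|\<close> for each \<open>\<nu>\<close>, so a square system of equations can be inverted: every \<open>S\<^sub>\<nu>\<close> is a polynomial in the power
  sums. Independence also shows that the polynomial does not depend on the number of rows. The divisibility
  of the alternants by the Vandermonde product comes out of the same equations.\<close>

section \<open>Determinants and their derivatives\<close>

text \<open>The determinant of the \<open>n \<times> n\<close> matrix with the entries \<open>a i j\<close>, with rows \<open>i\<close> and columns \<open>j\<close> counted from 0.\<close>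
definition sqdet :: "nat \<Rightarrow> (nat \<Rightarrow> nat \<Rightarrow> 'a) \<Rightarrow> 'a::comm_ring_1" where
  "sqdet n a = det (mat n n (\<lambda>(i, j). a i j))"

lemma sqdet_leibniz:
  "sqdet n a = (\<Sum>p | p permutes {..<n}. of_int (sign p) * (\<Prod>i<n. a i (p i)))"
proof -
  have "sqdet n a = (\<Sum>p | p permutes {..<n}.
      of_int (sign p) * (\<Prod>i<n. mat n n (\<lambda>(i, j). a i j) $$ (i, p i)))"
    unfolding sqdet_def atLeast0LessThan[symmetric] by (rule det_def') simp
  also have "\<dots> = (\<Sum>p | p permutes {..<n}. of_int (sign p) * (\<Prod>i<n. a i (p i)))"
  proof (intro sum.cong refl arg_cong[where f = "(*) _"] prod.cong)
    fix p i assume "p \<in> {p. p permutes {..<n}}" "i \<in> {..<n}"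
    thus "mat n n (\<lambda>(i, j). a i j) $$ (i, p i) = a i (p i)"
      using permutes_in_image[of p "{..<n}" i] by simp
  qed
  finally show ?thesis .
qed

lemma sqdet_cong: "(\<And>i j. i < n \<Longrightarrow> j < n \<Longrightarrow> a i j = b i j) \<Longrightarrow> sqdet n a = sqdet n b"
  unfolding sqdet_def by (intro arg_cong[where f = det] eq_matI) auto

lemma sqdet_equal_rows:
  assumes "i < n" "i' < n" "i \<noteq> i'" "\<And>j. j < n \<Longrightarrow> a i j = a i' j"
  shows "sqdet n a = 0"
  unfolding sqdet_def
  by (rule det_identical_rows[where i = i and j = i' and n = n]) (use assms in \<open>auto simp: row_def\<close>)

lemma sqdet_equal_cols:
  assumes "j < n" "j' < n" "j \<noteq> j'" "\<And>i. i < n \<Longrightarrow> a i j = a i j'"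
  shows "sqdet n a = 0"
  unfolding sqdet_def
  by (rule det_identical_columns[where i = j and j = j' and n = n]) (use assms in \<open>auto simp: col_def\<close>)

lemma sqdet_zero_col:
  assumes "j < n" "\<And>i. i < n \<Longrightarrow> a i j = 0"
  shows "sqdet n a = 0"
proof -
  have "(\<Prod>i<n. a i (p i)) = 0" if p: "p permutes {..<n}" for p
  proof -
    obtain i where i: "p i = j"
      using permutes_surj[OF p] by (metis surjD)
    hence "i < n"
      using permutes_in_image[OF p, of i] assms(1) by simp
    thus ?thesis using i assms(2) by (intro prod_zero) auto
  qed
  thus ?thesis by (simp add: sqdet_leibniz)
qed

lemma sqdet_permute_rows:
  assumes "p permutes {..<n}"
  shows "sqdet n (\<lambda>i. a (p i)) = of_int (sign p) * sqdet n a"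
proof -
  let ?A = "mat n n (\<lambda>(i, j). a i j)"
  have "mat n n (\<lambda>(i, j). ?A $$ (p i, j)) = mat n n (\<lambda>(i, j). a (p i) j)"
    using permutes_in_image[OF assms] by (intro eq_matI) auto
  moreover have "det (mat n n (\<lambda>(i, j). ?A $$ (p i, j))) = of_int (sign p) * det ?A"
    by (rule det_permute_rows) (use assms in \<open>auto simp: atLeast0LessThan\<close>)
  ultimately show ?thesis by (simp add: sqdet_def)
qed

lemma sqdet_scale:
  "sqdet n (\<lambda>i j. \<alpha> i * \<beta> j * a i j) = (\<Prod>i<n. \<alpha> i) * (\<Prod>j<n. \<beta> j) * sqdet n a"
proof -
  have "(\<Prod>i<n. \<beta> (p i)) = (\<Prod>j<n. \<beta> j)" if "p permutes {..<n}" for p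
    using prod.permute[OF that, of \<beta>] by (simp add: o_def)
  thus ?thesis
    by (auto simp: sqdet_leibniz prod.distrib sum_distrib_left mult_ac intro!: sum.cong)
qed

lemma sqdet_scale_cols: "sqdet n (\<lambda>i j. \<beta> j * a i j) = (\<Prod>j<n. \<beta> j) * sqdet n a"
  using sqdet_scale[of n "\<lambda>_. 1" \<beta> a] by simp

lemma sqdet_expand_col:
  assumes "c \<le> n" "\<And>i. i < n \<Longrightarrow> a i c = 0"
  shows "sqdet (Suc n) a = (-1) ^ (n + c) * a n c * sqdet n (\<lambda>i j. a i (if j < c then j else Suc j))"
proof -
  let ?A = "mat (Suc n) (Suc n) (\<lambda>(i, j). a i j)"
  have "sqdet (Suc n) a = (\<Sum>i<Suc n. ?A $$ (i, c) * cofactor ?A i c)"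
    unfolding sqdet_def by (rule laplace_expansion_column) (use assms in auto)
  also have "\<dots> = a n c * cofactor ?A n c"
    using assms by simp
  also have "mat_delete ?A n c = mat n n (\<lambda>(i, j). a i (if j < c then j else Suc j))"
    using assms(1) by (intro eq_matI) (auto simp: mat_delete_def)
  hence "cofactor ?A n c = (-1) ^ (n + c) * sqdet n (\<lambda>i j. a i (if j < c then j else Suc j))"
    by (simp add: cofactor_def sqdet_def)
  finally show ?thesis by (simp add: mult_ac)
qed

lemma of_real_sqdet: "complex_of_real (sqdet n a) = sqdet n (\<lambda>i j. complex_of_real (a i j))"
  by (simp add: sqdet_leibniz)

text \<open>The derivative at \<open>a\<close> of the determinant in the direction \<open>b\<close>, that is, the coefficient of \<open>t\<close> in the
  determinant of \<open>a + t b\<close>.\<close>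
definition det_deriv :: "nat \<Rightarrow> (nat \<Rightarrow> nat \<Rightarrow> 'a) \<Rightarrow> (nat \<Rightarrow> nat \<Rightarrow> 'a) \<Rightarrow> 'a::comm_ring_1" where
  "det_deriv n a b = (\<Sum>p | p permutes {..<n}. of_int (sign p) *
     (\<Sum>i<n. b i (p i) * (\<Prod>i'\<in>{..<n} - {i}. a i' (p i'))))"

lemma det_deriv_rows: "det_deriv n a b = (\<Sum>r<n. sqdet n (\<lambda>i. if i = r then b i else a i))"
proof -
  have *: "(\<Prod>i<n. (if i = r then b i else a i) (p i)) =
      b r (p r) * (\<Prod>i'\<in>{..<n} - {r}. a i' (p i'))" if "r < n" for r p
    using that by (subst prod.remove[of _ r]) (auto intro!: arg_cong2[where f = "(*)"] prod.cong)
  have "(\<Sum>r<n. sqdet n (\<lambda>i. if i = r then b i else a i)) =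
      (\<Sum>r<n. \<Sum>p | p permutes {..<n}. of_int (sign p) * (b r (p r) * (\<Prod>i'\<in>{..<n} - {r}. a i' (p i'))))"
    unfolding sqdet_leibniz using * by (intro sum.cong refl) simp
  also have "\<dots> = det_deriv n a b"
    unfolding det_deriv_def sum_distrib_left by (rule sum.swap)
  finally show ?thesis ..
qed

lemma det_deriv_cols:
  "det_deriv n a b = (\<Sum>c<n. sqdet n (\<lambda>i j. if j = c then b i j else a i j))"
proof -
  have *: "(\<Sum>c<n. \<Prod>i<n. (if p i = c then b i (p i) else a i (p i))) =
      (\<Sum>i<n. b i (p i) * (\<Prod>i'\<in>{..<n} - {i}. a i' (p i')))" if p: "p permutes {..<n}" for p
  proof -
    have "(\<Sum>c<n. \<Prod>i<n. (if p i = c then b i (p i) else a i (p i))) =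
        (\<Sum>r<n. \<Prod>i<n. (if p i = p r then b i (p i) else a i (p i)))"
      using sum.permute[OF p, of "\<lambda>c. \<Prod>i<n. (if p i = c then b i (p i) else a i (p i))"]
      by (simp add: o_def)
    also have "\<dots> = (\<Sum>i<n. b i (p i) * (\<Prod>i'\<in>{..<n} - {i}. a i' (p i')))"
    proof (intro sum.cong refl)
      fix r assume "r \<in> {..<n}"
      moreover have "p i = p r \<longleftrightarrow> i = r" for i
        using permutes_inj[OF p] by (auto dest: injD)
      ultimately show "(\<Prod>i<n. (if p i = p r then b i (p i) else a i (p i))) =
          b r (p r) * (\<Prod>i'\<in>{..<n} - {r}. a i' (p i'))"
        by (subst prod.remove[of _ r]) (auto intro!: arg_cong2[where f = "(*)"] prod.cong)
    qed
    finally show ?thesis .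
  qed
  have "(\<Sum>c<n. sqdet n (\<lambda>i j. if j = c then b i j else a i j)) =
      (\<Sum>p | p permutes {..<n}. \<Sum>c<n. of_int (sign p) * (\<Prod>i<n. (if p i = c then b i (p i) else a i (p i))))"
    unfolding sqdet_leibniz by (rule sum.swap)
  also have "\<dots> = det_deriv n a b"
    unfolding det_deriv_def sum_distrib_left[symmetric] using * by (intro sum.cong refl) simp
  finally show ?thesis ..
qed

lemma det_deriv_cong:
  "(\<And>i j. i < n \<Longrightarrow> j < n \<Longrightarrow> b i j = b' i j) \<Longrightarrow> det_deriv n a b = det_deriv n a b'"
  unfolding det_deriv_rows by (intro sum.cong refl sqdet_cong) auto

lemma det_deriv_add:
  "det_deriv n a (\<lambda>i j. b i j + b' i j) = det_deriv n a b + det_deriv n a b'"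
  by (simp add: det_deriv_def sum.distrib distrib_left distrib_right)

text \<open>An entrywise multiplication by \<open>\<alpha> j + \<beta> i\<close> scales the columns and the rows, so it acts on the determinant like a scalar.\<close>
lemma det_deriv_scale:
  "det_deriv n a (\<lambda>i j. (\<alpha> j + \<beta> i) * a i j) = ((\<Sum>j<n. \<alpha> j) + (\<Sum>i<n. \<beta> i)) * sqdet n a"
proof -
  have *: "(\<Sum>i<n. (\<alpha> (p i) + \<beta> i) * a i (p i) * (\<Prod>i'\<in>{..<n} - {i}. a i' (p i'))) =
      ((\<Sum>j<n. \<alpha> j) + (\<Sum>i<n. \<beta> i)) * (\<Prod>i<n. a i (p i))" if p: "p permutes {..<n}" for p
  proof -
    have "(\<Sum>i<n. (\<alpha> (p i) + \<beta> i) * a i (p i) * (\<Prod>i'\<in>{..<n} - {i}. a i' (p i'))) =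
        (\<Sum>i<n. (\<alpha> (p i) + \<beta> i) * (\<Prod>i<n. a i (p i)))"
    proof (intro sum.cong refl)
      fix i assume "i \<in> {..<n}"
      from prod.remove[OF finite_lessThan this, of "\<lambda>i. a i (p i)"]
      show "(\<alpha> (p i) + \<beta> i) * a i (p i) * (\<Prod>i'\<in>{..<n} - {i}. a i' (p i')) =
          (\<alpha> (p i) + \<beta> i) * (\<Prod>i<n. a i (p i))"
        by (simp only: mult.assoc)
    qed
    also have "\<dots> = ((\<Sum>i<n. \<alpha> (p i)) + (\<Sum>i<n. \<beta> i)) * (\<Prod>i<n. a i (p i))"
      by (simp add: sum_distrib_right sum.distrib distrib_right)
    also have "(\<Sum>i<n. \<alpha> (p i)) = (\<Sum>j<n. \<alpha> j)"
      using sum.permute[OF p, of \<alpha>] by (simp add: o_def)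
    finally show ?thesis .
  qed
  show ?thesis
    unfolding det_deriv_def sqdet_leibniz sum_distrib_left[of "_ + _"]
    by (intro sum.cong refl) (simp only: mem_Collect_eq * mult.left_commute)
qed

lemma falling_Suc: "falling x (Suc n) = falling x n * (x - of_nat n)"
  by (simp add: falling_def)

text \<open>The proof subtracts from each row a multiple of the next one so that the first column vanishes except in
  the last row; the multiplier is chosen from
  \<open>falling x (m + 1) - (y - m) falling x m = (x - y) falling x m\<close> with \<open>y = x 0\<close>.\<close>
lemma sqdet_falling_vandermonde:
  "sqdet n (\<lambda>i j. falling (x j) (n - 1 - i)) = (\<Prod>i<n. \<Prod>j\<in>{Suc i..<n}. x i - x j)"
proof (induction n arbitrary: x)
  case 0
  thus ?case by (simp add: sqdet_leibniz)
next
  case (Suc n)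
  let ?M = "mat (Suc n) (Suc n) (\<lambda>(i, j). falling (x j) (n - i))"
  \<comment> \<open>Multiplication by the unitriangular \<open>?L\<close> performs the row operations.\<close>
  let ?L = "mat (Suc n) (Suc n) (\<lambda>(i, j). if j = i then 1 else if j = Suc i
     then - (x 0 - of_nat (n - Suc i)) else 0)"
  define b where "b i j = (if i < n then falling (x j) (n - Suc i) * (x j - x 0) else 1)" for i j
  have "det ?L = 1"
    by (subst det_upper_triangular[where n = "Suc n"])
       (auto simp: upper_triangular_def prod_list_diag_prod)
  moreover have "?L * ?M = mat (Suc n) (Suc n) (\<lambda>(i, j). b i j)"
  proof (intro eq_matI)
    fix i j assume "i < dim_row (mat (Suc n) (Suc n) (\<lambda>(i, j). b i j))"
      "j < dim_col (mat (Suc n) (Suc n) (\<lambda>(i, j). b i j))"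
    hence ij: "i < Suc n" "j < Suc n" by auto
    have "(?L * ?M) $$ (i, j) = (\<Sum>k<Suc n. (if k = i then 1 else if k = Suc i
        then - (x 0 - of_nat (n - Suc i)) else 0) * falling (x j) (n - k))"
      using ij by (simp add: scalar_prod_def atLeast0LessThan)
    also have "\<dots> = (\<Sum>k<Suc n. (if k = i then falling (x j) (n - i) else 0) +
        (if k = Suc i then - (x 0 - of_nat (n - Suc i)) * falling (x j) (n - Suc i) else 0))"
      by (intro sum.cong) auto
    also have "\<dots> = falling (x j) (n - i) +
        (if i < n then - (x 0 - of_nat (n - Suc i)) * falling (x j) (n - Suc i) else 0)"
      using ij by (simp only: sum.distrib) auto
    also have "\<dots> = b i j"
    proof (cases "i < n")
      case True
      hence "falling (x j) (n - i) = falling (x j) (n - Suc i) * (x j - of_nat (n - Suc i))"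
        using falling_Suc[of "x j" "n - Suc i"] by (simp add: Suc_diff_Suc)
      thus ?thesis using True by (simp add: b_def algebra_simps)
    next
      case False
      thus ?thesis using ij by (simp add: b_def falling_def)
    qed
    finally show "(?L * ?M) $$ (i, j) = mat (Suc n) (Suc n) (\<lambda>(i, j). b i j) $$ (i, j)"
      using ij by simp
  qed auto
  moreover have "det (?L * ?M) = det ?L * det ?M"
    by (rule det_mult) auto
  ultimately have "sqdet (Suc n) (\<lambda>i j. falling (x j) (n - i)) = sqdet (Suc n) b"
    by (simp add: sqdet_def)
  also have "\<dots> = (-1) ^ n * sqdet n (\<lambda>i j. b i (Suc j))"
    by (subst sqdet_expand_col[where c = 0]) (auto simp: b_def)
  also have "sqdet n (\<lambda>i j. b i (Suc j)) =
      sqdet n (\<lambda>i j. (x (Suc j) - x 0) * falling (x (Suc j)) (n - 1 - i))"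
    by (rule sqdet_cong) (simp add: b_def mult.commute)
  also have "\<dots> = (\<Prod>j<n. x (Suc j) - x 0) * (\<Prod>i<n. \<Prod>j\<in>{Suc i..<n}. x (Suc i) - x (Suc j))"
    by (simp only: sqdet_scale_cols Suc.IH[of "\<lambda>j. x (Suc j)"])
  also have "(-1) ^ n * ((\<Prod>j<n. x (Suc j) - x 0) * (\<Prod>i<n. \<Prod>j\<in>{Suc i..<n}. x (Suc i) - x (Suc j))) =
      (\<Prod>j<n. x 0 - x (Suc j)) * (\<Prod>i<n. \<Prod>j\<in>{Suc i..<n}. x (Suc i) - x (Suc j))"
  proof -
    have "(\<Prod>j<n. x 0 - x (Suc j)) = (\<Prod>j<n. (-1) * (x (Suc j) - x 0))"
      by (intro prod.cong) auto
    also have "\<dots> = (-1) ^ n * (\<Prod>j<n. x (Suc j) - x 0)"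
      by (subst prod.distrib) simp
    finally show ?thesis by simp
  qed
  also have "\<dots> = (\<Prod>i<Suc n. \<Prod>j\<in>{Suc i..<Suc n}. x i - x j)"
    by (simp only: prod.lessThan_Suc_shift prod.atLeast_Suc_lessThan_Suc_shift o_def
        lessThan_atLeast0[symmetric] atLeast0LessThan)
  finally show ?case by simp
qed

section \<open>Rows of Young diagrams\<close>

text \<open>Row lengths with the rows counted from 0, as the indices of a matrix.\<close>
definition rowlen :: "box set \<Rightarrow> nat \<Rightarrow> nat" where
  "rowlen \<mu> i = row_len \<mu> (Suc i)"

text \<open>The set of boxes with row lengths \<open>f 0, f 1, \<dots>\<close>; it is a Young diagram if \<open>f\<close> decreases and is eventually zero.\<close>
definition diagram_of :: "(nat \<Rightarrow> nat) \<Rightarrow> box set" where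
  "diagram_of f = {(Suc i, Suc j) | i j. j < f i}"

lemma finite_young: "\<mu> \<in> young_diagrams \<Longrightarrow> finite \<mu>"
  by (simp add: young_diagrams_def)

lemma young_diagramsI:
  assumes "finite \<mu>" "\<mu> \<subseteq> {1..} \<times> {1..}"
    and "\<And>i j i' j'. (i, j) \<in> \<mu> \<Longrightarrow> 1 \<le> i' \<Longrightarrow> i' \<le> i \<Longrightarrow> 1 \<le> j' \<Longrightarrow> j' \<le> j \<Longrightarrow> (i', j') \<in> \<mu>"
  shows "\<mu> \<in> young_diagrams"
  unfolding young_diagrams_def using assms by blast

lemma young_diagrams_downD:
  assumes "\<mu> \<in> young_diagrams" "(i, j) \<in> \<mu>" "1 \<le> i'" "i' \<le> i" "1 \<le> j'" "j' \<le> j"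
  shows "(i', j') \<in> \<mu>"
  using assms unfolding young_diagrams_def by blast

lemma down_closed_eq_atLeastAtMost:
  fixes S :: "nat set"
  assumes "finite S" "S \<subseteq> {1..}" "\<And>j j'. j \<in> S \<Longrightarrow> 1 \<le> j' \<Longrightarrow> j' \<le> j \<Longrightarrow> j' \<in> S"
  shows "S = {1..card S}"
proof (cases "S = {}")
  case False
  have "S = {1..Max S}"
  proof (intro equalityI subsetI)
    fix j assume "j \<in> S"
    thus "j \<in> {1..Max S}" using assms(2) Max_ge[OF assms(1)] by auto
  next
    fix j assume "j \<in> {1..Max S}"
    thus "j \<in> S" using assms(3)[OF Max_in[OF assms(1) False]] by simp
  qed
  moreover have "card {1..Max S} = Max S" by simp
  ultimately show ?thesis by argo
qed simp

lemma mem_young_iff_row_len: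
  assumes "\<mu> \<in> young_diagrams"
  shows "(i, j) \<in> \<mu> \<longleftrightarrow> 1 \<le> j \<and> j \<le> row_len \<mu> i"
proof -
  have fin: "finite \<mu>" and pos: "\<mu> \<subseteq> {1..} \<times> {1..}"
    and dc: "\<And>i j i' j'. (i, j) \<in> \<mu> \<Longrightarrow> 1 \<le> i' \<Longrightarrow> i' \<le> i \<Longrightarrow> 1 \<le> j' \<Longrightarrow> j' \<le> j \<Longrightarrow> (i', j') \<in> \<mu>"
    using assms unfolding young_diagrams_def by blast+
  let ?S = "{j. (i, j) \<in> \<mu>}"
  have "?S \<subseteq> snd ` \<mu>" by force
  hence "finite ?S" using fin by (meson finite_imageI finite_subset)
  hence "?S = {1..card ?S}"
    by (rule down_closed_eq_atLeastAtMost) (use pos dc in auto)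
  hence "j \<in> ?S \<longleftrightarrow> j \<in> {1..card ?S}" by blast
  thus ?thesis by (simp add: row_len_def)
qed

lemma mem_young_iff:
  assumes "\<mu> \<in> young_diagrams"
  shows "(i, j) \<in> \<mu> \<longleftrightarrow> 1 \<le> i \<and> 1 \<le> j \<and> j \<le> rowlen \<mu> (i - 1)"
proof (cases i)
  case 0
  thus ?thesis using assms by (auto simp: young_diagrams_def)
next
  case (Suc i')
  thus ?thesis using mem_young_iff_row_len[OF assms] by (simp add: rowlen_def)
qed

lemma row_antimono:
  assumes "\<mu> \<in> young_diagrams" "i \<le> i'"
  shows "rowlen \<mu> i' \<le> rowlen \<mu> i"
proof (cases "rowlen \<mu> i' = 0")
  case False
  hence "(Suc i', rowlen \<mu> i') \<in> \<mu>" by (simp add: mem_young_iff[OF assms(1)])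
  hence "(Suc i, rowlen \<mu> i') \<in> \<mu>"
    using assms False by (auto intro!: young_diagrams_downD[OF assms(1), of "Suc i'" "rowlen \<mu> i'" "Suc i" "rowlen \<mu> i'"])
  thus ?thesis by (simp add: mem_young_iff[OF assms(1)])
qed simp

lemma young_eq_diagram_of:
  assumes "\<mu> \<in> young_diagrams"
  shows "\<mu> = diagram_of (rowlen \<mu>)"
proof -
  have "(i, j) \<in> \<mu> \<longleftrightarrow> (i, j) \<in> diagram_of (rowlen \<mu>)" for i j
    unfolding mem_young_iff[OF assms] diagram_of_def by (cases i; cases j) auto
  thus ?thesis by auto
qed

lemma young_eqI:
  assumes "\<mu> \<in> young_diagrams" "\<nu> \<in> young_diagrams" "\<And>i. rowlen \<mu> i = rowlen \<nu> i"
  shows "\<mu> = \<nu>"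
  using young_eq_diagram_of[OF assms(1)] young_eq_diagram_of[OF assms(2)] ext[of "rowlen \<mu>" "rowlen \<nu>", OF assms(3)]
  by simp

lemma row_len_0 [simp]: "\<mu> \<in> young_diagrams \<Longrightarrow> row_len \<mu> 0 = 0"
proof -
  assume "\<mu> \<in> young_diagrams"
  hence "{j. (0, j) \<in> \<mu>} = {}" by (auto simp: young_diagrams_def)
  thus ?thesis by (simp add: row_len_def)
qed

lemma row_diagram_of [simp]: "rowlen (diagram_of f) i = f i"
proof -
  have "{j. (Suc i, j) \<in> diagram_of f} = Suc ` {..<f i}"
    by (auto simp: diagram_of_def)
  thus ?thesis by (simp add: rowlen_def row_len_def card_image)
qed

lemma diagram_of_young:
  assumes "antimono f" "\<And>i. N \<le> i \<Longrightarrow> f i = 0"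
  shows "diagram_of f \<in> young_diagrams"
proof -
  have "diagram_of f \<subseteq> (\<lambda>(i, j). (Suc i, Suc j)) ` ({..<N} \<times> {..<f 0})"
  proof
    fix b assume "b \<in> diagram_of f"
    then obtain i j where "b = (Suc i, Suc j)" "j < f i" by (auto simp: diagram_of_def)
    moreover have "f i \<le> f 0" using assms(1) by (simp add: antimonoD)
    moreover have "i < N" using assms(2)[of i] \<open>j < f i\<close> by (cases "i < N") auto
    ultimately show "b \<in> (\<lambda>(i, j). (Suc i, Suc j)) ` ({..<N} \<times> {..<f 0})" by force
  qed
  hence "finite (diagram_of f)" by (rule finite_subset) simp
  moreover have "(i', j') \<in> diagram_of f" if "(i, j) \<in> diagram_of f" "1 \<le> i'" "i' \<le> i" "1 \<le> j'" "j' \<le> j"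
    for i j i' j'
  proof -
    from that obtain a b where ab: "i = Suc a" "j = Suc b" "b < f a" by (auto simp: diagram_of_def)
    from that obtain a' b' where ab': "i' = Suc a'" "j' = Suc b'" by (cases i'; cases j') auto
    have "f a \<le> f a'" using assms(1) ab ab' that by (simp add: antimonoD)
    thus ?thesis using ab ab' that by (auto simp: diagram_of_def)
  qed
  ultimately show ?thesis
    unfolding young_diagrams_def by (auto simp: diagram_of_def)
qed

lemma finite_row_support: "\<mu> \<in> young_diagrams \<Longrightarrow> finite {i. rowlen \<mu> i \<noteq> 0}"
proof -
  assume \<mu>: "\<mu> \<in> young_diagrams"
  have "Suc ` {i. rowlen \<mu> i \<noteq> 0} \<subseteq> fst ` \<mu>"
  proof
    fix x assume "x \<in> Suc ` {i. rowlen \<mu> i \<noteq> 0}"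
    then obtain i where "x = Suc i" "rowlen \<mu> i \<noteq> 0" by auto
    hence "(x, 1) \<in> \<mu>" by (simp add: mem_young_iff[OF \<mu>])
    thus "x \<in> fst ` \<mu>" by force
  qed
  thus ?thesis using finite_young[OF \<mu>] by (meson finite_imageD finite_imageI finite_subset inj_Suc inj_on_subset subset_UNIV)
qed

lemma row_eq_0_iff:
  assumes "\<mu> \<in> young_diagrams"
  shows "rowlen \<mu> i = 0 \<longleftrightarrow> num_rows \<mu> \<le> i"
proof -
  have "{i. row_len \<mu> i \<noteq> 0} = Suc ` {i. rowlen \<mu> i \<noteq> 0}"
  proof (intro Set.set_eqI iffI)
    fix i assume "i \<in> {i. row_len \<mu> i \<noteq> 0}"
    thus "i \<in> Suc ` {i. rowlen \<mu> i \<noteq> 0}" using assms by (cases i) (auto simp: rowlen_def)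
  qed (auto simp: rowlen_def)
  moreover have "Suc ` {i. rowlen \<mu> i \<noteq> 0} = {1..card (Suc ` {i. rowlen \<mu> i \<noteq> 0})}"
  proof (rule down_closed_eq_atLeastAtMost)
    fix j j' assume "j \<in> Suc ` {i. rowlen \<mu> i \<noteq> 0}" "1 \<le> j'" "j' \<le> j"
    then obtain a b where "j = Suc a" "rowlen \<mu> a \<noteq> 0" "j' = Suc b" "b \<le> a" by (cases j') auto
    thus "j' \<in> Suc ` {i. rowlen \<mu> i \<noteq> 0}"
      using row_antimono[OF assms, of b a] by auto
  qed (use finite_row_support[OF assms] in auto)
  ultimately have "Suc ` {i. rowlen \<mu> i \<noteq> 0} = {1..num_rows \<mu>}"
    by (simp add: num_rows_def)
  hence "Suc i \<in> Suc ` {i. rowlen \<mu> i \<noteq> 0} \<longleftrightarrow> Suc i \<in> {1..num_rows \<mu>}" by blast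
  thus ?thesis by auto
qed

lemma sum_young_rows:
  assumes "\<mu> \<in> young_diagrams" "num_rows \<mu> \<le> N"
  shows "(\<Sum>b\<in>\<mu>. g b) = (\<Sum>i<N. \<Sum>j<rowlen \<mu> i. g (Suc i, Suc j))"
proof -
  have "\<mu> = (\<lambda>(i, j). (Suc i, Suc j)) ` (SIGMA i:{..<N}. {..<rowlen \<mu> i})" (is "_ = ?f ` ?S")
  proof (intro Set.set_eqI iffI)
    fix b assume "b \<in> \<mu>"
    hence "b \<in> diagram_of (rowlen \<mu>)" using young_eq_diagram_of[OF assms(1)] by simp
    then obtain i j where *: "b = (Suc i, Suc j)" "j < rowlen \<mu> i" by (auto simp: diagram_of_def)
    hence "i < N" using row_eq_0_iff[OF assms(1), of i] assms(2) by (cases "i < N") auto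
    thus "b \<in> ?f ` ?S" using * by force
  next
    fix b assume "b \<in> ?f ` ?S"
    hence "b \<in> diagram_of (rowlen \<mu>)" by (auto simp: diagram_of_def)
    thus "b \<in> \<mu>" using young_eq_diagram_of[OF assms(1)] by simp
  qed
  moreover have "inj_on ?f ?S" by (auto simp: inj_on_def)
  ultimately have "(\<Sum>b\<in>\<mu>. g b) = (\<Sum>x\<in>?S. g (?f x))"
    using sum.reindex[of ?f ?S g] by (simp add: o_def)
  also have "\<dots> = (\<Sum>i<N. \<Sum>j<rowlen \<mu> i. g (Suc i, Suc j))"
    by (subst sum.Sigma) (auto simp: case_prod_beta)
  finally show ?thesis .
qed

lemma card_eq_sum_rows:
  assumes "\<mu> \<in> young_diagrams" "num_rows \<mu> \<le> N"
  shows "card \<mu> = (\<Sum>i<N. rowlen \<mu> i)"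
  using sum_young_rows[OF assms, of "\<lambda>_. 1::nat"] by simp

lemma num_rows_le_card:
  assumes "\<mu> \<in> young_diagrams"
  shows "num_rows \<mu> \<le> card \<mu>"
proof -
  have "(\<Sum>i<num_rows \<mu>. 1) \<le> (\<Sum>i<num_rows \<mu>. rowlen \<mu> i)"
  proof (rule sum_mono)
    fix i assume "i \<in> {..<num_rows \<mu>}"
    thus "1 \<le> rowlen \<mu> i" using row_eq_0_iff[OF assms, of i] by simp
  qed
  thus ?thesis using card_eq_sum_rows[OF assms order.refl] by simp
qed

lemma addable_eq:
  assumes "\<mu> \<in> young_diagrams"
  shows "addable \<mu> = (\<lambda>i. (Suc i, Suc (rowlen \<mu> i))) ` {i. i = 0 \<or> rowlen \<mu> i < rowlen \<mu> (i - 1)}"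
proof (intro Set.set_eqI iffI)
  fix b assume b: "b \<in> addable \<mu>"
  obtain i j where ij: "b = (i, j)" by (cases b)
  have bn: "(i, j) \<notin> \<mu>" and Y: "insert (i, j) \<mu> \<in> young_diagrams"
    using b ij by (auto simp: addable_def)
  have "i \<noteq> 0" "j \<noteq> 0" using Y by (auto simp: young_diagrams_def)
  then obtain a c where ac: "i = Suc a" "j = Suc c" by (cases i; cases j) auto
  have dc: "(i', j') \<in> \<mu>" if "1 \<le> i'" "i' \<le> i" "1 \<le> j'" "j' \<le> j" "(i', j') \<noteq> (i, j)" for i' j'
  proof -
    have "(i', j') \<in> insert (i, j) \<mu>" using Y that unfolding young_diagrams_def by blast
    thus ?thesis using that by auto
  qed
  have "c \<le> rowlen \<mu> a"
    using dc[of i c] ac mem_young_iff[OF assms] by (cases "c = 0") auto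
  hence "c = rowlen \<mu> a" using bn ac mem_young_iff[OF assms] by auto
  moreover have "rowlen \<mu> a < rowlen \<mu> (a - 1)" if "a \<noteq> 0"
    using dc[of a j] ac that mem_young_iff[OF assms] \<open>c = rowlen \<mu> a\<close> by auto
  ultimately show "b \<in> (\<lambda>i. (Suc i, Suc (rowlen \<mu> i))) ` {i. i = 0 \<or> rowlen \<mu> i < rowlen \<mu> (i - 1)}"
    using ij ac by auto
next
  fix b assume "b \<in> (\<lambda>i. (Suc i, Suc (rowlen \<mu> i))) ` {i. i = 0 \<or> rowlen \<mu> i < rowlen \<mu> (i - 1)}"
  then obtain a where a: "b = (Suc a, Suc (rowlen \<mu> a))" "a = 0 \<or> rowlen \<mu> a < rowlen \<mu> (a - 1)" by auto
  have mem: "b \<notin> \<mu>" using a mem_young_iff[OF assms] by auto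
  have "(i', j') \<in> insert b \<mu>"
    if "(i, j) \<in> insert b \<mu>" "1 \<le> i'" "i' \<le> i" "1 \<le> j'" "j' \<le> j" for i j i' j'
  proof (cases "(i, j) \<in> \<mu>")
    case True
    thus ?thesis using that young_diagrams_downD[OF assms] by blast
  next
    case False
    hence ij: "i = Suc a" "j = Suc (rowlen \<mu> a)" using that a by auto
    show ?thesis
    proof (cases "i' = i")
      case True
      thus ?thesis using that ij a mem_young_iff[OF assms] by auto
    next
      case False
      hence "a \<noteq> 0" "i' - 1 \<le> a - 1" using that ij by auto
      hence "rowlen \<mu> (a - 1) \<le> rowlen \<mu> (i' - 1)" "rowlen \<mu> a < rowlen \<mu> (a - 1)"
        using row_antimono[OF assms] a by auto
      thus ?thesis using that ij mem_young_iff[OF assms] by auto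
    qed
  qed
  moreover have "finite (insert b \<mu>)" "insert b \<mu> \<subseteq> {1..} \<times> {1..}"
    using assms a by (auto simp: young_diagrams_def)
  ultimately have "insert b \<mu> \<in> young_diagrams"
    by (intro young_diagramsI)
  with mem show "b \<in> addable \<mu>" by (simp add: addable_def)
qed

lemma removable_eq:
  assumes "\<mu> \<in> young_diagrams"
  shows "removable \<mu> = (\<lambda>i. (Suc i, rowlen \<mu> i)) ` {i. rowlen \<mu> (Suc i) < rowlen \<mu> i}"
proof (intro Set.set_eqI iffI)
  fix b assume b: "b \<in> removable \<mu>"
  obtain i j where ij: "b = (i, j)" by (cases b)
  have bn: "(i, j) \<in> \<mu>" and Y: "\<mu> - {(i, j)} \<in> young_diagrams"
    using b ij by (auto simp: removable_def)
  obtain a where a: "i = Suc a" "1 \<le> j" "j \<le> rowlen \<mu> a"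
    using bn mem_young_iff[OF assms] by (cases i) auto
  have up: "(i', j') \<notin> \<mu>" if "i \<le> i'" "j \<le> j'" "(i', j') \<noteq> (i, j)" for i' j'
  proof
    assume "(i', j') \<in> \<mu>"
    hence "(i', j') \<in> \<mu> - {(i, j)}" using that by simp
    hence "(i, j) \<in> \<mu> - {(i, j)}"
      by (rule young_diagrams_downD[OF Y]) (use a that in auto)
    thus False by simp
  qed
  have "j = rowlen \<mu> a" using up[of i "Suc j"] a mem_young_iff[OF assms] by auto
  moreover have "rowlen \<mu> (Suc a) < rowlen \<mu> a"
    using up[of "Suc i" j] a mem_young_iff[OF assms] calculation by auto
  ultimately show "b \<in> (\<lambda>i. (Suc i, rowlen \<mu> i)) ` {i. rowlen \<mu> (Suc i) < rowlen \<mu> i}"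
    using ij a by auto
next
  fix b assume "b \<in> (\<lambda>i. (Suc i, rowlen \<mu> i)) ` {i. rowlen \<mu> (Suc i) < rowlen \<mu> i}"
  then obtain a where a: "b = (Suc a, rowlen \<mu> a)" "rowlen \<mu> (Suc a) < rowlen \<mu> a" by auto
  have mem: "b \<in> \<mu>" using a mem_young_iff[OF assms] by auto
  have "(i', j') \<in> \<mu> - {b}"
    if "(i, j) \<in> \<mu> - {b}" "1 \<le> i'" "i' \<le> i" "1 \<le> j'" "j' \<le> j" for i j i' j'
  proof -
    have "(i', j') \<in> \<mu>" using that young_diagrams_downD[OF assms] by blast
    moreover have "(i', j') \<noteq> b"
    proof
      assume "(i', j') = b"
      hence i: "Suc a \<le> i" "rowlen \<mu> a \<le> j" "j \<le> rowlen \<mu> (i - 1)"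
        using that a mem_young_iff[OF assms] by auto
      have "i - 1 \<noteq> a"
        using i that a by auto
      hence "rowlen \<mu> (i - 1) \<le> rowlen \<mu> (Suc a)" using i by (intro row_antimono[OF assms]) auto
      thus False using i a by auto
    qed
    ultimately show ?thesis by simp
  qed
  moreover have "finite (\<mu> - {b})" "\<mu> - {b} \<subseteq> {1..} \<times> {1..}"
    using assms a by (auto simp: young_diagrams_def)
  ultimately have "\<mu> - {b} \<in> young_diagrams"
    by (intro young_diagramsI)
  with mem show "b \<in> removable \<mu>" by (simp add: removable_def)
qed

lemma row_insert:
  assumes "\<mu> \<in> young_diagrams"
  shows "rowlen (insert (Suc a, Suc (rowlen \<mu> a)) \<mu>) = (rowlen \<mu>)(a := Suc (rowlen \<mu> a))"
proof
  fix i
  have "{j. (Suc i, j) \<in> insert (Suc a, Suc (rowlen \<mu> a)) \<mu>} =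
      {1..((rowlen \<mu>)(a := Suc (rowlen \<mu> a))) i}"
    using mem_young_iff[OF assms] by auto
  thus "rowlen (insert (Suc a, Suc (rowlen \<mu> a)) \<mu>) i = ((rowlen \<mu>)(a := Suc (rowlen \<mu> a))) i"
    by (simp add: rowlen_def row_len_def)
qed

lemma row_remove:
  assumes "\<mu> \<in> young_diagrams"
  shows "rowlen (\<mu> - {(Suc a, rowlen \<mu> a)}) = (rowlen \<mu>)(a := rowlen \<mu> a - 1)"
proof
  fix i
  have "{j. (Suc i, j) \<in> \<mu> - {(Suc a, rowlen \<mu> a)}} = {1..((rowlen \<mu>)(a := rowlen \<mu> a - 1)) i}"
    using mem_young_iff[OF assms] by auto
  thus "rowlen (\<mu> - {(Suc a, rowlen \<mu> a)}) i = ((rowlen \<mu>)(a := rowlen \<mu> a - 1)) i"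
    by (simp add: rowlen_def row_len_def)
qed

lemma addable_index_less:
  assumes "\<mu> \<in> young_diagrams" "num_rows \<mu> < N" "i = 0 \<or> rowlen \<mu> i < rowlen \<mu> (i - 1)"
  shows "i < N"
  using assms row_eq_0_iff[OF assms(1), of "i - 1"] by (cases "i < N") auto

lemma removable_index_less:
  assumes "\<mu> \<in> young_diagrams" "num_rows \<mu> \<le> N" "rowlen \<mu> (Suc i) < rowlen \<mu> i"
  shows "i < N"
  using assms row_eq_0_iff[OF assms(1), of i] by (cases "i < N") auto

lemma sum_addable:
  assumes "\<mu> \<in> young_diagrams" "num_rows \<mu> < N"
  shows "(\<Sum>b\<in>addable \<mu>. g b) =
    (\<Sum>i<N. if i = 0 \<or> rowlen \<mu> i < rowlen \<mu> (i - 1) then g (Suc i, Suc (rowlen \<mu> i)) else 0)"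
proof -
  let ?I = "{i. i = 0 \<or> rowlen \<mu> i < rowlen \<mu> (i - 1)}"
  have "(\<Sum>b\<in>addable \<mu>. g b) = (\<Sum>i\<in>?I. g (Suc i, Suc (rowlen \<mu> i)))"
    unfolding addable_eq[OF assms(1)] by (subst sum.reindex) (auto simp: inj_on_def)
  also have "\<dots> = (\<Sum>i\<in>{i\<in>{..<N}. i = 0 \<or> rowlen \<mu> i < rowlen \<mu> (i - 1)}. g (Suc i, Suc (rowlen \<mu> i)))"
    by (rule sum.cong) (use addable_index_less[OF assms] in auto)
  also have "\<dots> = (\<Sum>i<N. if i = 0 \<or> rowlen \<mu> i < rowlen \<mu> (i - 1) then g (Suc i, Suc (rowlen \<mu> i)) else 0)"
    by (rule sum.inter_filter) simp
  finally show ?thesis .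
qed

lemma sum_removable:
  assumes "\<mu> \<in> young_diagrams" "num_rows \<mu> \<le> N"
  shows "(\<Sum>b\<in>removable \<mu>. g b) =
    (\<Sum>i<N. if rowlen \<mu> (Suc i) < rowlen \<mu> i then g (Suc i, rowlen \<mu> i) else 0)"
proof -
  let ?I = "{i. rowlen \<mu> (Suc i) < rowlen \<mu> i}"
  have "(\<Sum>b\<in>removable \<mu>. g b) = (\<Sum>i\<in>?I. g (Suc i, rowlen \<mu> i))"
    unfolding removable_eq[OF assms(1)] by (subst sum.reindex) (auto simp: inj_on_def)
  also have "\<dots> = (\<Sum>i\<in>{i\<in>{..<N}. rowlen \<mu> (Suc i) < rowlen \<mu> i}. g (Suc i, rowlen \<mu> i))"
    by (rule sum.cong) (use removable_index_less[OF assms] in auto)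
  also have "\<dots> = (\<Sum>i<N. if rowlen \<mu> (Suc i) < rowlen \<mu> i then g (Suc i, rowlen \<mu> i) else 0)"
    by (rule sum.inter_filter) simp
  finally show ?thesis .
qed

lemma addable_facts:
  assumes "\<mu> \<in> young_diagrams" "b \<in> addable \<mu>"
  shows "insert b \<mu> \<in> young_diagrams" "card (insert b \<mu>) = Suc (card \<mu>)"
  using assms finite_young[OF assms(1)] by (auto simp: addable_def)

lemma removable_facts:
  assumes "\<mu> \<in> young_diagrams" "b \<in> removable \<mu>"
  shows "\<mu> - {b} \<in> young_diagrams" "card \<mu> = Suc (card (\<mu> - {b}))"
  using assms card.remove[OF finite_young[OF assms(1)], of b] by (auto simp: removable_def)

lemma finite_removable: "\<mu> \<in> young_diagrams \<Longrightarrow> finite (removable \<mu>)"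
  by (rule finite_subset[of _ \<mu>]) (auto simp: removable_def finite_young)

section \<open>Evaluation of polynomials\<close>

text \<open>The value of a monomial, given by its exponents, at the point \<open>\<sigma>\<close>.\<close>
definition monom_val :: "(nat \<Rightarrow> 'a) \<Rightarrow> (nat \<Rightarrow>\<^sub>0 nat) \<Rightarrow> 'a::comm_ring_1" where
  "monom_val \<sigma> m = (\<Prod>n\<in>Poly_Mapping.keys m. \<sigma> n ^ Poly_Mapping.lookup m n)"

lemma peval_monom_val:
  "peval h \<sigma> p = (\<Sum>m\<in>Poly_Mapping.keys p. h (Poly_Mapping.lookup p m) * monom_val \<sigma> m)"
  by (simp add: peval_def monom_val_def)

lemma monom_val_superset:
  assumes "finite A" "Poly_Mapping.keys m \<subseteq> A"
  shows "monom_val \<sigma> m = (\<Prod>n\<in>A. \<sigma> n ^ Poly_Mapping.lookup m n)"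
  unfolding monom_val_def using assms by (intro prod.mono_neutral_left) (auto simp: in_keys_iff)

lemma monom_val_0 [simp]: "monom_val \<sigma> 0 = 1"
  by (simp add: monom_val_def)

lemma monom_val_single: "monom_val \<sigma> (Poly_Mapping.single n k) = \<sigma> n ^ k"
  by (simp add: monom_val_superset[of "{n}"])

lemma monom_val_add: "monom_val \<sigma> (m + m') = monom_val \<sigma> m * monom_val \<sigma> m'"
proof -
  let ?A = "Poly_Mapping.keys m \<union> Poly_Mapping.keys m'"
  have "Poly_Mapping.keys (m + m') \<subseteq> ?A" by (rule Poly_Mapping.keys_add)
  thus ?thesis
    by (simp add: monom_val_superset[of ?A] lookup_add power_add prod.distrib)
qed

lemma poly_ring_sum_monomials:
  "p = (\<Sum>m\<in>Poly_Mapping.keys p. Poly_Mapping.single m (Poly_Mapping.lookup p m))"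
proof (rule poly_mapping_eqI)
  fix k
  have "Poly_Mapping.lookup (\<Sum>m\<in>Poly_Mapping.keys p. Poly_Mapping.single m (Poly_Mapping.lookup p m)) k =
      (\<Sum>m\<in>Poly_Mapping.keys p. if k = m then Poly_Mapping.lookup p m else 0)"
    unfolding lookup_sum by (intro sum.cong) (auto simp: lookup_single when_def)
  also have "\<dots> = Poly_Mapping.lookup p k"
    by (simp add: in_keys_iff)
  finally show "Poly_Mapping.lookup p k = Poly_Mapping.lookup
      (\<Sum>m\<in>Poly_Mapping.keys p. Poly_Mapping.single m (Poly_Mapping.lookup p m)) k" ..
qed

context comm_ring_hom
begin

lemma peval_superset:
  assumes "finite A" "Poly_Mapping.keys p \<subseteq> A"
  shows "peval hom \<sigma> p = (\<Sum>m\<in>A. hom (Poly_Mapping.lookup p m) * monom_val \<sigma> m)"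
  unfolding peval_monom_val using assms
  by (intro sum.mono_neutral_left) (auto simp: in_keys_iff)

lemma peval_single: "peval hom \<sigma> (Poly_Mapping.single m c) = hom c * monom_val \<sigma> m"
  by (simp add: peval_superset[of "{m}"])

lemma peval_0 [simp]: "peval hom \<sigma> 0 = 0"
  by (simp add: peval_monom_val)

lemma peval_add: "peval hom \<sigma> (p + q) = peval hom \<sigma> p + peval hom \<sigma> q"
proof -
  let ?A = "Poly_Mapping.keys p \<union> Poly_Mapping.keys q"
  have "Poly_Mapping.keys (p + q) \<subseteq> ?A" by (rule Poly_Mapping.keys_add)
  thus ?thesis
    by (simp add: peval_superset[of ?A] lookup_add hom_add distrib_right sum.distrib)
qed

lemma peval_sum: "peval hom \<sigma> (\<Sum>x\<in>A. f x) = (\<Sum>x\<in>A. peval hom \<sigma> (f x))"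
  by (induction A rule: infinite_finite_induct) (auto simp: peval_add)

lemma peval_mult: "peval hom \<sigma> (p * q) = peval hom \<sigma> p * peval hom \<sigma> q"
proof -
  let ?K = Poly_Mapping.keys and ?l = Poly_Mapping.lookup
  have "p * q = (\<Sum>m\<in>?K p. Poly_Mapping.single m (?l p m)) * (\<Sum>m\<in>?K q. Poly_Mapping.single m (?l q m))"
    using poly_ring_sum_monomials[of p] poly_ring_sum_monomials[of q] by simp
  also have "\<dots> = (\<Sum>m\<in>?K p. \<Sum>m'\<in>?K q. Poly_Mapping.single (m + m') (?l p m * ?l q m'))"
    by (simp add: sum_product mult_single)
  finally have "peval hom \<sigma> (p * q) =
      (\<Sum>m\<in>?K p. \<Sum>m'\<in>?K q. hom (?l p m * ?l q m') * monom_val \<sigma> (m + m'))"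
    by (simp only: peval_sum peval_single)
  also have "\<dots> = peval hom \<sigma> p * peval hom \<sigma> q"
    by (simp add: peval_monom_val sum_product monom_val_add hom_mult mult_ac)
  finally show ?thesis .
qed

lemma peval_const: "peval hom \<sigma> (pconst c) = hom c"
  by (simp add: pconst_def peval_single)

lemma peval_var: "peval hom \<sigma> (pvar n) = \<sigma> n"
  by (simp add: pvar_def peval_single monom_val_single)

lemma peval_hom: "comm_ring_hom (peval hom \<sigma>)"
proof
  show "peval hom \<sigma> 1 = 1"
    using peval_const[of \<sigma> 1] by (simp add: pconst_def)
qed (auto simp: peval_add peval_mult)

lemma hom_peval: "hom (peval g \<tau> F) = peval (\<lambda>c. hom (g c)) (\<lambda>n. hom (\<tau> n)) F"
  by (simp add: peval_def hom_distribs)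

end

lemma comm_ring_hom_id: "comm_ring_hom id"
  by unfold_locales auto

lemma comm_ring_hom_pconst: "comm_ring_hom pconst"
  by unfold_locales (auto simp: pconst_def single_add mult_single)

lemma comm_ring_hom_of_real: "comm_ring_hom complex_of_real"
  by unfold_locales auto

lemma comm_ring_hom_pconst_of_real: "comm_ring_hom (\<lambda>c. pconst (complex_of_real c))"
  by unfold_locales (auto simp: pconst_def single_add mult_single)

lemmas peval_id_simps = comm_ring_hom.peval_const[OF comm_ring_hom_id] comm_ring_hom.peval_var[OF comm_ring_hom_id]
  comm_ring_hom.peval_add[OF comm_ring_hom_id] comm_ring_hom.peval_mult[OF comm_ring_hom_id]
  comm_ring_hom.peval_sum[OF comm_ring_hom_id]

lemma peval_id_hom: "comm_ring_hom (peval id \<sigma>)"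
  by (rule comm_ring_hom.peval_hom[OF comm_ring_hom_id])

lemma peval_id_comp:
  "peval id \<sigma> (peval pconst \<tau> F) = peval id (\<lambda>n. peval id \<sigma> (\<tau> n)) F"
  by (simp add: comm_ring_hom.hom_peval[OF peval_id_hom] peval_id_simps) (simp add: id_def)

lemma base_expansion_unique:
  fixes m m' :: "nat \<Rightarrow> nat"
  assumes "\<And>n. m n < B" "\<And>n. m' n < B"
    "(\<Sum>n\<le>M. m n * B ^ (M - n)) = (\<Sum>n\<le>M. m' n * B ^ (M - n))" "n \<le> M"
  shows "m n = m' n"
  using assms(3,4)
proof (induction M arbitrary: n)
  case (Suc M)
  have *: "(\<Sum>n\<le>Suc M. k n * B ^ (Suc M - n)) = B * (\<Sum>n\<le>M. k n * B ^ (M - n)) + k (Suc M)" for k :: "nat \<Rightarrow> nat"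
    by (simp add: sum_distrib_left Suc_diff_le mult_ac)
  have eq: "B * (\<Sum>n\<le>M. m n * B ^ (M - n)) + m (Suc M) = B * (\<Sum>n\<le>M. m' n * B ^ (M - n)) + m' (Suc M)"
    using Suc.prems(1) unfolding * .
  from arg_cong[OF eq, of "\<lambda>x. x mod B"] have last: "m (Suc M) = m' (Suc M)"
    using assms(1)[of "Suc M"] assms(2)[of "Suc M"] by simp
  have "B \<noteq> 0" using assms(1)[of 0] by auto
  with eq last have "(\<Sum>n\<le>M. m n * B ^ (M - n)) = (\<Sum>n\<le>M. m' n * B ^ (M - n))" by simp
  thus ?case using Suc.IH[of n] Suc.prems(2) last by (cases "n = Suc M") auto
qed auto

text \<open>Decreasing sequences of naturals are Zariski dense. The substitution \<open>\<sigma> n = t ^ (B ^ (M - n))\<close> is decreasing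
  and, for \<open>B\<close> larger than all exponents, sends distinct monomials to distinct powers of \<open>t\<close>.\<close>
lemma poly_ring_eq_0_if_vanishes:
  fixes p :: "'a::{idom, ring_char_0} poly_ring"
  assumes "\<And>\<sigma> :: nat \<Rightarrow> nat. antimono \<sigma> \<Longrightarrow> peval id (\<lambda>n. of_nat (\<sigma> n)) p = 0"
  shows "p = 0"
proof (rule ccontr)
  assume "p \<noteq> 0"
  let ?K = "Poly_Mapping.keys p"
  have K: "finite ?K" "?K \<noteq> {}" using \<open>p \<noteq> 0\<close> by auto
  define M where "M = Max (insert 0 (\<Union>m\<in>?K. Poly_Mapping.keys m))"
  define B where "B = Suc (Max (insert 0 (\<Union>m\<in>?K. Poly_Mapping.lookup m ` Poly_Mapping.keys m)))"
  have M: "n \<le> M" if "m \<in> ?K" "n \<in> Poly_Mapping.keys m" for m n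
    unfolding M_def using that by (intro Max_ge) auto
  have B: "Poly_Mapping.lookup m n < B" if "m \<in> ?K" for m n
  proof (cases "n \<in> Poly_Mapping.keys m")
    case True
    have "Poly_Mapping.lookup m n \<le> Max (insert 0 (\<Union>m\<in>?K. Poly_Mapping.lookup m ` Poly_Mapping.keys m))"
      using that True by (intro Max_ge) auto
    thus ?thesis by (simp add: B_def)
  qed (simp add: in_keys_iff B_def)
  define e where "e m = (\<Sum>n\<le>M. Poly_Mapping.lookup m n * B ^ (M - n))" for m :: "nat \<Rightarrow>\<^sub>0 nat"
  have inj: "inj_on e ?K"
  proof
    fix m m' assume mm: "m \<in> ?K" "m' \<in> ?K" "e m = e m'"
    show "m = m'"
    proof (rule poly_mapping_eqI)
      fix n
      show "Poly_Mapping.lookup m n = Poly_Mapping.lookup m' n"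
      proof (cases "n \<le> M")
        case True
        show ?thesis
          by (rule base_expansion_unique[OF B[OF mm(1)] B[OF mm(2)] _ True])
             (use mm(3) in \<open>simp add: e_def\<close>)
      next
        case False
        hence "n \<notin> Poly_Mapping.keys m" "n \<notin> Poly_Mapping.keys m'" using M mm by auto
        thus ?thesis by (simp add: in_keys_iff)
      qed
    qed
  qed
  define P where "P = (\<Sum>m\<in>?K. Polynomial.monom (Poly_Mapping.lookup p m) (e m))"
  have root: "poly P (of_nat t) = 0" if "t \<ge> 1" for t :: nat
  proof -
    define \<sigma> where "\<sigma> n = t ^ (B ^ (M - n))" for n
    have "antimono \<sigma>"
      using that by (auto simp: antimono_def \<sigma>_def B_def intro!: power_increasing diff_le_mono2)
    hence "peval id (\<lambda>n. of_nat (\<sigma> n)) p = 0" by (rule assms)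
    moreover have "monom_val (\<lambda>n. of_nat (\<sigma> n)) m = (of_nat t :: 'a) ^ e m" if "m \<in> ?K" for m
    proof -
      have "monom_val (\<lambda>n. of_nat (\<sigma> n)) m = (\<Prod>n\<le>M. (of_nat (\<sigma> n) :: 'a) ^ Poly_Mapping.lookup m n)"
        by (rule monom_val_superset) (use M that in auto)
      also have "\<dots> = (\<Prod>n\<le>M. of_nat t ^ (Poly_Mapping.lookup m n * B ^ (M - n)))"
        by (intro prod.cong) (auto simp: \<sigma>_def mult.commute simp flip: power_mult)
      finally show ?thesis by (simp add: e_def power_sum)
    qed
    ultimately show ?thesis
      by (simp add: P_def poly_sum poly_monom peval_monom_val)
  qed
  have "P = 0"
  proof (rule ccontr)
    assume "P \<noteq> 0"
    hence "finite {x. poly P x = 0}" by (rule poly_roots_finite)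
    moreover have "(of_nat :: nat \<Rightarrow> 'a) ` {1..} \<subseteq> {x. poly P x = 0}" using root by auto
    ultimately have "finite ((of_nat :: nat \<Rightarrow> 'a) ` {1..})" by (rule rev_finite_subset)
    hence "finite {1::nat..}" by (rule finite_imageD) (simp add: inj_on_def)
    thus False by (simp add: infinite_Ici)
  qed
  moreover obtain m where m: "m \<in> ?K" using K(2) by blast
  have "coeff P (e m) = (\<Sum>m'\<in>?K. if m' = m then Poly_Mapping.lookup p m' else 0)"
    unfolding P_def coeff_sum using inj_onD[OF inj] m by (intro sum.cong) (auto simp: coeff_monom)
  hence "coeff P (e m) = Poly_Mapping.lookup p m" using m by simp
  ultimately show False using m by (simp add: in_keys_iff)
qed

lemma poly_ring_eqI:
  fixes p q :: "'a::{idom, ring_char_0} poly_ring"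
  assumes "\<And>\<sigma> :: nat \<Rightarrow> nat. antimono \<sigma> \<Longrightarrow>
    peval id (\<lambda>n. of_nat (\<sigma> n)) p = peval id (\<lambda>n. of_nat (\<sigma> n)) q"
  shows "p = q"
proof -
  have *: "peval id \<sigma> (p - q) = peval id \<sigma> p - peval id \<sigma> q" for \<sigma> :: "nat \<Rightarrow> 'a"
    using peval_id_simps(3)[of \<sigma> "p - q" q] by (simp add: algebra_simps)
  have "p - q = 0"
    by (rule poly_ring_eq_0_if_vanishes) (use assms * in simp)
  thus ?thesis by simp
qed

section \<open>Functions vanishing on sums of points of the moment curve\<close>

text \<open>\<open>frechet_deg k Q\<close> says that \<open>Q\<close> is a polynomial of degree at most \<open>k\<close> in the sense of Frechet: all its differences
  of order \<open>k + 1\<close> vanish. In this form the degree visibly drops when a difference is taken.\<close>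
primrec frechet_deg :: "nat \<Rightarrow> ((nat \<Rightarrow> real) \<Rightarrow> real) \<Rightarrow> bool" where
  "frechet_deg 0 Q \<longleftrightarrow> (\<forall>u w. Q (\<lambda>n. u n + w n) = Q u)"
| "frechet_deg (Suc k) Q \<longleftrightarrow> (\<forall>w. frechet_deg k (\<lambda>u. Q (\<lambda>n. u n + w n) - Q u))"

lemma frechet_deg_0_const:
  assumes "frechet_deg 0 Q"
  shows "Q u = Q (\<lambda>_. 0)"
proof -
  have "Q (\<lambda>n. v n + u n) = Q v" for v using assms by simp
  from this[of "\<lambda>_. 0"] show ?thesis by simp
qed

lemma frechet_deg_const: "frechet_deg k (\<lambda>_. c)"
  by (induction k arbitrary: c) auto

lemma frechet_deg_Suc: "frechet_deg k Q \<Longrightarrow> frechet_deg (Suc k) Q"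
proof (induction k arbitrary: Q)
  case (Suc k)
  have "frechet_deg (Suc k) (\<lambda>u. Q (\<lambda>n. u n + w n) - Q u)" for w
    using Suc.prems by (intro Suc.IH) simp
  thus ?case by simp
qed simp

lemma frechet_deg_mono:
  assumes "frechet_deg k Q" "k \<le> l"
  shows "frechet_deg l Q"
  using assms(2,1)
  by (induction l rule: dec_induct) (auto intro: frechet_deg_Suc simp del: frechet_deg.simps)

lemma frechet_deg_shift: "frechet_deg k Q \<Longrightarrow> frechet_deg k (\<lambda>u. Q (\<lambda>n. u n + v n))"
proof (induction k arbitrary: Q)
  case 0
  have "Q f = Q g" for f g
    using frechet_deg_0_const[OF 0, of f] frechet_deg_0_const[OF 0, of g] by argo
  thus ?case unfolding frechet_deg.simps by blast
next
  case (Suc k)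
  have "frechet_deg k (\<lambda>u. Q (\<lambda>n. u n + v n + w n) - Q (\<lambda>n. u n + v n))" for w
    using Suc.IH[of "\<lambda>u. Q (\<lambda>n. u n + w n) - Q u"] Suc.prems by simp
  thus ?case by (simp add: algebra_simps)
qed

lemma frechet_deg_add:
  "frechet_deg k Q \<Longrightarrow> frechet_deg k R \<Longrightarrow> frechet_deg k (\<lambda>u. Q u + R u)"
proof (induction k arbitrary: Q R)
  case (Suc k)
  have "frechet_deg k (\<lambda>u. (Q (\<lambda>n. u n + w n) - Q u) + (R (\<lambda>n. u n + w n) - R u))" for w
    by (rule Suc.IH) (use Suc.prems in auto)
  thus ?case by (simp add: algebra_simps)
qed auto

lemma frechet_deg_scale: "frechet_deg k Q \<Longrightarrow> frechet_deg k (\<lambda>u. c * Q u)"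
proof (induction k arbitrary: Q)
  case (Suc k)
  have "frechet_deg k (\<lambda>u. c * (Q (\<lambda>n. u n + w n) - Q u))" for w
    by (rule Suc.IH) (use Suc.prems in auto)
  thus ?case by (simp add: algebra_simps)
qed auto

lemma frechet_deg_mult:
  "frechet_deg a Q \<Longrightarrow> frechet_deg b R \<Longrightarrow> frechet_deg (a + b) (\<lambda>u. Q u * R u)"
proof (induction "a + b" arbitrary: a b Q R rule: less_induct)
  case less
  show ?case
  proof (cases a)
    case 0
    have c: "Q u = Q (\<lambda>_. 0)" for u
      using less.prems(1) unfolding 0 by (rule frechet_deg_0_const)
    have "(\<lambda>u. Q u * R u) = (\<lambda>u. Q (\<lambda>_. 0) * R u)"
      by (rule ext, subst c, rule refl)
    thus ?thesis using frechet_deg_scale[OF less.prems(2)] 0 by simp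
  next
    case (Suc a')
    show ?thesis
    proof (cases b)
      case 0
      have c: "R u = R (\<lambda>_. 0)" for u
        using less.prems(2) unfolding 0 by (rule frechet_deg_0_const)
      have "(\<lambda>u. Q u * R u) = (\<lambda>u. R (\<lambda>_. 0) * Q u)"
        by (rule ext, subst c, rule mult.commute)
      thus ?thesis using frechet_deg_scale[OF less.prems(1)] 0 by simp
    next
      case (Suc b')
      have "frechet_deg (a' + b) (\<lambda>u. Q (\<lambda>n. u n + w n) * R (\<lambda>n. u n + w n) - Q u * R u)" for w
      proof -
        have "frechet_deg (a' + b) (\<lambda>u. (Q (\<lambda>n. u n + w n) - Q u) * R u)"
          by (rule less.hyps) (use less.prems \<open>a = Suc a'\<close> in auto)
        moreover have "frechet_deg (a + b') (\<lambda>u. Q (\<lambda>n. u n + w n) * (R (\<lambda>n. u n + w n) - R u))"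
          by (rule less.hyps) (use less.prems frechet_deg_shift[OF less.prems(1)] \<open>b = Suc b'\<close> in auto)
        moreover have "a + b' = a' + b" using \<open>a = Suc a'\<close> \<open>b = Suc b'\<close> by simp
        ultimately have "frechet_deg (a' + b) (\<lambda>u. (Q (\<lambda>n. u n + w n) - Q u) * R u +
            Q (\<lambda>n. u n + w n) * (R (\<lambda>n. u n + w n) - R u))"
          by (intro frechet_deg_add) auto
        thus ?thesis by (simp add: algebra_simps)
      qed
      thus ?thesis using \<open>a = Suc a'\<close> by simp
    qed
  qed
qed

lemma frechet_deg_coord: "frechet_deg 1 (\<lambda>u. u n)"
  by simp

lemma frechet_deg_power: "frechet_deg a Q \<Longrightarrow> frechet_deg (k * a) (\<lambda>u. Q u ^ k)"
  by (induction k) (auto simp: frechet_deg_const simp del: frechet_deg.simps intro: frechet_deg_mult)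

lemma frechet_deg_prod:
  "finite A \<Longrightarrow> (\<And>x. x \<in> A \<Longrightarrow> frechet_deg (d x) (Q x)) \<Longrightarrow>
    frechet_deg (\<Sum>x\<in>A. d x) (\<lambda>u. \<Prod>x\<in>A. Q x u)"
  by (induction A rule: finite_induct) (auto simp: frechet_deg_const simp del: frechet_deg.simps intro: frechet_deg_mult)

lemma frechet_deg_sum:
  "finite A \<Longrightarrow> (\<And>x. x \<in> A \<Longrightarrow> frechet_deg d (Q x)) \<Longrightarrow> frechet_deg d (\<lambda>u. \<Sum>x\<in>A. Q x u)"
  by (induction A rule: finite_induct) (auto simp: frechet_deg_const simp del: frechet_deg.simps intro: frechet_deg_add)

text \<open>The degree of a monomial if the \<open>n\<close>-th indeterminate, which stands for \<open>p\<^bsub>n+1\<^esub>\<close>, has degree \<open>n + 1\<close>.\<close>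
definition weight :: "(nat \<Rightarrow>\<^sub>0 nat) \<Rightarrow> nat" where
  "weight m = (\<Sum>n\<in>Poly_Mapping.keys m. Poly_Mapping.lookup m n * Suc n)"

text \<open>The weight is a crude bound for the number of factors of a monomial; it is the grading used for the expansions below.\<close>
lemma frechet_deg_peval:
  assumes "\<And>m. m \<in> Poly_Mapping.keys F \<Longrightarrow> weight m \<le> N"
  shows "frechet_deg N (\<lambda>u. peval id u F)"
proof -
  have "frechet_deg (weight m) (\<lambda>u. monom_val u m)" for m
    unfolding weight_def monom_val_def
  proof (intro frechet_deg_prod finite_keys)
    fix n
    have "frechet_deg (Poly_Mapping.lookup m n * 1) (\<lambda>u. u n ^ Poly_Mapping.lookup m n)"
      by (intro frechet_deg_power frechet_deg_coord)
    thus "frechet_deg (Poly_Mapping.lookup m n * Suc n) (\<lambda>u. u n ^ Poly_Mapping.lookup m n)"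
      by (rule frechet_deg_mono) simp
  qed
  thus ?thesis
    unfolding peval_monom_val using assms
    by (intro frechet_deg_sum frechet_deg_scale finite_keys) (blast intro: frechet_deg_mono)
qed

text \<open>Sequential continuity for pointwise convergence of the argument.\<close>
definition ptw_continuous :: "((nat \<Rightarrow> real) \<Rightarrow> real) \<Rightarrow> bool" where
  "ptw_continuous Q \<longleftrightarrow> (\<forall>u l. (\<forall>n. (\<lambda>i. u i n) \<longlonglongrightarrow> l n) \<longrightarrow> (\<lambda>i. Q (u i)) \<longlonglongrightarrow> Q l)"

lemma ptw_continuous_peval: "ptw_continuous (\<lambda>u. peval id u F)"
  unfolding ptw_continuous_def peval_def
  by (intro allI impI tendsto_sum tendsto_mult tendsto_const tendsto_prod tendsto_power) (erule spec)

lemma ptw_continuous_diff: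
  assumes "ptw_continuous Q"
  shows "ptw_continuous (\<lambda>u. Q (\<lambda>n. u n + w n) - Q u)"
  unfolding ptw_continuous_def
proof (intro allI impI)
  fix u :: "nat \<Rightarrow> nat \<Rightarrow> real" and l
  assume u: "\<forall>n. (\<lambda>i. u i n) \<longlonglongrightarrow> l n"
  hence "\<forall>n. (\<lambda>i. u i n + w n) \<longlonglongrightarrow> l n + w n" by (auto intro!: tendsto_intros)
  hence "(\<lambda>i. Q (\<lambda>n. u i n + w n)) \<longlonglongrightarrow> Q (\<lambda>n. l n + w n)"
    using assms[unfolded ptw_continuous_def, rule_format, of "\<lambda>i n. u i n + w n"] by auto
  moreover have "(\<lambda>i. Q (u i)) \<longlonglongrightarrow> Q l" using assms u by (auto simp: ptw_continuous_def)
  ultimately show "(\<lambda>i. Q (\<lambda>n. u i n + w n) - Q (u i)) \<longlonglongrightarrow> Q (\<lambda>n. l n + w n) - Q l"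
    by (rule tendsto_diff)
qed

text \<open>Invariance under \<open>(s, s\<^sup>2, s\<^sup>3, \<dots>)\<close> implies invariance under each coordinate direction, by induction on the
  coordinate \<open>k\<close>: once the lower coordinates are free, for \<open>t \<ge> 0\<close> the sum of \<open>i\<close> copies of the point with \<open>s ^ (k + 1) = t / i\<close> moves
  coordinate \<open>k\<close> by \<open>t\<close>, and the higher coordinates by amounts that tend to 0.\<close>
lemma const_if_invariant_under_moment_curve:
  assumes cts: "ptw_continuous Q"
    and inv: "\<And>u s. Q (\<lambda>n. u n + s ^ Suc n) = Q u"
  shows "Q u = Q v"
proof -
  have lower: "Q u = Q u'" if "\<And>n. n \<ge> k \<Longrightarrow> u n = u' n" for k u u'
    using that
  proof (induction k arbitrary: u u')
    case 0
    hence "u = u'" by auto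
    thus ?case by simp
  next
    case (Suc k)
    have mult: "Q (\<lambda>n. u n + of_nat i * s ^ Suc n) = Q u" for i u and s :: real
    proof (induction i)
      case (Suc i)
      have "Q (\<lambda>n. u n + of_nat (Suc i) * s ^ Suc n) = Q (\<lambda>n. (u n + of_nat i * s ^ Suc n) + s ^ Suc n)"
        by (simp add: algebra_simps)
      thus ?case using inv Suc.IH by metis
    qed simp
    have nonneg: "Q (u(k := u k + t)) = Q u" if "t \<ge> 0" for u and t :: real
    proof -
      define s where "s i = root (Suc k) (t / of_nat (Suc i))" for i
      define w where "w i = (\<lambda>n. if n < k then u n else u n + of_nat (Suc i) * s i ^ Suc n)" for i
      have s_pow: "of_nat (Suc i) * s i ^ Suc k = t" for i
      proof -
        have "s i ^ Suc k = t / of_nat (Suc i)"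
          unfolding s_def by (rule real_root_pow_pos2) (use that in auto)
        thus ?thesis by (simp del: of_nat_Suc power_Suc)
      qed
      have s_lim: "s \<longlonglongrightarrow> 0"
      proof -
        have "(\<lambda>i. t / of_nat (Suc i)) \<longlonglongrightarrow> 0"
          by (rule LIMSEQ_Suc[OF lim_const_over_n])
        hence "(\<lambda>i. root (Suc k) (t / of_nat (Suc i))) \<longlonglongrightarrow> root (Suc k) 0"
          by (rule tendsto_real_root)
        thus ?thesis by (simp add: s_def[abs_def])
      qed
      have "Q (w i) = Q u" for i
      proof -
        have "Q (w i) = Q (\<lambda>n. u n + of_nat (Suc i) * s i ^ Suc n)"
          by (rule Suc.IH) (simp add: w_def)
        also have "\<dots> = Q u" by (rule mult)
        finally show ?thesis .
      qed
      moreover have "(\<lambda>i. Q (w i)) \<longlonglongrightarrow> Q (u(k := u k + t))"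
      proof (rule cts[unfolded ptw_continuous_def, rule_format])
        fix n
        consider "n < k" | "n = k" | "n > k" by linarith
        thus "(\<lambda>i. w i n) \<longlonglongrightarrow> (u(k := u k + t)) n"
        proof cases
          case 3
          have "of_nat (Suc i) * s i ^ Suc n = t * s i ^ (n - k)" for i :: nat
          proof -
            have "Suc n = Suc k + (n - k)" using 3 by simp
            hence "s i ^ Suc n = s i ^ Suc k * s i ^ (n - k)" by (metis power_add)
            thus ?thesis using s_pow[of i] by (metis mult.assoc)
          qed
          moreover have "(\<lambda>i. u n + t * s i ^ (n - k)) \<longlonglongrightarrow> u n + t * 0 ^ (n - k)"
            by (intro tendsto_intros s_lim)
          moreover have "(0::real) ^ (n - k) = 0" using 3 by simp
          ultimately show ?thesis using 3 by (simp add: w_def)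
        qed (use s_pow in \<open>simp_all add: w_def\<close>)
      qed
      ultimately show ?thesis by (simp add: LIMSEQ_const_iff)
    qed
    have any: "Q (u(k := u k + t)) = Q u" for u and t :: real
    proof (cases "t \<ge> 0")
      case False
      thus ?thesis using nonneg[of "- t" "u(k := u k + t)"] by simp
    qed (rule nonneg)
    have "Q u = Q (u(k := u k + (u' k - u k)))" by (rule any[symmetric])
    also have "\<dots> = Q u'"
      by (rule Suc.IH) (use Suc.prems in \<open>auto simp: Suc_le_eq\<close>)
    finally show ?case .
  qed
  have "Q u = Q (\<lambda>_. 0)" for u
  proof -
    have "(\<lambda>i. Q (\<lambda>n. if n < i then u n else 0)) \<longlonglongrightarrow> Q u"
    proof (rule cts[unfolded ptw_continuous_def, rule_format])
      fix n
      have "eventually (\<lambda>i. (if n < i then u n else 0) = u n) sequentially"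
        using eventually_gt_at_top[of n] by eventually_elim auto
      thus "(\<lambda>i. if n < i then u n else 0) \<longlonglongrightarrow> u n"
        by (rule tendsto_eventually)
    qed
    moreover have "Q (\<lambda>n. if n < i then u n else 0) = Q (\<lambda>_. 0)" for i
      by (rule lower[of i]) auto
    ultimately show ?thesis by (simp add: LIMSEQ_const_iff)
  qed
  thus ?thesis by metis
qed

text \<open>The translation \<open>c\<close> is arbitrary because the induction step absorbs a point of the curve into it.\<close>
lemma zero_if_vanishes_on_power_sums:
  assumes "frechet_deg N Q" "ptw_continuous Q"
    and "\<And>x :: nat \<Rightarrow> real. Q (\<lambda>n. (\<Sum>i<N. x i ^ Suc n) + c n) = 0"
  shows "Q u = 0"
  using assms
proof (induction N arbitrary: Q c u)
  case 0
  show ?case using frechet_deg_0_const[OF 0(1), of u] frechet_deg_0_const[OF 0(1), of c] 0(3) by simp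
next
  case (Suc N)
  have shift: "Q (\<lambda>n. u n + (s ^ Suc n - t ^ Suc n)) = Q u" for u and s t :: real
  proof -
    \<comment> \<open>If \<open>N\<close> points are already chosen, the last one may be \<open>s\<close> or \<open>t\<close>; the difference has lower degree.\<close>
    let ?R = "\<lambda>u. Q (\<lambda>n. u n + (s ^ Suc n - t ^ Suc n)) - Q u"
    have "?R u = 0"
    proof (rule Suc.IH[where Q = ?R and u = u and c = "\<lambda>n. c n + t ^ Suc n"])
      show "frechet_deg N ?R" using Suc.prems(1) by (simp del: power_Suc)
      show "ptw_continuous ?R" by (rule ptw_continuous_diff) fact
      fix x :: "nat \<Rightarrow> real"
      have "Q (\<lambda>n. (\<Sum>i<N. x i ^ Suc n) + (c n + r ^ Suc n)) = 0" for r
      proof -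
        have "(\<Sum>i<Suc N. (x(N := r)) i ^ Suc n) = (\<Sum>i<N. x i ^ Suc n) + r ^ Suc n" for n
          by (simp del: power_Suc)
        thus ?thesis using Suc.prems(3)[of "x(N := r)"] by (simp add: add_ac del: power_Suc sum.lessThan_Suc)
      qed
      from this[of s] this[of t]
      show "?R (\<lambda>n. (\<Sum>i<N. x i ^ Suc n) + (c n + t ^ Suc n)) = 0"
        by (simp add: algebra_simps del: power_Suc)
    qed
    thus ?thesis by simp
  qed
  have "Q (\<lambda>n. u n + s ^ Suc n) = Q u" for u s
    using shift[of u s 0] by simp
  hence "Q u = Q (\<lambda>n. (\<Sum>i<Suc N. (\<lambda>_. 0) i ^ Suc n) + c n)"
    by (rule const_if_invariant_under_moment_curve[OF Suc.prems(2)])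
  also have "\<dots> = 0" by (rule Suc.prems(3))
  finally show ?case .
qed

section \<open>Determinants of inverse factorials\<close>

text \<open>The inverse factorial, continued by 0 to the negative integers, so that \<open>ifact_step\<close> holds everywhere.\<close>
definition ifact :: "int \<Rightarrow> real" where
  "ifact m = (if m < 0 then 0 else 1 / fact (nat m))"

lemma ifact_step: "real_of_int m * ifact m = ifact (m - 1)"
proof (cases "m > 0")
  case True
  then obtain n where "m = int (Suc n)" by (metis gr0_implies_Suc zero_less_imp_eq_int)
  thus ?thesis by (simp add: ifact_def nat_add_distrib)
qed (auto simp: ifact_def)

lemma falling_eq_ifact: "falling (real l) k = fact l * ifact (int l - int k)"
proof (induction k)
  case 0
  thus ?case by (simp add: falling_def ifact_def)
next
  case (Suc k)
  have "falling (real l) (Suc k) = fact l * (real_of_int (int l - int k) * ifact (int l - int k))"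
    using Suc by (simp add: falling_Suc)
  thus ?case by (simp only: ifact_step) (simp add: algebra_simps)
qed

text \<open>With rows counted from 0, \<open>modified_row \<mu> i\<close> is the content of the box that would be added to row \<open>i\<close>.\<close>
definition modified_row :: "box set \<Rightarrow> nat \<Rightarrow> int" where
  "modified_row \<mu> i = int (rowlen \<mu> i) - int i"

text \<open>The determinant \<open>\<Phi> (\<mu>, \<nu>)\<close> with columns indexed by the rows of \<open>\<mu>\<close> and rows by the rows of \<open>\<nu>\<close>. Its entries do
  not involve the size \<open>N\<close>.\<close>
definition Phi :: "nat \<Rightarrow> box set \<Rightarrow> box set \<Rightarrow> real" where
  "Phi N \<mu> \<nu> = sqdet N (\<lambda>i j. ifact (modified_row \<mu> j - modified_row \<nu> i))"

lemma modified_row_ge: "modified_row \<mu> i \<ge> - int i"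
  by (simp add: modified_row_def)

lemma modified_row_eq: "\<mu> \<in> young_diagrams \<Longrightarrow> num_rows \<mu> \<le> i \<Longrightarrow> modified_row \<mu> i = - int i"
  using row_eq_0_iff[of \<mu> i] by (simp add: modified_row_def)

lemma sum_modified_row:
  assumes "\<mu> \<in> young_diagrams" "num_rows \<mu> \<le> N"
  shows "(\<Sum>i<N. modified_row \<mu> i) = int (card \<mu>) - (\<Sum>i<N. int i)"
  by (simp add: modified_row_def sum_subtractf card_eq_sum_rows[OF assms])

text \<open>Lowering \<open>m\<^sub>j\<close> by one multiplies the entry by \<open>m\<^sub>j - k\<^sub>i\<close>; where no box can be removed, the shifted column makes the determinant vanish.\<close>
lemma Phi_remove_boxes:
  assumes "\<mu> \<in> young_diagrams" "\<nu> \<in> young_diagrams" "num_rows \<mu> \<le> N" "num_rows \<nu> \<le> N"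
  shows "(\<Sum>b\<in>removable \<mu>. Phi N (\<mu> - {b}) \<nu>) = (real (card \<mu>) - real (card \<nu>)) * Phi N \<mu> \<nu>"
proof -
  let ?m = "modified_row \<mu>" and ?k = "modified_row \<nu>"
  let ?a = "\<lambda>i j. ifact (?m j - ?k i)"
  have col: "sqdet N (\<lambda>i j. if j = c then ifact (?m j - 1 - ?k i) else ?a i j) =
      (if rowlen \<mu> (Suc c) < rowlen \<mu> c then Phi N (\<mu> - {(Suc c, rowlen \<mu> c)}) \<nu> else 0)"
    if c: "c < N" for c
  proof (cases "rowlen \<mu> (Suc c) < rowlen \<mu> c")
    case True
    have "modified_row (\<mu> - {(Suc c, rowlen \<mu> c)}) j = (if j = c then ?m j - 1 else ?m j)" for j
      using True by (simp add: modified_row_def row_remove[OF assms(1)])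
    thus ?thesis using True by (auto simp: Phi_def intro!: sqdet_cong)
  next
    case False
    hence eq: "rowlen \<mu> (Suc c) = rowlen \<mu> c" using row_antimono[OF assms(1), of c "Suc c"] by simp
    have "sqdet N (\<lambda>i j. if j = c then ifact (?m j - 1 - ?k i) else ?a i j) = 0"
    proof (cases "Suc c < N")
      case True
      have "?m c - 1 = ?m (Suc c)" using eq by (simp add: modified_row_def)
      thus ?thesis using True c
        by (intro sqdet_equal_cols[of c N "Suc c"]) auto
    next
      case False
      hence "Suc c = N" using c by simp
      hence "rowlen \<mu> c = 0" using eq row_eq_0_iff[OF assms(1), of "Suc c"] assms(3) by simp
      moreover have "ifact (- int c - 1 - ?k i) = 0" if "i < N" for i
        using modified_row_ge[of i \<nu>] that \<open>Suc c = N\<close> by (simp add: ifact_def)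
      ultimately show ?thesis using c
        by (intro sqdet_zero_col[of c]) (auto simp: modified_row_def)
    qed
    thus ?thesis using False by simp
  qed
  have "(\<Sum>b\<in>removable \<mu>. Phi N (\<mu> - {b}) \<nu>) =
      (\<Sum>c<N. if rowlen \<mu> (Suc c) < rowlen \<mu> c then Phi N (\<mu> - {(Suc c, rowlen \<mu> c)}) \<nu> else 0)"
    by (rule sum_removable[OF assms(1,3)])
  also have "\<dots> = det_deriv N ?a (\<lambda>i j. ifact (?m j - 1 - ?k i))"
    unfolding det_deriv_cols by (intro sum.cong refl col[symmetric]) simp
  also have "\<dots> = det_deriv N ?a (\<lambda>i j. (real_of_int (?m j) + real_of_int (- ?k i)) * ?a i j)"
  proof (rule det_deriv_cong)
    fix i j
    show "ifact (?m j - 1 - ?k i) = (real_of_int (?m j) + real_of_int (- ?k i)) * ?a i j"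
      using ifact_step[of "?m j - ?k i"] by (simp add: algebra_simps)
  qed
  also have "\<dots> = ((\<Sum>j<N. real_of_int (?m j)) + (\<Sum>i<N. real_of_int (- ?k i))) * Phi N \<mu> \<nu>"
    unfolding Phi_def by (rule det_deriv_scale)
  also have "(\<Sum>j<N. real_of_int (?m j)) + (\<Sum>i<N. real_of_int (- ?k i)) =
      of_int ((\<Sum>j<N. ?m j) - (\<Sum>i<N. ?k i))"
    by (simp add: sum_negf)
  also have "(\<Sum>j<N. ?m j) - (\<Sum>i<N. ?k i) = int (card \<mu>) - int (card \<nu>)"
    using sum_modified_row[OF assms(1,3)] sum_modified_row[OF assms(2,4)] by simp
  finally show ?thesis by simp
qed

lemma ifact_last_col:
  assumes "\<mu> \<in> young_diagrams" "num_rows \<mu> \<le> M" "i < M"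
  shows "ifact (modified_row \<mu> M - modified_row \<nu> i) = 0"
  using modified_row_ge[of i \<nu>] assms(3) by (simp add: modified_row_eq[OF assms(1,2)] ifact_def)

lemma Phi_Suc:
  assumes "\<mu> \<in> young_diagrams" "\<nu> \<in> young_diagrams" "num_rows \<mu> \<le> N" "num_rows \<nu> \<le> N"
  shows "Phi (Suc N) \<mu> \<nu> = Phi N \<mu> \<nu>"
  unfolding Phi_def using ifact_last_col[OF assms(1,3)]
  by (subst sqdet_expand_col[of N])
     (auto simp: modified_row_eq[OF assms(1,3)] modified_row_eq[OF assms(2,4)] ifact_def intro!: sqdet_cong)

lemma Phi_stable:
  assumes "\<mu> \<in> young_diagrams" "\<nu> \<in> young_diagrams" "num_rows \<mu> \<le> N" "num_rows \<nu> \<le> N" "N \<le> N'"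
  shows "Phi N' \<mu> \<nu> = Phi N \<mu> \<nu>"
  using assms(5) by (induction N' rule: dec_induct) (use assms Phi_Suc in auto)

lemma Phi_eq_0:
  assumes "\<mu> \<in> young_diagrams" "\<nu> \<in> young_diagrams" "num_rows \<mu> < num_rows \<nu>" "num_rows \<nu> \<le> N"
  shows "Phi N \<mu> \<nu> = 0"
proof -
  let ?n = "num_rows \<nu>"
  obtain M where M: "?n = Suc M" using assms(3) by (cases ?n) auto
  have "Phi N \<mu> \<nu> = Phi ?n \<mu> \<nu>"
    by (rule Phi_stable) (use assms in auto)
  also have "\<dots> = 0"
    unfolding Phi_def
  proof (rule sqdet_zero_col[of M])
    fix i assume "i < ?n"
    hence "rowlen \<nu> i \<noteq> 0" using row_eq_0_iff[OF assms(2)] by simp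
    hence "modified_row \<nu> i > - int M" using \<open>i < ?n\<close> M by (simp add: modified_row_def)
    thus "ifact (modified_row \<mu> M - modified_row \<nu> i) = 0"
      using modified_row_eq[OF assms(1), of M] assms(3) M by (simp add: ifact_def)
  qed (use M in simp)
  finally show ?thesis .
qed

lemma sqdet_scale_col:
  assumes "c < n"
  shows "sqdet n (\<lambda>i j. if j = c then w * b i j else a i j) = w * sqdet n (\<lambda>i j. if j = c then b i j else a i j)"
proof -
  have "sqdet n (\<lambda>i j. if j = c then w * b i j else a i j) =
      sqdet n (\<lambda>i j. (if j = c then w else 1) * (if j = c then b i j else a i j))"
    by (rule sqdet_cong) auto
  also have "\<dots> = (\<Prod>j<n. if j = c then w else 1) * sqdet n (\<lambda>i j. if j = c then b i j else a i j)"
    by (rule sqdet_scale_cols)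
  finally show ?thesis using assms by simp
qed

lemma sqdet_scale_row:
  assumes "r < n"
  shows "sqdet n (\<lambda>i. if i = r then (\<lambda>j. w * b i j) else a i) = w * sqdet n (\<lambda>i. if i = r then b i else a i)"
proof -
  have "sqdet n (\<lambda>i. if i = r then (\<lambda>j. w * b i j) else a i) =
      sqdet n (\<lambda>i j. (if i = r then w else 1) * 1 * (if i = r then b i else a i) j)"
    by (rule sqdet_cong) auto
  also have "\<dots> = (\<Prod>i<n. if i = r then w else 1) * sqdet n (\<lambda>i. if i = r then b i else a i)"
    by (subst sqdet_scale) simp
  finally show ?thesis using assms by simp
qed

text \<open>The bound on the number of rows is strict so that every addable box of \<open>\<mu>\<close> lies in the first \<open>N\<close> rows. The last
  row of \<open>\<nu>\<close> is then empty; lowering it is not the removal of a box and contributes the term \<open>w (- N) \<Phi> (\<mu>, \<nu>)\<close>.\<close>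
lemma Phi_add_boxes:
  fixes z z' :: complex
  assumes "\<mu> \<in> young_diagrams" "\<nu> \<in> young_diagrams" "num_rows \<mu> < N" "num_rows \<nu> < N"
  defines "w \<equiv> \<lambda>c. (z + of_int c) * (z' + of_int c)"
  shows "(\<Sum>b\<in>addable \<mu>. w (content b) * of_real (Phi N (insert b \<mu>) \<nu>)) -
      (\<Sum>b\<in>removable \<nu>. w (content b) * of_real (Phi N \<mu> (\<nu> - {b}))) =
    (of_nat (card \<mu>) + of_nat (card \<nu>) + z * z') * of_real (Phi N \<mu> \<nu>)"
proof -
  let ?m = "modified_row \<mu>" and ?k = "modified_row \<nu>"
  let ?f = "\<lambda>x. complex_of_real (ifact x)"
  let ?a = "\<lambda>i j. ?f (?m j - ?k i)"
  let ?b = "\<lambda>i j. ?f (?m j + 1 - ?k i)"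
  have Phi: "of_real (Phi N \<mu>' \<nu>') = sqdet N (\<lambda>i j. ?f (modified_row \<mu>' j - modified_row \<nu>' i))" for \<mu>' \<nu>'
    by (simp add: Phi_def of_real_sqdet)
  have col: "sqdet N (\<lambda>i j. if j = c then w (?m j) * ?b i j else ?a i j) =
      (if c = 0 \<or> rowlen \<mu> c < rowlen \<mu> (c - 1)
       then w (content (Suc c, Suc (rowlen \<mu> c))) * of_real (Phi N (insert (Suc c, Suc (rowlen \<mu> c)) \<mu>) \<nu>)
       else 0)" if c: "c < N" for c
  proof (cases "c = 0 \<or> rowlen \<mu> c < rowlen \<mu> (c - 1)")
    case True
    have "modified_row (insert (Suc c, Suc (rowlen \<mu> c)) \<mu>) j = (if j = c then ?m j + 1 else ?m j)" for j
      by (simp add: modified_row_def row_insert[OF assms(1)])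
    moreover have "w (content (Suc c, Suc (rowlen \<mu> c))) = w (?m c)"
      by (simp add: content_def modified_row_def)
    moreover have "sqdet N (\<lambda>i j. if j = c then w (?m j) * ?b i j else ?a i j) =
        sqdet N (\<lambda>i j. if j = c then w (?m c) * ?b i j else ?a i j)"
      by (rule sqdet_cong) simp
    ultimately show ?thesis using True c
      by (auto simp: Phi sqdet_scale_col intro!: sqdet_cong)
  next
    case False
    hence eq: "c \<noteq> 0" "rowlen \<mu> c = rowlen \<mu> (c - 1)" using row_antimono[OF assms(1), of "c - 1" c] by auto
    have "sqdet N (\<lambda>i j. if j = c then ?b i j else ?a i j) = 0"
    proof (rule sqdet_equal_cols[of c N "c - 1"])
      fix i
      have "?m c + 1 = ?m (c - 1)" using eq by (cases c) (auto simp: modified_row_def)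
      thus "(if c = c then ?b i c else ?a i c) = (if c - 1 = c then ?b i (c - 1) else ?a i (c - 1))"
        using eq by simp
    qed (use eq c in auto)
    moreover have "sqdet N (\<lambda>i j. if j = c then w (?m j) * ?b i j else ?a i j) =
        sqdet N (\<lambda>i j. if j = c then w (?m c) * ?b i j else ?a i j)"
      by (rule sqdet_cong) simp
    ultimately show ?thesis using False c by (simp add: sqdet_scale_col)
  qed
  obtain M where M: "N = Suc M" using assms(3) by (cases N) auto
  have row: "sqdet N (\<lambda>i. if i = r then (\<lambda>j. w (?k i - 1) * ?b i j) else ?a i) =
      (if rowlen \<nu> (Suc r) < rowlen \<nu> r
       then w (content (Suc r, rowlen \<nu> r)) * of_real (Phi N \<mu> (\<nu> - {(Suc r, rowlen \<nu> r)})) else 0) +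
      (if r = M then w (- int N) * of_real (Phi N \<mu> \<nu>) else 0)" if r: "r < N" for r
  proof -
    have pull: "sqdet N (\<lambda>i. if i = r then (\<lambda>j. w (?k i - 1) * ?b i j) else ?a i) =
        w (?k r - 1) * sqdet N (\<lambda>i. if i = r then ?b i else ?a i)"
      by (subst sqdet_scale_row[OF r, symmetric]) (auto intro!: sqdet_cong)
    have last: "rowlen \<nu> (Suc M) = 0" "rowlen \<nu> M = 0"
      using row_eq_0_iff[OF assms(2)] assms(4) M by auto
    consider "rowlen \<nu> (Suc r) < rowlen \<nu> r" | "rowlen \<nu> (Suc r) = rowlen \<nu> r" "r < M"
      | "rowlen \<nu> (Suc r) = rowlen \<nu> r" "r = M"
      using row_antimono[OF assms(2), of r "Suc r"] r M by linarith
    thus ?thesis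
    proof cases
      case 1
      have "modified_row (\<nu> - {(Suc r, rowlen \<nu> r)}) i = (if i = r then ?k i - 1 else ?k i)" for i
        using 1 by (simp add: modified_row_def row_remove[OF assms(2)])
      moreover have "content (Suc r, rowlen \<nu> r) = ?k r - 1"
        by (simp add: content_def modified_row_def)
      moreover have "r \<noteq> M" using 1 last by auto
      ultimately show ?thesis using 1 unfolding pull
        by (auto simp: Phi diff_diff_eq2 intro!: sqdet_cong arg_cong[where f = "(*) _"])
    next
      case 2
      have "sqdet N (\<lambda>i. if i = r then ?b i else ?a i) = 0"
      proof (rule sqdet_equal_rows[of r N "Suc r"])
        fix j
        have "?k r = ?k (Suc r) + 1" using 2 by (simp add: modified_row_def)
        thus "(if r = r then ?b r else ?a r) j = (if Suc r = r then ?b (Suc r) else ?a (Suc r)) j"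
          by simp
      qed (use 2 M in auto)
      thus ?thesis using 2 unfolding pull by simp
    next
      case 3
      have z: "- int M < ?k i" if "i < M" for i
        using modified_row_ge[of i \<nu>] that by simp
      have mM: "?m M = - int M" "?k M = - int M"
        using modified_row_eq[OF assms(1), of M] modified_row_eq[OF assms(2), of M] assms(3,4) M by auto
      have "sqdet N (\<lambda>i. if i = r then ?b i else ?a i) = sqdet M ?a"
        unfolding M 3(2) by (subst sqdet_expand_col[of M]) (use z mM in \<open>auto simp: ifact_def intro!: sqdet_cong\<close>)
      also have "\<dots> = of_real (Phi N \<mu> \<nu>)"
        unfolding Phi unfolding M by (subst sqdet_expand_col[of M]) (use z mM in \<open>auto simp: ifact_def intro!: sqdet_cong\<close>)
      finally have "sqdet N (\<lambda>i. if i = r then ?b i else ?a i) = of_real (Phi N \<mu> \<nu>)" .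
      moreover have "?k r - 1 = - int N" using 3 mM M by simp
      ultimately show ?thesis using 3 unfolding pull by simp
    qed
  qed
  let ?A = "\<Sum>b\<in>addable \<mu>. w (content b) * of_real (Phi N (insert b \<mu>) \<nu>)"
  let ?R = "\<Sum>b\<in>removable \<nu>. w (content b) * of_real (Phi N \<mu> (\<nu> - {b}))"
  have "?A = det_deriv N ?a (\<lambda>i j. w (?m j) * ?b i j)"
    unfolding det_deriv_cols sum_addable[OF assms(1,3)]
    by (intro sum.cong refl col[symmetric]) simp
  also have "\<dots> = det_deriv N ?a (\<lambda>i j. w (?k i - 1) * ?b i j +
      (of_int (?m j) + (of_int (?k i) + (z + z' - 1))) * ?a i j)"
  proof (rule det_deriv_cong)
    fix i j
    \<comment> \<open>\<open>w x - w y = (x - y) (x + y + z + z')\<close>, and the factor \<open>x - y\<close> lowers the factorial.\<close>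
    have "?m j + 1 - ?k i - 1 = ?m j - ?k i" by simp
    with ifact_step[of "?m j + 1 - ?k i"]
    have "complex_of_real (real_of_int (?m j + 1 - ?k i) * ifact (?m j + 1 - ?k i)) = ?a i j"
      by metis
    hence "of_int (?m j + 1 - ?k i) * ?b i j = ?a i j"
      by (simp only: of_real_mult of_real_of_int_eq)
    moreover have "w (?m j) = w (?k i - 1) +
        (of_int (?m j) + (of_int (?k i) + (z + z' - 1))) * of_int (?m j + 1 - ?k i)"
      by (simp add: w_def algebra_simps)
    ultimately show "w (?m j) * ?b i j = w (?k i - 1) * ?b i j +
        (of_int (?m j) + (of_int (?k i) + (z + z' - 1))) * ?a i j"
      by (simp only: distrib_right mult.assoc)
  qed
  also have "\<dots> = det_deriv N ?a (\<lambda>i j. w (?k i - 1) * ?b i j) +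
      ((\<Sum>j<N. of_int (?m j)) + (\<Sum>i<N. of_int (?k i) + (z + z' - 1))) * of_real (Phi N \<mu> \<nu>)"
    by (simp only: det_deriv_add det_deriv_scale Phi)
  also have "det_deriv N ?a (\<lambda>i j. w (?k i - 1) * ?b i j) = ?R + w (- int N) * of_real (Phi N \<mu> \<nu>)"
  proof -
    have "num_rows \<nu> \<le> N" using assms(4) by simp
    have "det_deriv N ?a (\<lambda>i j. w (?k i - 1) * ?b i j) =
       (\<Sum>r<N. (if rowlen \<nu> (Suc r) < rowlen \<nu> r
       then w (content (Suc r, rowlen \<nu> r)) * of_real (Phi N \<mu> (\<nu> - {(Suc r, rowlen \<nu> r)})) else 0) +
      (if r = M then w (- int N) * of_real (Phi N \<mu> \<nu>) else 0))"
      unfolding det_deriv_rows by (intro sum.cong refl row) simp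
    thus ?thesis
      unfolding sum_removable[OF assms(2) \<open>num_rows \<nu> \<le> N\<close>] sum.distrib by (simp add: M)
  qed
  also have "(\<Sum>j<N. complex_of_int (?m j)) + (\<Sum>i<N. of_int (?k i) + (z + z' - 1)) =
      of_int ((\<Sum>j<N. ?m j) + (\<Sum>i<N. ?k i)) + of_nat N * (z + z' - 1)"
    by (simp add: sum.distrib)
  also have "(\<Sum>j<N. ?m j) + (\<Sum>i<N. ?k i) = int (card \<mu>) + int (card \<nu>) - 2 * (\<Sum>i<N. int i)"
    using sum_modified_row[OF assms(1), of N] sum_modified_row[OF assms(2), of N] assms(3,4) by simp
  also have "2 * (\<Sum>i<N. int i) = int N * (int N - 1)"
    by (induction N) (auto simp: algebra_simps)
  finally show ?thesis
    by (simp add: w_def algebra_simps)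
qed

section \<open>The number of standard tableaux\<close>

lemma mem_standard_tableaux:
  "T \<in> standard_tableaux \<nu> \<longleftrightarrow> T \<in> extensional \<nu> \<and> bij_betw T \<nu> {1..card \<nu>} \<and>
     (\<forall>i j. (i, j) \<in> \<nu> \<longrightarrow> (i, Suc j) \<in> \<nu> \<longrightarrow> T (i, j) < T (i, Suc j)) \<and>
     (\<forall>i j. (i, j) \<in> \<nu> \<longrightarrow> (Suc i, j) \<in> \<nu> \<longrightarrow> T (i, j) < T (Suc i, j))"
  unfolding standard_tableaux_def PiE_def by (auto dest: bij_betwE)

lemma finite_standard_tableaux: "finite \<nu> \<Longrightarrow> finite (standard_tableaux \<nu>)"
  by (rule finite_subset[of _ "\<nu> \<rightarrow>\<^sub>E {1..card \<nu>}"]) (auto simp: standard_tableaux_def intro: finite_PiE)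

text \<open>The box with the largest entry of a standard tableau is removable.\<close>
lemma max_box_removable:
  assumes \<mu>: "\<mu> \<in> young_diagrams" and T: "T \<in> standard_tableaux \<mu>"
    and b: "b \<in> \<mu>" "T b = card \<mu>"
  shows "b \<in> removable \<mu>"
proof -
  obtain i j where ij: "b = (i, j)" by (cases b)
  have bd: "T x \<le> card \<mu>" if "x \<in> \<mu>" for x
    using T that by (auto simp: mem_standard_tableaux dest!: bij_betwE)
  have "(i, Suc j) \<notin> \<mu>" "(Suc i, j) \<notin> \<mu>"
    using T b ij bd[of "(i, Suc j)"] bd[of "(Suc i, j)"]
    by (fastforce simp: mem_standard_tableaux)+
  moreover obtain a where a: "i = Suc a" "1 \<le> j" "j \<le> rowlen \<mu> a"
    using b(1) mem_young_iff[OF \<mu>, of i j] ij by (cases i) auto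
  ultimately have "j = rowlen \<mu> a" "rowlen \<mu> (Suc a) < rowlen \<mu> a"
    using mem_young_iff[OF \<mu>, of i "Suc j"] mem_young_iff[OF \<mu>, of "Suc i" j] by auto
  thus ?thesis using ij a by (auto simp: removable_eq[OF \<mu>])
qed

lemma card_tableaux_max_box:
  assumes \<mu>: "\<mu> \<in> young_diagrams" and b: "b \<in> removable \<mu>"
  shows "card {T \<in> standard_tableaux \<mu>. T b = card \<mu>} = dim_young (\<mu> - {b})"
proof -
  let ?\<nu> = "\<mu> - {b}" and ?n = "card (\<mu> - {b})"
  have n: "card \<mu> = Suc ?n" by (rule removable_facts(2)[OF \<mu> b])
  have b\<mu>: "b \<in> \<mu>" using b by (simp add: removable_def)
  have ins: "insert b ?\<nu> = \<mu>" using b\<mu> by auto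
  obtain a where a: "b = (Suc a, rowlen \<mu> a)" "rowlen \<mu> (Suc a) < rowlen \<mu> a"
    using b by (auto simp: removable_eq[OF \<mu>])
  have out: "(fst b, Suc (snd b)) \<notin> \<mu>" "(Suc (fst b), snd b) \<notin> \<mu>"
    using a by (auto simp: mem_young_iff[OF \<mu>])
  have "bij_betw (\<lambda>T. restrict T ?\<nu>) {T \<in> standard_tableaux \<mu>. T b = card \<mu>} (standard_tableaux ?\<nu>)"
  proof (rule bij_betw_byWitness[where f' = "\<lambda>T. T(b := card \<mu>)"])
    show "\<forall>T\<in>{T \<in> standard_tableaux \<mu>. T b = card \<mu>}. (restrict T ?\<nu>)(b := card \<mu>) = T"
    proof
      fix T assume "T \<in> {T \<in> standard_tableaux \<mu>. T b = card \<mu>}"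
      hence "T b = card \<mu>" "T \<in> extensional \<mu>" by (auto simp: mem_standard_tableaux)
      thus "(restrict T ?\<nu>)(b := card \<mu>) = T"
        by (intro ext) (auto simp: restrict_def extensional_def)
    qed
    show "\<forall>T\<in>standard_tableaux ?\<nu>. restrict (T(b := card \<mu>)) ?\<nu> = T"
    proof
      fix T assume "T \<in> standard_tableaux ?\<nu>"
      hence "T \<in> extensional ?\<nu>" by (simp add: mem_standard_tableaux)
      thus "restrict (T(b := card \<mu>)) ?\<nu> = T"
        by (intro ext) (auto simp: restrict_def extensional_def)
    qed
    show "(\<lambda>T. restrict T ?\<nu>) ` {T \<in> standard_tableaux \<mu>. T b = card \<mu>} \<subseteq> standard_tableaux ?\<nu>"
    proof (rule image_subsetI)
      fix T assume "T \<in> {T \<in> standard_tableaux \<mu>. T b = card \<mu>}"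
      hence T: "T \<in> standard_tableaux \<mu>" "T b = card \<mu>" by auto
      hence "bij_betw T \<mu> {1..card \<mu>}" by (simp add: mem_standard_tableaux)
      moreover have "bij_betw T {b} {card \<mu>}" using T(2) by (simp add: bij_betw_def)
      moreover have "{b} \<subseteq> \<mu>" "{card \<mu>} \<subseteq> {1..card \<mu>}" using b\<mu> n by auto
      ultimately have "bij_betw T ?\<nu> ({1..card \<mu>} - {card \<mu>})" by (rule bij_betw_DiffI)
      also have "{1..card \<mu>} - {card \<mu>} = {1..?n}" using n by auto
      finally have "bij_betw (restrict T ?\<nu>) ?\<nu> {1..?n}"
        by (rule bij_betw_cong[THEN iffD1, rotated]) simp
      thus "restrict T ?\<nu> \<in> standard_tableaux ?\<nu>"
        using T(1) by (simp add: mem_standard_tableaux)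
    qed
    show "(\<lambda>T. T(b := card \<mu>)) ` standard_tableaux ?\<nu> \<subseteq> {T \<in> standard_tableaux \<mu>. T b = card \<mu>}"
    proof (rule image_subsetI)
      fix T assume T: "T \<in> standard_tableaux ?\<nu>"
      let ?T = "T(b := card \<mu>)"
      have bij: "bij_betw T ?\<nu> {1..?n}" using T by (simp add: mem_standard_tableaux)
      have "bij_betw ?T ?\<nu> {1..?n}"
        by (rule bij_betw_cong[THEN iffD1, OF _ bij]) auto
      hence "bij_betw ?T (?\<nu> \<union> {b}) ({1..?n} \<union> {?T b})"
        by (rule notIn_Un_bij_betw[rotated 2]) (auto simp: n)
      moreover have "{1..?n} \<union> {?T b} = {1..card \<mu>}" using n by auto
      ultimately have bij': "bij_betw ?T \<mu> {1..card \<mu>}" using ins by simp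
      have lt: "T x < card \<mu>" if "x \<in> ?\<nu>" for x
      proof -
        have "T x \<in> {1..?n}" using bij_betwE[OF bij] that by blast
        thus ?thesis using n by simp
      qed
      have ext: "?T \<in> extensional \<mu>"
        using T b\<mu> by (auto simp: mem_standard_tableaux extensional_def)
      have "?T x < ?T y" if "x \<in> \<mu>" "y \<in> \<mu>" "x \<noteq> b" "y = b \<or> T x < T y" for x y
        using lt[of x] that by auto
      moreover have "(i, j) \<noteq> b" if "(i, Suc j) \<in> \<mu> \<or> (Suc i, j) \<in> \<mu>" for i j
        using out that by auto
      moreover have "T (i, j) < T (i, Suc j)" if "(i, j) \<in> ?\<nu>" "(i, Suc j) \<in> ?\<nu>" for i j
        using T that by (simp add: mem_standard_tableaux)
      moreover have "T (i, j) < T (Suc i, j)" if "(i, j) \<in> ?\<nu>" "(Suc i, j) \<in> ?\<nu>" for i j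
        using T that by (simp add: mem_standard_tableaux)
      ultimately have "\<forall>i j. (i, j) \<in> \<mu> \<longrightarrow> (i, Suc j) \<in> \<mu> \<longrightarrow> ?T (i, j) < ?T (i, Suc j)"
        "\<forall>i j. (i, j) \<in> \<mu> \<longrightarrow> (Suc i, j) \<in> \<mu> \<longrightarrow> ?T (i, j) < ?T (Suc i, j)"
        by (metis Diff_iff singletonD)+
      hence "?T \<in> standard_tableaux \<mu>"
        unfolding mem_standard_tableaux using ext bij' by blast
      thus "?T \<in> {T \<in> standard_tableaux \<mu>. T b = card \<mu>}" by simp
    qed
  qed
  thus ?thesis by (simp add: dim_young_def bij_betw_same_card)
qed

lemma dim_young_recursion:
  assumes \<mu>: "\<mu> \<in> young_diagrams" and "\<mu> \<noteq> {}"
  shows "dim_young \<mu> = (\<Sum>b\<in>removable \<mu>. dim_young (\<mu> - {b}))"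
proof -
  let ?S = "\<lambda>b. {T \<in> standard_tableaux \<mu>. T b = card \<mu>}"
  have fin: "finite \<mu>" by (rule finite_young[OF \<mu>])
  have "card \<mu> \<in> {1..card \<mu>}"
    using assms(2) fin by (simp add: card_gt_0_iff Suc_le_eq)
  have "standard_tableaux \<mu> = (\<Union>b\<in>removable \<mu>. ?S b)"
  proof (intro equalityI subsetI)
    fix T assume T: "T \<in> standard_tableaux \<mu>"
    hence "T ` \<mu> = {1..card \<mu>}" by (simp add: mem_standard_tableaux bij_betw_def)
    with \<open>card \<mu> \<in> {1..card \<mu>}\<close> obtain b where "b \<in> \<mu>" "T b = card \<mu>" by (metis imageE)
    thus "T \<in> (\<Union>b\<in>removable \<mu>. ?S b)" using max_box_removable[OF \<mu> T] T by blast
  qed auto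
  hence "dim_young \<mu> = card (\<Union>b\<in>removable \<mu>. ?S b)" by (simp add: dim_young_def)
  also have "\<dots> = (\<Sum>b\<in>removable \<mu>. card (?S b))"
  proof (rule card_UN_disjoint)
    show "\<forall>b\<in>removable \<mu>. finite (?S b)" using finite_standard_tableaux[OF fin] by simp
    show "\<forall>b\<in>removable \<mu>. \<forall>b'\<in>removable \<mu>. b \<noteq> b' \<longrightarrow> ?S b \<inter> ?S b' = {}"
    proof (intro ballI impI)
      fix b b' assume b: "b \<in> removable \<mu>" "b' \<in> removable \<mu>" "b \<noteq> b'"
      hence "b \<in> \<mu>" "b' \<in> \<mu>" by (auto simp: removable_def)
      have ne: "T b \<noteq> T b'" if "T \<in> standard_tableaux \<mu>" for T
      proof -
        have "inj_on T \<mu>" using that by (simp add: mem_standard_tableaux bij_betw_def)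
        thus ?thesis using \<open>b \<in> \<mu>\<close> \<open>b' \<in> \<mu>\<close> b(3) by (metis inj_onD)
      qed
      show "?S b \<inter> ?S b' = {}"
      proof (rule equals0I)
        fix T assume "T \<in> ?S b \<inter> ?S b'"
        thus False using ne[of T] by simp
      qed
    qed
  qed (rule finite_removable[OF \<mu>])
  finally show ?thesis using card_tableaux_max_box[OF \<mu>] by simp
qed

lemma num_rows_remove:
  assumes "\<mu> \<in> young_diagrams" "b \<in> removable \<mu>" "num_rows \<mu> \<le> N"
  shows "num_rows (\<mu> - {b}) \<le> N"
proof -
  obtain a where "b = (Suc a, rowlen \<mu> a)" using assms(2) by (auto simp: removable_eq[OF assms(1)])
  hence "rowlen (\<mu> - {b}) N = 0"
    using row_remove[OF assms(1), of a] row_eq_0_iff[OF assms(1), of N] assms(3) by auto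
  thus ?thesis using row_eq_0_iff[OF removable_facts(1)[OF assms(1,2)]] by simp
qed

lemma num_rows_insert:
  assumes "\<mu> \<in> young_diagrams" "b \<in> addable \<mu>" "num_rows \<mu> < N"
  shows "num_rows (insert b \<mu>) \<le> N"
proof -
  obtain a where a: "b = (Suc a, Suc (rowlen \<mu> a))" "a = 0 \<or> rowlen \<mu> a < rowlen \<mu> (a - 1)"
    using assms(2) by (auto simp: addable_eq[OF assms(1)])
  hence "a < N" using addable_index_less[OF assms(1,3)] by simp
  hence "rowlen (insert b \<mu>) N = 0"
    using a row_insert[OF assms(1)] row_eq_0_iff[OF assms(1), of N] assms(3) by simp
  thus ?thesis using row_eq_0_iff[OF addable_facts(1)[OF assms(1,2)]] by simp
qed

lemma empty_young [simp]: "{} \<in> young_diagrams"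
  by (simp add: young_diagrams_def)

lemma num_rows_empty [simp]: "num_rows {} = 0"
  by (simp add: num_rows_def row_len_def)

lemma rowlen_empty [simp]: "rowlen {} i = 0"
  by (simp add: rowlen_def row_len_def)

lemma dim_young_eq_Phi:
  assumes "\<mu> \<in> young_diagrams" "num_rows \<mu> \<le> N"
  shows "real (dim_young \<mu>) = fact (card \<mu>) * Phi N \<mu> {}"
  using assms
proof (induction "card \<mu>" arbitrary: \<mu>)
  case 0
  hence "\<mu> = {}" using finite_young by auto
  moreover have "standard_tableaux {} = {\<lambda>_. undefined}"
    by (auto simp: standard_tableaux_def bij_betw_def)
  moreover have "Phi N {} {} = Phi 0 {} {}" by (rule Phi_stable) auto
  ultimately show ?case by (simp add: dim_young_def Phi_def sqdet_leibniz)
next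
  case (Suc n)
  hence "\<mu> \<noteq> {}" by auto
  hence "real (dim_young \<mu>) = (\<Sum>b\<in>removable \<mu>. real (dim_young (\<mu> - {b})))"
    by (simp add: dim_young_recursion[OF Suc.prems(1)])
  also have "\<dots> = (\<Sum>b\<in>removable \<mu>. fact n * Phi N (\<mu> - {b}) {})"
  proof (rule sum.cong[OF refl])
    fix b assume b: "b \<in> removable \<mu>"
    have "card (\<mu> - {b}) = n" using removable_facts(2)[OF Suc.prems(1) b] Suc.hyps(2) by simp
    thus "real (dim_young (\<mu> - {b})) = fact n * Phi N (\<mu> - {b}) {}"
      using Suc.hyps(1)[of "\<mu> - {b}"] removable_facts(1)[OF Suc.prems(1) b]
        num_rows_remove[OF Suc.prems(1) b Suc.prems(2)] by simp
  qed
  also have "\<dots> = fact n * (real (card \<mu>) * Phi N \<mu> {})"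
    using Phi_remove_boxes[OF Suc.prems(1) empty_young Suc.prems(2)]
    by (simp flip: sum_distrib_left)
  also have "\<dots> = fact (card \<mu>) * Phi N \<mu> {}"
    by (simp flip: Suc.hyps(2))
  finally show ?case .
qed

section \<open>Values of shifted Schur functions\<close>

text \<open>The strictly decreasing exponents \<open>\<mu>\<^sub>i + N - i\<close>, with \<open>i\<close> counted from 0 and hence \<open>N - 1 - i\<close>.\<close>
definition shifted_row :: "nat \<Rightarrow> box set \<Rightarrow> nat \<Rightarrow> nat" where
  "shifted_row N \<mu> i = rowlen \<mu> i + (N - 1 - i)"

text \<open>The numerator of the factorial Schur polynomial for arbitrary exponents \<open>k\<close>, evaluated at the shifted rows
  of \<open>\<mu>\<close>. For the exponents of the empty diagram it is the Vandermonde determinant.\<close>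
definition alternant :: "nat \<Rightarrow> (nat \<Rightarrow> nat) \<Rightarrow> box set \<Rightarrow> real" where
  "alternant N k \<mu> = sqdet N (\<lambda>i j. falling (real (shifted_row N \<mu> j)) (k i))"

lemma shifted_row_strict:
  assumes "\<mu> \<in> young_diagrams" "i < j" "j < N"
  shows "shifted_row N \<mu> j < shifted_row N \<mu> i"
  using row_antimono[OF assms(1), of i j] assms by (simp add: shifted_row_def)

lemma alternant_eq_Phi:
  "alternant N (shifted_row N \<nu>) \<mu> = (\<Prod>j<N. fact (shifted_row N \<mu> j)) * Phi N \<mu> \<nu>"
proof -
  have "alternant N (shifted_row N \<nu>) \<mu> = sqdet N (\<lambda>i j. fact (shifted_row N \<mu> j) *
      ifact (modified_row \<mu> j - modified_row \<nu> i))"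
    unfolding alternant_def
  proof (rule sqdet_cong)
    fix i j assume "i < N" "j < N"
    hence "int (shifted_row N \<mu> j) - int (shifted_row N \<nu> i) = modified_row \<mu> j - modified_row \<nu> i"
      by (simp add: shifted_row_def modified_row_def of_nat_diff)
    thus "falling (real (shifted_row N \<mu> j)) (shifted_row N \<nu> i) = fact (shifted_row N \<mu> j) *
      ifact (modified_row \<mu> j - modified_row \<nu> i)"
      by (simp add: falling_eq_ifact)
  qed
  thus ?thesis by (simp only: sqdet_scale_cols Phi_def)
qed

lemma alternant_vandermonde:
  "alternant N (shifted_row N {}) \<mu> =
    (\<Prod>i<N. \<Prod>j\<in>{Suc i..<N}. real (shifted_row N \<mu> i) - real (shifted_row N \<mu> j))"
  using sqdet_falling_vandermonde[of N "\<lambda>j. real (shifted_row N \<mu> j)"]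
  by (simp add: alternant_def shifted_row_def[of N "{}"])

lemma alternant_vandermonde_nonzero:
  assumes "\<mu> \<in> young_diagrams"
  shows "alternant N (shifted_row N {}) \<mu> \<noteq> 0"
proof -
  have "real (shifted_row N \<mu> i) - real (shifted_row N \<mu> j) \<noteq> 0" if "j \<in> {Suc i..<N}" for i j
    using shifted_row_strict[OF assms, of i j N] that by simp
  thus ?thesis by (simp add: alternant_vandermonde)
qed

lemma Phi_empty_nonzero: "\<mu> \<in> young_diagrams \<Longrightarrow> Phi N \<mu> {} \<noteq> 0"
  using alternant_vandermonde_nonzero[of \<mu> N] by (auto simp: alternant_eq_Phi)

text \<open>The value at \<open>\<mu>\<close> of the shifted Schur function of \<open>\<nu>\<close>; by \<open>shifted_schur_value_eq\<close> any larger \<open>N\<close> gives the same value.\<close>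
definition shifted_schur_value :: "box set \<Rightarrow> box set \<Rightarrow> real" where
  "shifted_schur_value \<nu> \<mu> = (let N = max (num_rows \<mu>) (num_rows \<nu>) in Phi N \<mu> \<nu> / Phi N \<mu> {})"

lemma shifted_schur_value_eq:
  assumes "\<mu> \<in> young_diagrams" "\<nu> \<in> young_diagrams" "num_rows \<mu> \<le> N" "num_rows \<nu> \<le> N"
  shows "shifted_schur_value \<nu> \<mu> = Phi N \<mu> \<nu> / Phi N \<mu> {}"
proof -
  let ?M = "max (num_rows \<mu>) (num_rows \<nu>)"
  have "Phi N \<mu> \<nu> = Phi ?M \<mu> \<nu>" "Phi N \<mu> {} = Phi ?M \<mu> {}"
    by (rule Phi_stable; use assms in simp)+
  thus ?thesis by (simp add: shifted_schur_value_def Let_def)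
qed

lemma shifted_schur_value_alternant:
  assumes "\<mu> \<in> young_diagrams" "\<nu> \<in> young_diagrams" "num_rows \<mu> \<le> N" "num_rows \<nu> \<le> N"
  shows "shifted_schur_value \<nu> \<mu> * alternant N (shifted_row N {}) \<mu> = alternant N (shifted_row N \<nu>) \<mu>"
  using Phi_empty_nonzero[OF assms(1), of N]
  by (simp add: shifted_schur_value_eq[OF assms] alternant_eq_Phi)

text \<open>This accounts for the convention that the factorial Schur polynomial vanishes if the diagram has more rows than there are variables.\<close>
lemma shifted_schur_value_eq_0:
  assumes "\<mu> \<in> young_diagrams" "\<nu> \<in> young_diagrams" "num_rows \<mu> < num_rows \<nu>"
  shows "shifted_schur_value \<nu> \<mu> = 0"
  using assms Phi_eq_0[OF assms order.refl] by (simp add: shifted_schur_value_eq[of _ _ "num_rows \<nu>"])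

section \<open>Power sums of a diagram\<close>

text \<open>The diagram is the disjoint union of the hooks at its diagonal boxes, and the sum over the contents of a hook
  telescopes to the contribution of one pair of Frobenius coordinates.\<close>
lemma power_sum_fun_contents:
  assumes "\<mu> \<in> young_diagrams"
  shows "power_sum_fun k \<mu> = (\<Sum>b\<in>\<mu>. (of_int (content b) + 1/2) ^ k - (of_int (content b) - 1/2) ^ k)"
proof -
  let ?g = "\<lambda>b. (real_of_int (content b) + 1/2) ^ k - (of_int (content b) - 1/2) ^ k"
  let ?d = "diag_len \<mu>"
  have diag: "(i, i) \<in> \<mu> \<longleftrightarrow> 1 \<le> i \<and> i \<le> ?d" for i
  proof -
    have "{i. (i, i) \<in> \<mu>} \<subseteq> fst ` \<mu>" by force
    hence "finite {i. (i, i) \<in> \<mu>}"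
      using finite_young[OF assms] by (meson finite_imageI finite_subset)
    hence "{i. (i, i) \<in> \<mu>} = {1..?d}"
      unfolding diag_len_def
      by (rule down_closed_eq_atLeastAtMost)
         (use assms young_diagrams_downD[OF assms] mem_young_iff[OF assms] in auto)
    hence "i \<in> {i. (i, i) \<in> \<mu>} \<longleftrightarrow> i \<in> {1..?d}" by blast
    thus ?thesis by simp
  qed
  have col: "(j, i) \<in> \<mu> \<longleftrightarrow> 1 \<le> j \<and> j \<le> row_len (transposed \<mu>) i" for i j
  proof -
    have eq: "{j. (i, j) \<in> transposed \<mu>} = {j. (j, i) \<in> \<mu>}" by (auto simp: transposed_def)
    have "{j. (j, i) \<in> \<mu>} \<subseteq> fst ` \<mu>" by force
    hence "finite {j. (j, i) \<in> \<mu>}"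
      using finite_young[OF assms] by (meson finite_imageI finite_subset)
    hence "{j. (j, i) \<in> \<mu>} = {1..card {j. (j, i) \<in> \<mu>}}"
      by (rule down_closed_eq_atLeastAtMost)
         (use assms young_diagrams_downD[OF assms] mem_young_iff[OF assms] in auto)
    hence "j \<in> {j. (j, i) \<in> \<mu>} \<longleftrightarrow> j \<in> {1..card {j. (j, i) \<in> \<mu>}}" by blast
    thus ?thesis by (simp add: row_len_def eq)
  qed
  have tele: "(\<Sum>x\<in>{a<..b}. f (int x) - f (int x - 1)) = f (int b) - f (int a)"
    if "a \<le> b" for a b and f :: "int \<Rightarrow> real"
    using that
  proof (induction b rule: dec_induct)
    case (step b)
    have "{a<..Suc b} = insert (Suc b) {a<..b}" using step by auto
    thus ?case using step by simp
  qed simp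
  \<comment> \<open>The second part starts below the diagonal, so that the box \<open>(i, i)\<close> is counted once.\<close>
  define hook where "hook i = {(i, j) | j. i \<le> j \<and> j \<le> row_len \<mu> i} \<union>
    {(j, i) | j. i < j \<and> j \<le> row_len (transposed \<mu>) i}" for i
  have hook_sum: "(\<Sum>b\<in>hook i. ?g b) = frobenius_a \<mu> i ^ k - (- frobenius_b \<mu> i) ^ k"
    if i: "i \<in> {1..?d}" for i
  proof -
    let ?r = "row_len \<mu> i" and ?c = "row_len (transposed \<mu>) i"
    have "(i, i) \<in> \<mu>" using i diag by simp
    hence le: "i \<le> ?r" "i \<le> ?c" "1 \<le> i"
      using mem_young_iff_row_len[OF assms, of i i] col[of i i] by auto
    have A: "{(i, j) | j. i \<le> j \<and> j \<le> ?r} = Pair i ` {i - 1<..?r}" using le by auto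
    have B: "{(j, i) | j. i < j \<and> j \<le> ?c} = (\<lambda>j. (j, i)) ` {i<..?c}" by auto
    let ?p = "\<lambda>x. (real_of_int (x - int i) + 1/2) ^ k"
    let ?q = "\<lambda>x. - ((real_of_int (int i - x) - 1/2) ^ k)"
    have "(\<Sum>b\<in>hook i. ?g b) = (\<Sum>j\<in>{i - 1<..?r}. ?g (i, j)) + (\<Sum>j\<in>{i<..?c}. ?g (j, i))"
      unfolding hook_def A B
      by (subst sum.union_disjoint) (auto simp: sum.reindex inj_on_def)
    also have "(\<Sum>j\<in>{i - 1<..?r}. ?g (i, j)) = (\<Sum>j\<in>{i - 1<..?r}. ?p (int j) - ?p (int j - 1))"
      by (intro sum.cong) (auto simp: content_def algebra_simps)
    also have "\<dots> = ?p (int ?r) - ?p (int (i - 1))"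
      by (rule tele) (use le in simp)
    also have "(\<Sum>j\<in>{i<..?c}. ?g (j, i)) = (\<Sum>j\<in>{i<..?c}. ?q (int j) - ?q (int j - 1))"
      by (intro sum.cong) (auto simp: content_def algebra_simps)
    also have "\<dots> = ?q (int ?c) - ?q (int i)"
      by (rule tele) (use le in simp)
    also have "?p (int (i - 1)) = (- 1/2) ^ k" using le by (simp add: of_nat_diff)
    finally show ?thesis
      by (simp add: frobenius_a_def frobenius_b_def algebra_simps)
  qed
  have union: "\<mu> = (\<Union>i\<in>{1..?d}. hook i)"
  proof (intro equalityI subsetI)
    fix b assume b: "b \<in> \<mu>"
    obtain i j where ij: "b = (i, j)" by (cases b)
    have pos: "1 \<le> i" "1 \<le> j" using b ij mem_young_iff[OF assms, of i j] by auto
    have "(min i j, min i j) \<in> \<mu>"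
      by (rule young_diagrams_downD[OF assms b[unfolded ij]]) (use pos in auto)
    hence "min i j \<in> {1..?d}" using diag by simp
    moreover have "b \<in> hook (min i j)"
      using b mem_young_iff_row_len[OF assms, of i j] col[of i j] unfolding ij hook_def
      by (cases "i \<le> j") (auto simp: min_def)
    ultimately show "b \<in> (\<Union>i\<in>{1..?d}. hook i)" by blast
  next
    fix b assume "b \<in> (\<Union>i\<in>{1..?d}. hook i)"
    then obtain i j where i: "i \<in> {1..?d}"
      and "b = (i, j) \<and> i \<le> j \<and> j \<le> row_len \<mu> i \<or> b = (j, i) \<and> i < j \<and> j \<le> row_len (transposed \<mu>) i"
      unfolding hook_def by blast
    thus "b \<in> \<mu>"
    proof (elim disjE conjE)
      assume "b = (i, j)" "i \<le> j" "j \<le> row_len \<mu> i"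
      thus ?thesis using i mem_young_iff_row_len[OF assms, of i j] by simp
    next
      assume "b = (j, i)" "i < j" "j \<le> row_len (transposed \<mu>) i"
      thus ?thesis using i col[of j i] by simp
    qed
  qed
  have "(\<Sum>b\<in>\<mu>. ?g b) = (\<Sum>b\<in>(\<Union>i\<in>{1..?d}. hook i). ?g b)"
    using union by (rule sum.cong) (rule refl)
  also have "\<dots> = (\<Sum>i\<in>{1..?d}. \<Sum>b\<in>hook i. ?g b)"
  proof (rule sum.UNION_disjoint)
    have "finite (\<Union>i\<in>{1..?d}. hook i)"
      using finite_young[OF assms] by (subst (asm) union)
    thus "\<forall>i\<in>{1..?d}. finite (hook i)" by (meson UN_upper finite_subset)
    show "\<forall>i\<in>{1..?d}. \<forall>j\<in>{1..?d}. i \<noteq> j \<longrightarrow> hook i \<inter> hook j = {}"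
      by (auto simp: hook_def)
  qed simp
  also have "\<dots> = power_sum_fun k \<mu>"
    unfolding power_sum_fun_def by (intro sum.cong refl hook_sum)
  finally show ?thesis ..
qed

text \<open>The sum over contents, taken row by row instead of hook by hook, telescopes to the shifted power sum.\<close>
lemma power_sum_fun_rows:
  assumes "\<mu> \<in> young_diagrams" "num_rows \<mu> \<le> N"
  shows "power_sum_fun k \<mu> = (\<Sum>i<N. (real (rowlen \<mu> i) - real i - 1/2) ^ k - (- real i - 1/2) ^ k)"
proof -
  have tele: "(\<Sum>x<n. f (real x + 1) - f (real x)) = f (real n) - f 0" for n and f :: "real \<Rightarrow> real"
    by (induction n) (auto simp: add.commute)
  have "(\<Sum>j<rowlen \<mu> i. (real_of_int (content (Suc i, Suc j)) + 1/2) ^ k -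
      (real_of_int (content (Suc i, Suc j)) - 1/2) ^ k) =
      (real (rowlen \<mu> i) - real i - 1/2) ^ k - (- real i - 1/2) ^ k" for i
    using tele[of "\<lambda>x. (x - real i - 1/2) ^ k" "rowlen \<mu> i"]
    by (simp add: content_def algebra_simps)
  thus ?thesis
    by (simp add: power_sum_fun_contents[OF assms(1)] sum_young_rows[OF assms])
qed

section \<open>Symmetric functions are determined by their values\<close>

text \<open>The real version of \<open>fun_on_young\<close>.\<close>
definition sym_value :: "sym \<Rightarrow> box set \<Rightarrow> real" where
  "sym_value F \<mu> = peval id (\<lambda>n. power_sum_fun (n + 1) \<mu>) F"

text \<open>The diagram with rows \<open>\<sigma> 1, \<dots>, \<sigma> N\<close>, the point at which a polynomial in \<open>N\<close> variables indexed from 1 is evaluated.\<close>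
definition rows_diagram :: "nat \<Rightarrow> (nat \<Rightarrow> nat) \<Rightarrow> box set" where
  "rows_diagram N \<sigma> = diagram_of (\<lambda>i. if i < N then \<sigma> (Suc i) else 0)"

lemma rows_diagram:
  assumes "antimono \<sigma>"
  shows "rows_diagram N \<sigma> \<in> young_diagrams" "num_rows (rows_diagram N \<sigma>) \<le> N"
    "i < N \<Longrightarrow> rowlen (rows_diagram N \<sigma>) i = \<sigma> (Suc i)"
proof -
  show young: "rows_diagram N \<sigma> \<in> young_diagrams"
    unfolding rows_diagram_def
    by (rule diagram_of_young[where N = N]) (use assms in \<open>auto simp: antimono_def\<close>)
  have "rowlen (rows_diagram N \<sigma>) N = 0" by (simp add: rows_diagram_def)
  thus "num_rows (rows_diagram N \<sigma>) \<le> N" using row_eq_0_iff[OF young] by simp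
  show "i < N \<Longrightarrow> rowlen (rows_diagram N \<sigma>) i = \<sigma> (Suc i)" by (simp add: rows_diagram_def)
qed

lemma peval_id_minus: "peval id \<sigma> (p - q) = peval id \<sigma> p - peval id \<sigma> q"
  using peval_id_simps(3)[of \<sigma> "p - q" q] by (simp add: algebra_simps)

lemma peval_id_power: "peval id \<sigma> (p ^ k) = peval id \<sigma> p ^ k"
proof -
  interpret comm_ring_hom "peval id \<sigma>" by (rule peval_id_hom)
  show ?thesis by (rule hom_power)
qed

lemma peval_id_prod: "peval id \<sigma> (\<Prod>x\<in>A. f x) = (\<Prod>x\<in>A. peval id \<sigma> (f x))"
proof -
  interpret comm_ring_hom "peval id \<sigma>" by (rule peval_id_hom)
  show ?thesis by (rule hom_prod)
qed

lemma peval_id_det: "peval id \<sigma> (det (mat n n a)) = det (mat n n (\<lambda>x. peval id \<sigma> (a x)))"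
proof -
  interpret comm_ring_hom "peval id \<sigma>" by (rule peval_id_hom)
  have "map_mat (peval id \<sigma>) (mat n n a) = mat n n (\<lambda>x. peval id \<sigma> (a x))"
    by (intro eq_matI) auto
  thus ?thesis using hom_det[of "mat n n a"] by simp
qed

lemma pconst_of_nat: "pconst (of_nat n) = of_nat n"
  by (simp add: pconst_def)

lemma peval_id_falling: "peval id \<sigma> (falling p n) = falling (peval id \<sigma> p) n"
  unfolding falling_def peval_id_prod peval_id_minus
  by (simp add: peval_id_simps flip: pconst_of_nat)

lemma peval_to_shifted_sym:
  "peval id \<sigma> (to_shifted_sym F N) = peval id (\<lambda>n. \<Sum>i<N.
     (\<sigma> (Suc i) - real i - 1/2) ^ Suc n - (- real i - 1/2) ^ Suc n) F"
proof -
  have "peval id \<sigma> (shifted_power_sum (n + 1) N) =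
      (\<Sum>i<N. (\<sigma> (Suc i) - real i - 1/2) ^ Suc n - (- real i - 1/2) ^ Suc n)" for n
  proof -
    have "peval id \<sigma> (shifted_power_sum (n + 1) N) =
        (\<Sum>i=1..N. (\<sigma> i - real i + 1/2) ^ Suc n - (- real i + 1/2) ^ Suc n)"
      by (simp only: shifted_power_sum_def peval_id_simps peval_id_minus peval_id_power id_apply Suc_eq_plus1)
    also have "\<dots> = (\<Sum>i<N. (\<sigma> (Suc i) - real (Suc i) + 1/2) ^ Suc n - (- real (Suc i) + 1/2) ^ Suc n)"
      by (simp only: One_nat_def sum.atLeast1_atMost_eq)
    also have "\<dots> = (\<Sum>i<N. (\<sigma> (Suc i) - real i - 1/2) ^ Suc n - (- real i - 1/2) ^ Suc n)"
    proof -
      have "y - real (Suc i) + 1/2 = y - real i - 1/2" "- real (Suc i) + 1/2 = - real i - 1/2" for y i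
        by (simp_all add: field_simps)
      thus ?thesis by (simp only:)
    qed
    finally show ?thesis .
  qed
  thus ?thesis by (simp only: to_shifted_sym_def peval_id_comp)
qed

lemma peval_to_shifted_sym_diagram:
  assumes "antimono \<sigma>"
  shows "peval id (\<lambda>n. real (\<sigma> n)) (to_shifted_sym F N) = sym_value F (rows_diagram N \<sigma>)"
proof -
  note D = rows_diagram[OF assms, where N = N]
  have "(\<Sum>i<N. (real (\<sigma> (Suc i)) - real i - 1/2) ^ Suc n - (- real i - 1/2) ^ Suc n) =
      power_sum_fun (n + 1) (rows_diagram N \<sigma>)" for n
    unfolding power_sum_fun_rows[OF D(1,2)] using D(3) by (intro sum.cong) auto
  thus ?thesis by (simp only: peval_to_shifted_sym sym_value_def)
qed

text \<open>Only diagrams with at most \<open>N\<close> rows are needed for polynomials of weight at most \<open>N\<close>; this is what makes expansions independent of \<open>N\<close>.\<close>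
lemma sym_eq_0_if_vanishes:
  assumes wt: "\<And>m. m \<in> Poly_Mapping.keys F \<Longrightarrow> weight m \<le> N"
    and van: "\<And>\<mu>. \<mu> \<in> young_diagrams \<Longrightarrow> num_rows \<mu> \<le> N \<Longrightarrow> sym_value F \<mu> = 0"
  shows "F = 0"
proof -
  have T: "to_shifted_sym F N = 0"
    by (rule poly_ring_eq_0_if_vanishes)
       (simp add: peval_to_shifted_sym_diagram van rows_diagram)
  have "peval id u F = 0" for u
  proof (rule zero_if_vanishes_on_power_sums[OF frechet_deg_peval[OF wt] ptw_continuous_peval])
    fix x :: "nat \<Rightarrow> real"
    have "peval id (\<lambda>n. x (n - 1) + real n - 1/2) (to_shifted_sym F N) = 0"
      by (simp add: T peval_monom_val)
    thus "peval id (\<lambda>n. (\<Sum>i<N. x i ^ Suc n) + - (\<Sum>i<N. (- real i - 1/2) ^ Suc n)) F = 0"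
      by (simp add: peval_to_shifted_sym sum_subtractf)
  qed
  thus ?thesis by (intro poly_ring_eq_0_if_vanishes) simp
qed

lemma sym_value_diff: "sym_value (F - G) \<mu> = sym_value F \<mu> - sym_value G \<mu>"
  by (simp add: sym_value_def peval_id_minus)

lemma sym_value_sum: "sym_value (\<Sum>x\<in>A. F x) \<mu> = (\<Sum>x\<in>A. sym_value (F x) \<mu>)"
  by (simp add: sym_value_def peval_id_simps)

lemma sym_value_mult: "sym_value (F * G) \<mu> = sym_value F \<mu> * sym_value G \<mu>"
  by (simp add: sym_value_def peval_id_simps)

lemma sym_value_const: "sym_value (pconst c) \<mu> = c"
  by (simp add: sym_value_def peval_id_simps)

lemma sym_value_single:
  "sym_value (Poly_Mapping.single m c) \<mu> = c * monom_val (\<lambda>n. power_sum_fun (n + 1) \<mu>) m"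
  by (simp add: sym_value_def comm_ring_hom.peval_single[OF comm_ring_hom_id])

lemma sym_eqI_weight:
  assumes "\<And>m. m \<in> Poly_Mapping.keys F \<Longrightarrow> weight m \<le> N"
    and "\<And>m. m \<in> Poly_Mapping.keys G \<Longrightarrow> weight m \<le> N"
    and "\<And>\<mu>. \<mu> \<in> young_diagrams \<Longrightarrow> num_rows \<mu> \<le> N \<Longrightarrow> sym_value F \<mu> = sym_value G \<mu>"
  shows "F = G"
proof -
  have "F - G = 0"
  proof (rule sym_eq_0_if_vanishes)
    fix m assume "m \<in> Poly_Mapping.keys (F - G)"
    hence "m \<in> Poly_Mapping.keys F \<union> Poly_Mapping.keys G"
      by (auto simp: in_keys_iff lookup_minus)
    thus "weight m \<le> N" using assms(1,2) by auto
  qed (use assms(3) in \<open>simp add: sym_value_diff\<close>)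
  thus ?thesis by simp
qed

lemma sym_eqI:
  assumes "\<And>\<mu>. \<mu> \<in> young_diagrams \<Longrightarrow> sym_value F \<mu> = sym_value G \<mu>"
  shows "F = G"
proof (rule sym_eqI_weight)
  let ?K = "Poly_Mapping.keys F \<union> Poly_Mapping.keys G"
  have "weight m \<le> Max (weight ` ?K)" if "m \<in> ?K" for m
    using that by (intro Max_ge) auto
  thus "m \<in> Poly_Mapping.keys F \<Longrightarrow> weight m \<le> Max (weight ` ?K)"
    "m \<in> Poly_Mapping.keys G \<Longrightarrow> weight m \<le> Max (weight ` ?K)" for m by auto
qed (rule assms)

section \<open>Power sums times the Vandermonde determinant\<close>

text \<open>The span of the alternants whose exponents have sum at most \<open>d\<close> plus the degree of the Vandermonde determinant.
  The exponents are not required to be decreasing.\<close>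
inductive_set alternant_span :: "nat \<Rightarrow> nat \<Rightarrow> (box set \<Rightarrow> real) set" for N d where
  zero: "(\<lambda>_. 0) \<in> alternant_span N d"
| add_scaled: "f \<in> alternant_span N d \<Longrightarrow> (\<Sum>i<N. k i) \<le> d + (\<Sum>i<N. N - 1 - i) \<Longrightarrow>
    (\<lambda>\<mu>. f \<mu> + c * alternant N k \<mu>) \<in> alternant_span N d"

lemma alternant_span_scale:
  "f \<in> alternant_span N d \<Longrightarrow> (\<lambda>\<mu>. c * f \<mu>) \<in> alternant_span N d"
proof (induction rule: alternant_span.induct)
  case (add_scaled f k a)
  from alternant_span.add_scaled[OF add_scaled.IH add_scaled.hyps(2), of "c * a"]
  show ?case by (simp add: algebra_simps)
qed (simp add: alternant_span.zero)

lemma alternant_span_add: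
  "f \<in> alternant_span N d \<Longrightarrow> g \<in> alternant_span N d \<Longrightarrow> (\<lambda>\<mu>. f \<mu> + g \<mu>) \<in> alternant_span N d"
proof (induction rule: alternant_span.induct)
  case (add_scaled f k a)
  from alternant_span.add_scaled[OF add_scaled.IH[OF add_scaled.prems] add_scaled.hyps(2), of a]
  show ?case by (simp add: algebra_simps)
qed simp

lemma alternant_span_sum:
  "(\<And>x. x \<in> A \<Longrightarrow> f x \<in> alternant_span N d) \<Longrightarrow> (\<lambda>\<mu>. \<Sum>x\<in>A. f x \<mu>) \<in> alternant_span N d"
  by (induction A rule: infinite_finite_induct)
     (auto intro: alternant_span.zero alternant_span_add)

lemma alternant_span_mono:
  "f \<in> alternant_span N d \<Longrightarrow> d \<le> d' \<Longrightarrow> f \<in> alternant_span N d'"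
proof (induction rule: alternant_span.induct)
  case (add_scaled f k a)
  thus ?case by (intro alternant_span.add_scaled) auto
qed (simp add: alternant_span.zero)

lemma alternant_in_span:
  "(\<Sum>i<N. k i) \<le> d + (\<Sum>i<N. N - 1 - i) \<Longrightarrow> alternant N k \<in> alternant_span N d"
  using alternant_span.add_scaled[OF alternant_span.zero, of k N d 1] by simp

lemma sqdet_row_add:
  assumes "r < n"
  shows "sqdet n (\<lambda>i. if i = r then (\<lambda>j. b j + c * b' j) else a i) =
    sqdet n (\<lambda>i. if i = r then b else a i) + c * sqdet n (\<lambda>i. if i = r then b' else a i)"
proof -
  have *: "(\<Prod>i<n. (if i = r then f else a i) (p i)) = f (p r) * (\<Prod>i\<in>{..<n} - {r}. a i (p i))"
    for f p
  proof -
    have "(\<Prod>i<n. (if i = r then f else a i) (p i)) =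
        (if r = r then f else a r) (p r) * (\<Prod>i\<in>{..<n} - {r}. (if i = r then f else a i) (p i))"
      by (rule prod.remove) (use assms in auto)
    also have "(\<Prod>i\<in>{..<n} - {r}. (if i = r then f else a i) (p i)) = (\<Prod>i\<in>{..<n} - {r}. a i (p i))"
      by (rule prod.cong) auto
    finally show ?thesis by simp
  qed
  show ?thesis
    unfolding sqdet_leibniz * by (simp add: sum.distrib sum_distrib_left algebra_simps)
qed

text \<open>Induction on \<open>r\<close> with \<open>x falling x \<kappa> = falling x (\<kappa> + 1) + \<kappa> falling x \<kappa>\<close>, applied in row \<open>i\<close> of the determinant.\<close>
lemma power_times_alternant_row:
  assumes "i < N" "(\<Sum>i'\<in>{..<N} - {i}. k i') + \<kappa> \<le> d + (\<Sum>i<N. N - 1 - i)"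
  shows "(\<lambda>\<mu>. sqdet N (\<lambda>i'. if i' = i then (\<lambda>j. real (shifted_row N \<mu> j) ^ r * falling (real (shifted_row N \<mu> j)) \<kappa>)
      else (\<lambda>j. falling (real (shifted_row N \<mu> j)) (k i')))) \<in> alternant_span N (d + r)"
  using assms(2)
proof (induction r arbitrary: \<kappa> d)
  case 0
  let ?k = "k(i := \<kappa>)"
  have "(\<Sum>i'<N. ?k i') = \<kappa> + (\<Sum>i'\<in>{..<N} - {i}. ?k i')"
    using assms(1) by (subst sum.remove[of _ i]) auto
  also have "(\<Sum>i'\<in>{..<N} - {i}. ?k i') = (\<Sum>i'\<in>{..<N} - {i}. k i')"
    by (rule sum.cong) auto
  finally have "alternant N ?k \<in> alternant_span N d"
    using 0 by (intro alternant_in_span) simp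
  moreover have "alternant N ?k = (\<lambda>\<mu>. sqdet N (\<lambda>i'. if i' = i then (\<lambda>j. real (shifted_row N \<mu> j) ^ 0 * falling (real (shifted_row N \<mu> j)) \<kappa>)
      else (\<lambda>j. falling (real (shifted_row N \<mu> j)) (k i'))))"
    unfolding alternant_def by (intro ext sqdet_cong) auto
  ultimately show ?case by simp
next
  case (Suc r)
  let ?D = "\<lambda>r \<kappa> \<mu>. sqdet N (\<lambda>i'. if i' = i then (\<lambda>j. real (shifted_row N \<mu> j) ^ r * falling (real (shifted_row N \<mu> j)) \<kappa>)
      else (\<lambda>j. falling (real (shifted_row N \<mu> j)) (k i')))"
  have "?D r (Suc \<kappa>) \<in> alternant_span N (Suc d + r)"
    using Suc.prems by (intro Suc.IH) simp
  moreover have "?D r \<kappa> \<in> alternant_span N (d + r)"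
    by (rule Suc.IH[OF Suc.prems])
  hence "?D r \<kappa> \<in> alternant_span N (Suc d + r)"
    by (rule alternant_span_mono) simp
  ultimately have "(\<lambda>\<mu>. ?D r (Suc \<kappa>) \<mu> + real \<kappa> * ?D r \<kappa> \<mu>) \<in> alternant_span N (Suc d + r)"
    by (intro alternant_span_add alternant_span_scale)
  moreover have "?D (Suc r) \<kappa> \<mu> = ?D r (Suc \<kappa>) \<mu> + real \<kappa> * ?D r \<kappa> \<mu>" for \<mu>
  proof -
    have "?D (Suc r) \<kappa> \<mu> = sqdet N (\<lambda>i'. if i' = i then (\<lambda>j. real (shifted_row N \<mu> j) ^ r * falling (real (shifted_row N \<mu> j)) (Suc \<kappa>) +
        real \<kappa> * (real (shifted_row N \<mu> j) ^ r * falling (real (shifted_row N \<mu> j)) \<kappa>))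
      else (\<lambda>j. falling (real (shifted_row N \<mu> j)) (k i')))"
      by (intro sqdet_cong) (auto simp: falling_Suc algebra_simps)
    also have "\<dots> = ?D r (Suc \<kappa>) \<mu> + real \<kappa> * ?D r \<kappa> \<mu>"
      by (rule sqdet_row_add[OF assms(1)])
    finally show ?thesis .
  qed
  ultimately show ?case by simp
qed

text \<open>Multiplication by \<open>\<Sum> x\<^sub>j ^ r\<close> is a derivative of the determinant, hence a sum over its rows.\<close>
lemma alternant_span_mult_moment:
  assumes "f \<in> alternant_span N d"
  shows "(\<lambda>\<mu>. (\<Sum>j<N. real (shifted_row N \<mu> j) ^ r) * f \<mu>) \<in> alternant_span N (d + r)"
  using assms
proof (induction rule: alternant_span.induct)
  case zero
  show ?case by (simp add: alternant_span.zero)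
next
  case (add_scaled f k c)
  let ?x = "\<lambda>\<mu> j. real (shifted_row N \<mu> j)"
  have "(\<lambda>\<mu>. \<Sum>i<N. sqdet N (\<lambda>i'. if i' = i then (\<lambda>j. ?x \<mu> j ^ r * falling (?x \<mu> j) (k i))
      else (\<lambda>j. falling (?x \<mu> j) (k i')))) \<in> alternant_span N (d + r)"
  proof (intro alternant_span_sum power_times_alternant_row)
    fix i assume "i \<in> {..<N}"
    thus "(\<Sum>i'\<in>{..<N} - {i}. k i') + k i \<le> d + (\<Sum>i<N. N - 1 - i)"
      using add_scaled.hyps(2) by (subst (asm) sum.remove[of "{..<N}" i]) auto
  qed auto
  moreover have "(\<Sum>j<N. ?x \<mu> j ^ r) * alternant N k \<mu> =
      (\<Sum>i<N. sqdet N (\<lambda>i'. if i' = i then (\<lambda>j. ?x \<mu> j ^ r * falling (?x \<mu> j) (k i))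
      else (\<lambda>j. falling (?x \<mu> j) (k i'))))" for \<mu>
  proof -
    have "(\<Sum>j<N. ?x \<mu> j ^ r) * alternant N k \<mu> = det_deriv N (\<lambda>i j. falling (?x \<mu> j) (k i))
        (\<lambda>i j. ?x \<mu> j ^ r * falling (?x \<mu> j) (k i))"
      using det_deriv_scale[of N "\<lambda>i j. falling (?x \<mu> j) (k i)" "\<lambda>j. ?x \<mu> j ^ r" "\<lambda>_. 0"]
      by (simp add: alternant_def)
    also have "\<dots> = (\<Sum>i<N. sqdet N (\<lambda>i'. if i' = i then (\<lambda>j. ?x \<mu> j ^ r * falling (?x \<mu> j) (k i))
      else (\<lambda>j. falling (?x \<mu> j) (k i'))))"
      unfolding det_deriv_rows by (intro sum.cong refl sqdet_cong) auto
    finally show ?thesis .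
  qed
  ultimately have "(\<lambda>\<mu>. (\<Sum>j<N. ?x \<mu> j ^ r) * f \<mu> + c * ((\<Sum>j<N. ?x \<mu> j ^ r) * alternant N k \<mu>))
      \<in> alternant_span N (d + r)"
    using add_scaled.IH by (intro alternant_span_add alternant_span_scale) auto
  thus ?case by (simp add: algebra_simps)
qed

text \<open>The right-hand side of \<open>power_sum_fun_rows\<close>, as a function of all diagrams for a fixed number \<open>N\<close> of rows.\<close>
definition power_sum_rows :: "nat \<Rightarrow> nat \<Rightarrow> box set \<Rightarrow> real" where
  "power_sum_rows N k \<mu> = (\<Sum>i<N. (real (rowlen \<mu> i) - real i - 1/2) ^ k - (- real i - 1/2) ^ k)"

lemma alternant_span_mult_power_sum:
  assumes "f \<in> alternant_span N d"
  shows "(\<lambda>\<mu>. power_sum_rows N k \<mu> * f \<mu>) \<in> alternant_span N (d + k)"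
proof -
  let ?M = "\<lambda>r \<mu>. \<Sum>j<N. real (shifted_row N \<mu> j) ^ r"
  let ?a = "1/2 - real N"
  have p: "power_sum_rows N k \<mu> = (\<Sum>r\<le>k. real (k choose r) * ?a ^ (k - r) * ?M r \<mu>) +
      - (\<Sum>i<N. (- real i - 1/2) ^ k)" for \<mu>
  proof -
    have "(\<Sum>i<N. (real (rowlen \<mu> i) - real i - 1/2) ^ k) = (\<Sum>j<N. (real (shifted_row N \<mu> j) + ?a) ^ k)"
      by (intro sum.cong refl arg_cong[where f = "\<lambda>x. x ^ k"]) (simp add: shifted_row_def of_nat_diff)
    also have "\<dots> = (\<Sum>j<N. \<Sum>r\<le>k. real (k choose r) * real (shifted_row N \<mu> j) ^ r * ?a ^ (k - r))"
      by (simp only: binomial_ring)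
    also have "\<dots> = (\<Sum>r\<le>k. real (k choose r) * ?a ^ (k - r) * ?M r \<mu>)"
      by (subst sum.swap, intro sum.cong refl, subst sum_distrib_left, intro sum.cong refl) simp
    finally show ?thesis by (simp add: power_sum_rows_def sum_subtractf)
  qed
  have "(\<lambda>\<mu>. (\<Sum>r\<le>k. (real (k choose r) * ?a ^ (k - r)) * (?M r \<mu> * f \<mu>)) +
      - (\<Sum>i<N. (- real i - 1/2) ^ k) * f \<mu>) \<in> alternant_span N (d + k)"
  proof (intro alternant_span_add alternant_span_sum alternant_span_scale)
    fix r assume "r \<in> {..k}"
    thus "(\<lambda>\<mu>. ?M r \<mu> * f \<mu>) \<in> alternant_span N (d + k)"
      by (intro alternant_span_mono[OF alternant_span_mult_moment[OF assms]]) simp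
  next
    show "f \<in> alternant_span N (d + k)" by (rule alternant_span_mono[OF assms]) simp
  qed
  thus ?thesis by (simp only: p distrib_right sum_distrib_right mult.assoc)
qed

lemma alternant_span_monomial:
  "(\<lambda>\<mu>. monom_val (\<lambda>n. power_sum_rows N (n + 1) \<mu>) m * alternant N (shifted_row N {}) \<mu>)
    \<in> alternant_span N (weight m)"
proof -
  have pow: "(\<lambda>\<mu>. power_sum_rows N (n + 1) \<mu> ^ e * f \<mu>) \<in> alternant_span N (d + e * Suc n)"
    if "f \<in> alternant_span N d" for e n f d
  proof (induction e)
    case (Suc e)
    from alternant_span_mult_power_sum[OF Suc.IH, of "n + 1"] show ?case by (simp add: mult_ac add_ac)
  qed (use that in simp)
  have "(\<lambda>\<mu>. (\<Prod>n\<in>A. power_sum_rows N (n + 1) \<mu> ^ e n) * alternant N (shifted_row N {}) \<mu>)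
      \<in> alternant_span N (\<Sum>n\<in>A. e n * Suc n)" if "finite A" for A e
    using that
  proof (induction A rule: finite_induct)
    case empty
    have "alternant N (shifted_row N {}) \<in> alternant_span N 0"
      by (rule alternant_in_span) (simp add: shifted_row_def)
    thus ?case by simp
  next
    case (insert n A)
    from pow[OF insert.IH, of n "e n"] show ?case
      using insert.hyps by (simp add: mult_ac add_ac)
  qed
  thus ?thesis by (simp add: monom_val_def weight_def)
qed

section \<open>Inverting the expansion of power sums in Schur functions\<close>

text \<open>The diagrams with at most \<open>N\<close> rows and at most \<open>d\<close> boxes.\<close>
definition small_diagrams :: "nat \<Rightarrow> nat \<Rightarrow> box set set" where
  "small_diagrams N d = {\<nu> \<in> young_diagrams. num_rows \<nu> \<le> N \<and> card \<nu> \<le> d}"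

lemma finite_small_diagrams: "finite (small_diagrams N d)"
proof -
  have "\<nu> \<subseteq> {..d} \<times> {..d}" if \<nu>: "\<nu> \<in> young_diagrams" "card \<nu> \<le> d" for \<nu>
  proof
    fix b assume b: "b \<in> \<nu>"
    obtain i j where ij: "b = (i, j)" by (cases b)
    have fin: "finite \<nu>" by (rule finite_young[OF \<nu>(1)])
    have pos: "1 \<le> i" "1 \<le> j" using b ij mem_young_iff[OF \<nu>(1), of i j] by auto
    have "{1..i} \<times> {1} \<subseteq> \<nu>" "{1} \<times> {1..j} \<subseteq> \<nu>"
      using young_diagrams_downD[OF \<nu>(1) b[unfolded ij]] pos by auto
    from this[THEN card_mono[OF fin]] have "card ({1..i} \<times> {1::nat}) \<le> card \<nu>"
      "card ({1::nat} \<times> {1..j}) \<le> card \<nu>" .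
    thus "b \<in> {..d} \<times> {..d}" using \<nu>(2) ij by simp
  qed
  hence "small_diagrams N d \<subseteq> Pow ({..d} \<times> {..d})"
    unfolding small_diagrams_def by blast
  thus ?thesis by (rule finite_subset) simp
qed

lemma sort_decreasing:
  fixes k :: "nat \<Rightarrow> nat"
  assumes inj: "inj_on k {..<N}"
  shows "\<exists>\<pi>. \<pi> permutes {..<N} \<and> (\<forall>i j. i < j \<longrightarrow> j < N \<longrightarrow> k (\<pi> j) < k (\<pi> i))"
proof -
  define xs where "xs = rev (sorted_list_of_set (k ` {..<N}))"
  have len: "length xs = N" using card_image[OF inj] by (simp add: xs_def)
  have set: "set xs = k ` {..<N}" by (simp add: xs_def)
  have dist: "distinct xs" by (simp add: xs_def)
  have dec: "xs ! j < xs ! i" if "i < j" "j < N" for i j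
  proof -
    have "sorted_wrt (\<lambda>x y. y < x) xs"
      using strict_sorted_list_of_set[of "k ` {..<N}"] by (simp add: xs_def sorted_wrt_rev)
    thus ?thesis using that len by (simp add: sorted_wrt_iff_nth_less)
  qed
  define \<pi> where "\<pi> i = (if i < N then the_inv_into {..<N} k (xs ! i) else i)" for i
  have k\<pi>: "k (\<pi> i) = xs ! i" "\<pi> i \<in> {..<N}" if "i < N" for i
  proof -
    have "xs ! i \<in> k ` {..<N}" using that len set nth_mem by blast
    thus "k (\<pi> i) = xs ! i" "\<pi> i \<in> {..<N}"
      using that f_the_inv_into_f[OF inj] the_inv_into_into[OF inj _ order.refl] by (auto simp: \<pi>_def)
  qed
  have "inj_on \<pi> {..<N}"
  proof
    fix i j assume ij: "i \<in> {..<N}" "j \<in> {..<N}" "\<pi> i = \<pi> j"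
    hence "xs ! i = xs ! j" using k\<pi>(1)[of i] k\<pi>(1)[of j] by simp
    thus "i = j" using dist ij len by (simp add: nth_eq_iff_index_eq)
  qed
  moreover have "\<pi> ` {..<N} \<subseteq> {..<N}" using k\<pi>(2) by auto
  ultimately have "bij_betw \<pi> {..<N} {..<N}"
    by (simp add: bij_betw_def endo_inj_surj)
  hence "\<pi> permutes {..<N}"
    by (rule bij_imp_permutes) (simp add: \<pi>_def)
  moreover have "k (\<pi> j) < k (\<pi> i)" if "i < j" "j < N" for i j
    using dec[OF that] k\<pi>(1)[of i] k\<pi>(1)[of j] that by simp
  ultimately show ?thesis by blast
qed

text \<open>Up to sign, an alternant with distinct exponents is one with decreasing exponents, which are the shifted rows of a diagram.\<close>
lemma alternant_straighten:
  assumes deg: "(\<Sum>i<N. k i) \<le> d + (\<Sum>i<N. N - 1 - i)"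
  shows "\<exists>\<nu>\<in>small_diagrams N d. \<exists>s. \<forall>\<mu>. alternant N k \<mu> = s * alternant N (shifted_row N \<nu>) \<mu>"
proof (cases "inj_on k {..<N}")
  case False
  then obtain i j where "i < N" "j < N" "i \<noteq> j" "k i = k j" by (auto simp: inj_on_def)
  hence "alternant N k \<mu> = 0" for \<mu>
    unfolding alternant_def by (intro sqdet_equal_rows[of i N j]) auto
  moreover have "{} \<in> small_diagrams N d" by (simp add: small_diagrams_def)
  ultimately show ?thesis by (intro bexI[of _ "{}"] exI[of _ 0]) auto
next
  case True
  from sort_decreasing[OF this] obtain \<pi> where \<pi>: "\<pi> permutes {..<N}"
    and dec: "\<And>i j. i < j \<Longrightarrow> j < N \<Longrightarrow> k (\<pi> j) < k (\<pi> i)"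
    by blast
  define e where "e i = k (\<pi> i)" for i
  have lower: "t \<le> e (N - 1 - t)" if "t < N" for t
    using that
  proof (induction t)
    case (Suc t)
    have "e (N - 1 - t) < e (N - 1 - Suc t)"
      unfolding e_def by (rule dec) (use Suc.prems in auto)
    thus ?case using Suc by simp
  qed simp
  have ge: "N - 1 - i \<le> e i" if "i < N" for i
    using lower[of "N - 1 - i"] that by simp
  define f where "f i = (if i < N then e i - (N - 1 - i) else 0)" for i
  have "f (Suc i) \<le> f i" for i
  proof (cases "Suc i < N")
    case True
    hence "e (Suc i) < e i" unfolding e_def by (intro dec) auto
    thus ?thesis using True by (simp add: f_def)
  qed (simp add: f_def)
  hence anti: "antimono f" by (simp add: antimono_iff_le_Suc)
  have \<nu>: "diagram_of f \<in> young_diagrams"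
    by (rule diagram_of_young[OF anti, where N = N]) (simp add: f_def)
  have rows: "num_rows (diagram_of f) \<le> N"
    using row_eq_0_iff[OF \<nu>, of N] by (simp add: f_def)
  have e: "shifted_row N (diagram_of f) i = e i" if "i < N" for i
    using ge[OF that] that by (simp add: shifted_row_def f_def)
  have "card (diagram_of f) + (\<Sum>i<N. N - 1 - i) = (\<Sum>i<N. e i)"
    unfolding card_eq_sum_rows[OF \<nu> rows] sum.distrib[symmetric]
    using e by (intro sum.cong) (auto simp: shifted_row_def)
  also have "\<dots> = (\<Sum>i<N. k i)"
    using sum.permute[OF \<pi>, of k] by (simp add: o_def e_def)
  finally have "card (diagram_of f) \<le> d" using deg by simp
  hence "diagram_of f \<in> small_diagrams N d" using \<nu> rows by (simp add: small_diagrams_def)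
  moreover have "alternant N k \<mu> = of_int (sign \<pi>) * alternant N (shifted_row N (diagram_of f)) \<mu>" for \<mu>
  proof -
    let ?a = "\<lambda>i j. falling (real (shifted_row N \<mu> j)) (k i)"
    have "alternant N (shifted_row N (diagram_of f)) \<mu> = sqdet N (\<lambda>i. ?a (\<pi> i))"
      unfolding alternant_def by (rule sqdet_cong) (simp add: e e_def)
    also have "\<dots> = of_int (sign \<pi>) * alternant N k \<mu>"
      unfolding alternant_def by (rule sqdet_permute_rows[OF \<pi>])
    finally show ?thesis by (simp add: sign_def)
  qed
  ultimately show ?thesis by blast
qed

lemma alternant_span_expansion:
  assumes "f \<in> alternant_span N d"
  shows "\<exists>c. \<forall>\<mu>. f \<mu> = (\<Sum>\<nu>\<in>small_diagrams N d. c \<nu> * alternant N (shifted_row N \<nu>) \<mu>)"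
  using assms
proof (induction rule: alternant_span.induct)
  case zero
  show ?case by (intro exI[of _ "\<lambda>_. 0"]) simp
next
  case (add_scaled f k a)
  then obtain c where c: "f \<mu> = (\<Sum>\<nu>\<in>small_diagrams N d. c \<nu> * alternant N (shifted_row N \<nu>) \<mu>)" for \<mu>
    by blast
  from alternant_straighten[OF add_scaled.hyps(2)] obtain \<nu>0 s where
    \<nu>0: "\<nu>0 \<in> small_diagrams N d" "alternant N k \<mu> = s * alternant N (shifted_row N \<nu>0) \<mu>" for \<mu>
    by blast
  have "f \<mu> + a * alternant N k \<mu> = (\<Sum>\<nu>\<in>small_diagrams N d.
      (c \<nu> + (if \<nu> = \<nu>0 then a * s else 0)) * alternant N (shifted_row N \<nu>) \<mu>)" for \<mu>
  proof -
    have "(\<Sum>\<nu>\<in>small_diagrams N d. (c \<nu> + (if \<nu> = \<nu>0 then a * s else 0)) * alternant N (shifted_row N \<nu>) \<mu>) =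
        f \<mu> + (\<Sum>\<nu>\<in>small_diagrams N d. if \<nu> = \<nu>0 then a * s * alternant N (shifted_row N \<nu>) \<mu> else 0)"
      unfolding c distrib_right sum.distrib by (intro arg_cong[where f = "(+) _"] sum.cong) auto
    also have "\<dots> = f \<mu> + a * alternant N k \<mu>"
      using \<nu>0 by (simp add: finite_small_diagrams)
    finally show ?thesis ..
  qed
  thus ?case by (intro exI[of _ "\<lambda>\<nu>. c \<nu> + (if \<nu> = \<nu>0 then a * s else 0)"] allI)
qed

lemma monomial_schur_expansion:
  assumes "weight m \<le> d"
  shows "\<exists>c. \<forall>\<mu>. \<mu> \<in> young_diagrams \<longrightarrow> num_rows \<mu> \<le> N \<longrightarrow>
    monom_val (\<lambda>n. power_sum_fun (n + 1) \<mu>) m = (\<Sum>\<nu>\<in>small_diagrams N d. c \<nu> * shifted_schur_value \<nu> \<mu>)"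
proof -
  let ?V = "alternant N (shifted_row N {})"
  obtain c where c: "monom_val (\<lambda>n. power_sum_rows N (n + 1) \<mu>) m * ?V \<mu> =
      (\<Sum>\<nu>\<in>small_diagrams N d. c \<nu> * alternant N (shifted_row N \<nu>) \<mu>)" for \<mu>
    using alternant_span_expansion[OF alternant_span_mono[OF alternant_span_monomial assms]] by blast
  have "monom_val (\<lambda>n. power_sum_fun (n + 1) \<mu>) m = (\<Sum>\<nu>\<in>small_diagrams N d. c \<nu> * shifted_schur_value \<nu> \<mu>)"
    if \<mu>: "\<mu> \<in> young_diagrams" "num_rows \<mu> \<le> N" for \<mu>
  proof -
    have "monom_val (\<lambda>n. power_sum_fun (n + 1) \<mu>) m * ?V \<mu> =
        (\<Sum>\<nu>\<in>small_diagrams N d. c \<nu> * alternant N (shifted_row N \<nu>) \<mu>)"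
      using c[of \<mu>] by (simp only: power_sum_rows_def power_sum_fun_rows[OF \<mu>])
    also have "\<dots> = (\<Sum>\<nu>\<in>small_diagrams N d. c \<nu> * shifted_schur_value \<nu> \<mu>) * ?V \<mu>"
      unfolding sum_distrib_right mult.assoc
      by (intro sum.cong refl) (simp add: shifted_schur_value_alternant \<mu> small_diagrams_def)
    finally show ?thesis using alternant_vandermonde_nonzero[OF \<mu>(1), of N] by simp
  qed
  thus ?thesis by blast
qed

lemma left_inverse_if_rows_independent:
  fixes M :: "'d \<Rightarrow> 'd \<Rightarrow> real"
  assumes fin: "finite D"
    and ind: "\<And>c. (\<And>k. k \<in> D \<Longrightarrow> (\<Sum>i\<in>D. c i * M i k) = 0) \<Longrightarrow> \<forall>i\<in>D. c i = 0"
  shows "\<exists>B. \<forall>j\<in>D. \<forall>k\<in>D. (\<Sum>i\<in>D. B j i * M i k) = (if j = k then 1 else 0)"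
proof -
  define n where "n = card D"
  obtain h where h: "bij_betw h {..<n} D"
    using ex_bij_betw_nat_finite[OF fin] by (auto simp: n_def atLeast0LessThan)
  define g where "g = the_inv_into {..<n} h"
  have g: "h (g x) = x" "g x < n" if "x \<in> D" for x
    using that h f_the_inv_into_f_bij_betw[OF h] the_inv_into_into[of h "{..<n}" x "{..<n}"]
    by (auto simp: g_def bij_betw_def)
  have gh: "g (h a) = a" if "a < n" for a
    using that h by (simp add: g_def the_inv_into_f_f bij_betw_def)
  have hD: "h a \<in> D" if "a < n" for a using that h by (auto simp: bij_betw_def)
  have reindex: "(\<Sum>i\<in>D. F i) = (\<Sum>a<n. F (h a))" for F :: "'d \<Rightarrow> real"
    by (rule sum.reindex_bij_betw[OF h, symmetric])
  define A where "A = mat n n (\<lambda>(a, b). M (h a) (h b))"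
  have A: "A \<in> carrier_mat n n" by (simp add: A_def)
  have "det A \<noteq> 0"
  proof
    assume "det A = 0"
    hence "det (transpose_mat A) = 0" using det_transpose[OF A] by simp
    then obtain v where v: "v \<in> carrier_vec n" "v \<noteq> 0\<^sub>v n" "transpose_mat A *\<^sub>v v = 0\<^sub>v n"
      using det_0_iff_vec_prod_zero[of "transpose_mat A" n] A by auto
    have "\<forall>i\<in>D. v $ g i = 0"
    proof (rule ind)
      fix k assume k: "k \<in> D"
      have "(transpose_mat A *\<^sub>v v) $ g k = (\<Sum>a<n. M (h a) k * v $ a)"
        using g[OF k] v(1) A by (simp add: A_def scalar_prod_def atLeast0LessThan)
      thus "(\<Sum>i\<in>D. v $ g i * M i k) = 0"
        using v(3) g[OF k] by (simp add: reindex gh mult.commute)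
    qed
    hence "v $ a = 0" if "a < n" for a using gh[OF that] hD[OF that] by metis
    hence "v = 0\<^sub>v n" using v(1) by (intro eq_vecI) auto
    thus False using v(2) by simp
  qed
  have adj: "adj_mat A \<in> carrier_mat n n" "adj_mat A * A = det A \<cdot>\<^sub>m 1\<^sub>m n"
    using adj_mat[OF A] by auto
  have "(\<Sum>i\<in>D. adj_mat A $$ (g j, g i) / det A * M i k) = (if j = k then 1 else 0)"
    if jk: "j \<in> D" "k \<in> D" for j k
  proof -
    have "(\<Sum>i\<in>D. adj_mat A $$ (g j, g i) / det A * M i k) =
        (\<Sum>a<n. adj_mat A $$ (g j, a) * A $$ (a, g k)) / det A"
      unfolding reindex sum_divide_distrib
      using g jk by (intro sum.cong) (auto simp: gh A_def)
    also have "(\<Sum>a<n. adj_mat A $$ (g j, a) * A $$ (a, g k)) = (adj_mat A * A) $$ (g j, g k)"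
      using g jk A adj(1) by (simp add: scalar_prod_def atLeast0LessThan)
    also have "\<dots> = (if j = k then det A else 0)"
      using g[OF jk(1)] g[OF jk(2)] by (auto simp: adj(2))
    finally show ?thesis using \<open>det A \<noteq> 0\<close> by simp
  qed
  thus ?thesis by (intro exI[of _ "\<lambda>j i. adj_mat A $$ (g j, g i) / det A"]) blast
qed

text \<open>The monomial in which \<open>p\<^sub>k\<close> occurs as often as there are columns of length \<open>k\<close> in \<open>\<nu>\<close>. It provides as many
  independent monomials as there are diagrams.\<close>
definition column_monomial :: "box set \<Rightarrow> nat \<Rightarrow>\<^sub>0 nat" where
  "column_monomial \<nu> = Abs_poly_mapping (\<lambda>n. rowlen \<nu> n - rowlen \<nu> (Suc n))"

lemma lookup_column_monomial:
  assumes "\<nu> \<in> young_diagrams"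
  shows "Poly_Mapping.lookup (column_monomial \<nu>) n = rowlen \<nu> n - rowlen \<nu> (Suc n)"
proof -
  have "finite {n. rowlen \<nu> n - rowlen \<nu> (Suc n) \<noteq> 0}"
    by (rule finite_subset[OF _ finite_row_support[OF assms]]) auto
  thus ?thesis unfolding column_monomial_def by simp
qed

lemma weight_superset:
  assumes "finite A" "Poly_Mapping.keys m \<subseteq> A"
  shows "weight m = (\<Sum>n\<in>A. Poly_Mapping.lookup m n * Suc n)"
  unfolding weight_def using assms by (intro sum.mono_neutral_left) (auto simp: in_keys_iff)

lemma weight_column_monomial:
  assumes "\<nu> \<in> young_diagrams"
  shows "weight (column_monomial \<nu>) = card \<nu>"
proof -
  let ?N = "num_rows \<nu>"
  have "(\<Sum>n<N. (rowlen \<nu> n - rowlen \<nu> (Suc n)) * Suc n) + N * rowlen \<nu> N = (\<Sum>n<N. rowlen \<nu> n)" for N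
  proof (induction N)
    case (Suc N)
    have "rowlen \<nu> (Suc N) \<le> rowlen \<nu> N" by (rule row_antimono[OF assms]) simp
    then obtain e where "rowlen \<nu> N = rowlen \<nu> (Suc N) + e" using le_Suc_ex by blast
    thus ?case using Suc by (simp add: algebra_simps)
  qed simp
  from this[of ?N] have "(\<Sum>n<?N. (rowlen \<nu> n - rowlen \<nu> (Suc n)) * Suc n) = card \<nu>"
    using row_eq_0_iff[OF assms, of ?N] card_eq_sum_rows[OF assms order.refl] by simp
  moreover have "Poly_Mapping.keys (column_monomial \<nu>) \<subseteq> {..<?N}"
  proof
    fix n assume "n \<in> Poly_Mapping.keys (column_monomial \<nu>)"
    hence "rowlen \<nu> n \<noteq> 0" by (simp add: in_keys_iff lookup_column_monomial[OF assms])
    thus "n \<in> {..<?N}" using row_eq_0_iff[OF assms, of n] by simp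
  qed
  ultimately show ?thesis
    by (simp only: weight_superset[OF finite_lessThan] lookup_column_monomial[OF assms])
qed

lemma inj_column_monomial: "inj_on column_monomial young_diagrams"
proof
  fix \<mu> \<nu> assume \<mu>: "\<mu> \<in> young_diagrams" and \<nu>: "\<nu> \<in> young_diagrams"
    and eq: "column_monomial \<mu> = column_monomial \<nu>"
  let ?N = "max (num_rows \<mu>) (num_rows \<nu>)"
  have diff: "rowlen \<mu> n - rowlen \<mu> (Suc n) = rowlen \<nu> n - rowlen \<nu> (Suc n)" for n
    using eq lookup_column_monomial[OF \<mu>, of n] lookup_column_monomial[OF \<nu>, of n] by simp
  have "rowlen \<mu> n = rowlen \<nu> n" for n
  proof (cases "n \<le> ?N")
    case True
    thus ?thesis
    proof (induction n rule: inc_induct)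
      case base
      show ?case using row_eq_0_iff[OF \<mu>, of ?N] row_eq_0_iff[OF \<nu>, of ?N] by simp
    next
      case (step n)
      have "rowlen \<mu> (Suc n) \<le> rowlen \<mu> n" "rowlen \<nu> (Suc n) \<le> rowlen \<nu> n"
        by (rule row_antimono[OF \<mu>], simp, rule row_antimono[OF \<nu>], simp)
      thus ?case using diff[of n] step by linarith
    qed
  next
    case False
    hence "num_rows \<mu> \<le> n" "num_rows \<nu> \<le> n" by auto
    hence "rowlen \<mu> n = 0" "rowlen \<nu> n = 0" by (simp_all add: row_eq_0_iff \<mu> \<nu>)
    thus ?thesis by simp
  qed
  thus "\<mu> = \<nu>" by (rule young_eqI[OF \<mu> \<nu>])
qed

section \<open>Existence of the Frobenius--Schur functions\<close>

lemma schur_sym_exists_rows: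
  assumes \<nu>: "\<nu> \<in> young_diagrams" and N: "card \<nu> \<le> N"
  shows "\<exists>F. (\<forall>m\<in>Poly_Mapping.keys F. weight m \<le> card \<nu>) \<and>
    (\<forall>\<mu>\<in>young_diagrams. num_rows \<mu> \<le> N \<longrightarrow> sym_value F \<mu> = shifted_schur_value \<nu> \<mu>)"
proof -
  let ?d = "card \<nu>"
  let ?D = "small_diagrams N ?d"
  note fin = finite_small_diagrams[of N ?d]
  have D: "\<kappa> \<in> young_diagrams" "weight (column_monomial \<kappa>) \<le> ?d" if "\<kappa> \<in> ?D" for \<kappa>
    using that by (auto simp: small_diagrams_def weight_column_monomial)
  have "\<forall>\<kappa>\<in>?D. \<exists>c. \<forall>\<mu>. \<mu> \<in> young_diagrams \<longrightarrow> num_rows \<mu> \<le> N \<longrightarrow>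
    monom_val (\<lambda>n. power_sum_fun (n + 1) \<mu>) (column_monomial \<kappa>) =
    (\<Sum>\<rho>\<in>?D. c \<rho> * shifted_schur_value \<rho> \<mu>)"
    using monomial_schur_expansion D(2) by blast
  from bchoice[OF this] obtain M where M0: "\<forall>\<kappa>\<in>?D. \<forall>\<mu>. \<mu> \<in> young_diagrams \<longrightarrow> num_rows \<mu> \<le> N \<longrightarrow>
    monom_val (\<lambda>n. power_sum_fun (n + 1) \<mu>) (column_monomial \<kappa>) =
    (\<Sum>\<rho>\<in>?D. M \<kappa> \<rho> * shifted_schur_value \<rho> \<mu>)" ..
  have M: "monom_val (\<lambda>n. power_sum_fun (n + 1) \<mu>) (column_monomial \<kappa>) =
    (\<Sum>\<rho>\<in>?D. M \<kappa> \<rho> * shifted_schur_value \<rho> \<mu>)"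
    if "\<kappa> \<in> ?D" "\<mu> \<in> young_diagrams" "num_rows \<mu> \<le> N" for \<kappa> \<mu>
    using M0 that by blast
  define G where "G c = (\<Sum>\<kappa>\<in>?D. Poly_Mapping.single (column_monomial \<kappa>) (c \<kappa> :: real))" for c
  have val: "sym_value (G c) \<mu> = (\<Sum>\<rho>\<in>?D. (\<Sum>\<kappa>\<in>?D. c \<kappa> * M \<kappa> \<rho>) * shifted_schur_value \<rho> \<mu>)"
    if "\<mu> \<in> young_diagrams" "num_rows \<mu> \<le> N" for c \<mu>
  proof -
    have "sym_value (G c) \<mu> = (\<Sum>\<kappa>\<in>?D. \<Sum>\<rho>\<in>?D. c \<kappa> * (M \<kappa> \<rho> * shifted_schur_value \<rho> \<mu>))"
      unfolding G_def sym_value_sum sym_value_single sum_distrib_left[symmetric]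
      using M that by (intro sum.cong) auto
    also have "\<dots> = (\<Sum>\<rho>\<in>?D. \<Sum>\<kappa>\<in>?D. c \<kappa> * (M \<kappa> \<rho> * shifted_schur_value \<rho> \<mu>))"
      by (rule sum.swap)
    finally show ?thesis by (simp add: sum_distrib_right mult.assoc)
  qed
  have wt: "weight m \<le> ?d" if "m \<in> Poly_Mapping.keys (G c)" for m c
  proof -
    from subsetD[OF Poly_Mapping.keys_sum that[unfolded G_def]] obtain \<kappa>
      where "\<kappa> \<in> ?D" "m \<in> Poly_Mapping.keys (Poly_Mapping.single (column_monomial \<kappa>) (c \<kappa>))"
      by (rule UN_E)
    thus ?thesis using D(2)[of \<kappa>] by (auto split: if_splits)
  qed
  have coeff: "Poly_Mapping.lookup (G c) (column_monomial \<kappa>) = c \<kappa>" if "\<kappa> \<in> ?D" for c \<kappa>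
  proof -
    have "Poly_Mapping.lookup (G c) (column_monomial \<kappa>) = (\<Sum>\<kappa>'\<in>?D. if \<kappa>' = \<kappa> then c \<kappa>' else 0)"
      unfolding G_def lookup_sum
    proof (rule sum.cong[OF refl])
      fix \<kappa>' assume "\<kappa>' \<in> ?D"
      hence "column_monomial \<kappa>' = column_monomial \<kappa> \<longleftrightarrow> \<kappa>' = \<kappa>"
        using inj_onD[OF inj_column_monomial] D(1) that by blast
      thus "Poly_Mapping.lookup (Poly_Mapping.single (column_monomial \<kappa>') (c \<kappa>')) (column_monomial \<kappa>) =
          (if \<kappa>' = \<kappa> then c \<kappa>' else 0)"
        by (simp add: lookup_single when_def)
    qed
    thus ?thesis using that fin by simp
  qed
  have "\<exists>B. \<forall>j\<in>?D. \<forall>k\<in>?D. (\<Sum>i\<in>?D. B j i * M i k) = (if j = k then 1 else 0)"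
  proof (rule left_inverse_if_rows_independent[OF fin])
    fix c assume c: "\<And>k. k \<in> ?D \<Longrightarrow> (\<Sum>i\<in>?D. c i * M i k) = 0"
    have "G c = 0"
    proof (rule sym_eq_0_if_vanishes)
      fix m assume "m \<in> Poly_Mapping.keys (G c)"
      thus "weight m \<le> N" using wt N by (meson order_trans)
    qed (simp add: val c)
    thus "\<forall>i\<in>?D. c i = 0" using coeff[of _ c] by simp
  qed
  then obtain B where B: "(\<Sum>i\<in>?D. B j i * M i k) = (if j = k then 1 else 0)"
    if "j \<in> ?D" "k \<in> ?D" for j k by blast
  have \<nu>D: "\<nu> \<in> ?D" using \<nu> N num_rows_le_card[OF \<nu>] by (simp add: small_diagrams_def)
  have "sym_value (G (B \<nu>)) \<mu> = shifted_schur_value \<nu> \<mu>"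
    if "\<mu> \<in> young_diagrams" "num_rows \<mu> \<le> N" for \<mu>
  proof -
    have "sym_value (G (B \<nu>)) \<mu> = (\<Sum>\<rho>\<in>?D. if \<nu> = \<rho> then shifted_schur_value \<rho> \<mu> else 0)"
      unfolding val[OF that] using B[OF \<nu>D] by (intro sum.cong) auto
    thus ?thesis using \<nu>D fin by simp
  qed
  thus ?thesis using wt by blast
qed

lemma schur_sym_exists:
  assumes \<nu>: "\<nu> \<in> young_diagrams"
  shows "\<exists>F. (\<forall>m\<in>Poly_Mapping.keys F. weight m \<le> card \<nu>) \<and>
    (\<forall>\<mu>\<in>young_diagrams. sym_value F \<mu> = shifted_schur_value \<nu> \<mu>)"
proof -
  \<comment> \<open>Solutions for different numbers of rows agree on diagrams with at most \<open>card \<nu>\<close> rows, hence coincide.\<close>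
  let ?P = "\<lambda>N F. (\<forall>m\<in>Poly_Mapping.keys F. weight m \<le> card \<nu>) \<and>
    (\<forall>\<mu>\<in>young_diagrams. num_rows \<mu> \<le> N \<longrightarrow> sym_value F \<mu> = shifted_schur_value \<nu> \<mu>)"
  obtain F where F: "?P (card \<nu>) F"
    using schur_sym_exists_rows[OF \<nu> order.refl] by blast
  have "sym_value F \<mu> = shifted_schur_value \<nu> \<mu>" if \<mu>: "\<mu> \<in> young_diagrams" for \<mu>
  proof -
    let ?N = "max (card \<nu>) (num_rows \<mu>)"
    obtain F' where F': "?P ?N F'" using schur_sym_exists_rows[OF \<nu>, of ?N] by auto
    have "F = F'"
      by (rule sym_eqI_weight[of _ "card \<nu>"]) (use F F' in auto)
    thus ?thesis using F' \<mu> by simp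
  qed
  thus ?thesis using F by blast
qed

lemma peval_shift_inverse:
  fixes p :: "real poly_ring"
  shows "peval pconst (\<lambda>i. pvar i - pconst (a i)) (peval pconst (\<lambda>i. pvar i + pconst (a i)) p) = p"
    and "peval pconst (\<lambda>i. pvar i + pconst (a i)) (peval pconst (\<lambda>i. pvar i - pconst (a i)) p) = p"
  by (rule poly_ring_eqI, simp add: peval_id_comp peval_id_simps peval_id_minus)+

text \<open>The identity that characterizes the factorial Schur polynomial holds at all diagrams with at most \<open>N\<close> rows
  and hence as an identity of polynomials, after the substitution \<open>x\<^sub>i = y\<^sub>i + N - i\<close>.\<close>
lemma to_shifted_sym_eq_shifted_schur:
  assumes \<nu>: "\<nu> \<in> young_diagrams"
    and F: "\<And>\<mu>. \<mu> \<in> young_diagrams \<Longrightarrow> sym_value F \<mu> = shifted_schur_value \<nu> \<mu>"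
  shows "to_shifted_sym F N = shifted_schur \<nu> N"
proof (cases "num_rows \<nu> \<le> N")
  case False
  have "to_shifted_sym F N = 0"
  proof (rule poly_ring_eq_0_if_vanishes)
    fix \<sigma> :: "nat \<Rightarrow> nat" assume \<sigma>: "antimono \<sigma>"
    have "num_rows (rows_diagram N \<sigma>) < num_rows \<nu>" using rows_diagram(2)[OF \<sigma>, of N] False by simp
    thus "peval id (\<lambda>n. of_nat (\<sigma> n)) (to_shifted_sym F N) = 0"
      by (simp add: peval_to_shifted_sym_diagram[OF \<sigma>] F rows_diagram[OF \<sigma>] shifted_schur_value_eq_0 \<nu>)
  qed
  thus ?thesis using False
    by (simp add: shifted_schur_def factorial_schur_def comm_ring_hom.peval_0[OF comm_ring_hom_pconst])
next
  case True
  \<comment> \<open>\<open>sh\<close> passes from the variables \<open>x\<close> to the variables \<open>y\<close>, and \<open>un\<close> is its inverse.\<close>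
  define sh :: "real poly_ring \<Rightarrow> real poly_ring"
    where "sh = peval pconst (\<lambda>i. pvar i + pconst (real N - real i))"
  define un :: "real poly_ring \<Rightarrow> real poly_ring"
    where "un = peval pconst (\<lambda>i. pvar i - pconst (real N - real i))"
  have sh_un: "sh (un p) = p" "un (sh p) = p" for p
    unfolding sh_def un_def by (rule peval_shift_inverse)+
  have hom: "sh (p * q) = sh p * sh q" "un (p * q) = un p * un q" for p q
    unfolding sh_def un_def by (rule comm_ring_hom.peval_mult[OF comm_ring_hom_pconst])+
  let ?V = "\<Prod>i=1..N. \<Prod>j=Suc i..N. (pvar i - pvar j) :: real poly_ring"
  let ?det = "det (mat N N (\<lambda>(i, j). falling (pvar (j + 1)) (row_len \<nu> (i + 1) + N - (i + 1)))) :: real poly_ring"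
  let ?T = "to_shifted_sym F N"
  have eval_sh: "peval id \<sigma> (sh p) = peval id (\<lambda>i. \<sigma> i + (real N - real i)) p" for \<sigma> p
    by (simp add: sh_def peval_id_comp peval_id_simps)
  have x: "real (\<sigma> (Suc j)) + (real N - real (Suc j)) = real (shifted_row N (rows_diagram N \<sigma>) j)"
    if "antimono \<sigma>" "j < N" for \<sigma> j
    using rows_diagram(3)[OF that] that(2) by (simp add: shifted_row_def of_nat_diff)
  have eval_V: "peval id (\<lambda>n. real (\<sigma> n)) (sh ?V) = alternant N (shifted_row N {}) (rows_diagram N \<sigma>)"
    if \<sigma>: "antimono \<sigma>" for \<sigma>
  proof -
    let ?x = "\<lambda>i. real (\<sigma> i) + (real N - real i)"
    have "peval id (\<lambda>n. real (\<sigma> n)) (sh ?V) = (\<Prod>i=1..N. \<Prod>j=Suc i..N. ?x i - ?x j)"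
      by (simp only: eval_sh peval_id_prod peval_id_minus peval_id_simps)
    also have "\<dots> = (\<Prod>i<N. \<Prod>j=Suc (Suc i)..N. ?x (Suc i) - ?x j)"
      by (simp only: One_nat_def prod.atLeast1_atMost_eq)
    also have "\<dots> = (\<Prod>i<N. \<Prod>j\<in>{Suc i..<N}. ?x (Suc i) - ?x (Suc j))"
      by (simp only: atLeastLessThanSuc_atLeastAtMost[symmetric] prod.atLeast_Suc_lessThan_Suc_shift o_def)
    also have "\<dots> = alternant N (shifted_row N {}) (rows_diagram N \<sigma>)"
      unfolding alternant_vandermonde using x[OF \<sigma>] by (intro prod.cong) auto
    finally show ?thesis .
  qed
  have eval_det: "peval id (\<lambda>n. real (\<sigma> n)) (sh ?det) = alternant N (shifted_row N \<nu>) (rows_diagram N \<sigma>)"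
    if \<sigma>: "antimono \<sigma>" for \<sigma>
  proof -
    let ?x = "\<lambda>i. real (\<sigma> i) + (real N - real i)"
    have "peval id (\<lambda>n. real (\<sigma> n)) (sh ?det) =
        sqdet N (\<lambda>i j. falling (?x (j + 1)) (row_len \<nu> (i + 1) + N - (i + 1)))"
      by (simp only: eval_sh peval_id_det sqdet_def)
         (simp add: case_prod_beta' peval_id_falling peval_id_simps)
    also have "\<dots> = alternant N (shifted_row N \<nu>) (rows_diagram N \<sigma>)"
      unfolding alternant_def
    proof (rule sqdet_cong)
      fix i j assume ij: "i < N" "j < N"
      have "row_len \<nu> (i + 1) + N - (i + 1) = shifted_row N \<nu> i"
        using ij by (simp add: shifted_row_def rowlen_def)
      thus "falling (?x (j + 1)) (row_len \<nu> (i + 1) + N - (i + 1)) =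
          falling (real (shifted_row N (rows_diagram N \<sigma>) j)) (shifted_row N \<nu> i)"
        using x[OF \<sigma> ij(2)] by simp
    qed
    finally show ?thesis .
  qed
  have "?T * sh ?V = sh ?det"
  proof (rule poly_ring_eqI)
    fix \<sigma> :: "nat \<Rightarrow> nat" assume \<sigma>: "antimono \<sigma>"
    show "peval id (\<lambda>n. of_nat (\<sigma> n)) (?T * sh ?V) = peval id (\<lambda>n. of_nat (\<sigma> n)) (sh ?det)"
      unfolding peval_id_simps eval_V[OF \<sigma>] eval_det[OF \<sigma>] peval_to_shifted_sym_diagram[OF \<sigma>]
      by (simp add: F rows_diagram[OF \<sigma>] shifted_schur_value_alternant \<nu> True)
  qed
  hence "un (?T * sh ?V) = un (sh ?det)" by (rule arg_cong)
  hence eq: "un ?T * ?V = ?det" unfolding hom(2) sh_un(2) .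
  have V: "?V \<noteq> 0"
  proof
    assume V0: "?V = 0"
    have "peval id (\<lambda>n. real ((\<lambda>_. 0) n)) (sh ?V) = 0"
      unfolding V0 by (simp add: sh_def comm_ring_hom.peval_0[OF comm_ring_hom_pconst]
          comm_ring_hom.peval_0[OF comm_ring_hom_id])
    thus False
      using eval_V[of "\<lambda>_. 0"] alternant_vandermonde_nonzero[OF rows_diagram(1)[of "\<lambda>_. 0" N], of N]
      by (simp add: antimono_def)
  qed
  have "(THE q. q * ?V = ?det) = un ?T"
  proof (rule the_equality)
    fix q assume "q * ?V = ?det"
    hence "q * ?V = un ?T * ?V" by (simp only: eq)
    thus "q = un ?T" by (rule mult_right_cancel[OF V, THEN iffD1])
  qed (rule eq)
  hence "factorial_schur \<nu> N = un ?T" using True by (simp only: factorial_schur_def if_True)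
  hence "shifted_schur \<nu> N = sh (un ?T)" by (simp add: shifted_schur_def sh_def)
  thus ?thesis by (simp add: sh_un)
qed

lemma sym_value_eq_if_to_shifted_sym_eq:
  assumes "to_shifted_sym F N = to_shifted_sym G N" "\<mu> \<in> young_diagrams" "num_rows \<mu> \<le> N"
  shows "sym_value F \<mu> = sym_value G \<mu>"
proof -
  define \<sigma> where "\<sigma> i = rowlen \<mu> (i - 1)" for i
  have \<sigma>: "antimono \<sigma>" using row_antimono[OF assms(2)] by (auto simp: antimono_def \<sigma>_def)
  have "rowlen (rows_diagram N \<sigma>) i = rowlen \<mu> i" for i
    using row_eq_0_iff[OF assms(2), of i] assms(3) by (simp add: rows_diagram_def \<sigma>_def)
  hence "rows_diagram N \<sigma> = \<mu>" by (intro young_eqI rows_diagram(1)[OF \<sigma>] assms)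
  thus ?thesis
    using peval_to_shifted_sym_diagram[OF \<sigma>, of F N] peval_to_shifted_sym_diagram[OF \<sigma>, of G N] assms(1) by simp
qed

lemma FS_properties:
  assumes \<nu>: "\<nu> \<in> young_diagrams"
  shows "\<mu> \<in> young_diagrams \<Longrightarrow> sym_value (FS \<nu>) \<mu> = shifted_schur_value \<nu> \<mu>"
    and "m \<in> Poly_Mapping.keys (FS \<nu>) \<Longrightarrow> weight m \<le> card \<nu>"
proof -
  obtain F where wt: "\<And>m. m \<in> Poly_Mapping.keys F \<Longrightarrow> weight m \<le> card \<nu>"
    and F: "\<And>\<mu>. \<mu> \<in> young_diagrams \<Longrightarrow> sym_value F \<mu> = shifted_schur_value \<nu> \<mu>"
    using schur_sym_exists[OF \<nu>] by blast
  note T = to_shifted_sym_eq_shifted_schur[OF \<nu> F]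
  have "FS \<nu> = F"
    unfolding FS_def from_shifted_sym_def
  proof (rule the_equality)
    fix G assume G: "\<forall>N\<ge>1. to_shifted_sym G N = shifted_schur \<nu> N"
    show "G = F"
    proof (rule sym_eqI)
      fix \<mu> assume \<mu>: "\<mu> \<in> young_diagrams"
      show "sym_value G \<mu> = sym_value F \<mu>"
        by (rule sym_value_eq_if_to_shifted_sym_eq[of _ "max 1 (num_rows \<mu>)"]) (use G T \<mu> in auto)
    qed
  qed (simp add: T)
  thus "\<mu> \<in> young_diagrams \<Longrightarrow> sym_value (FS \<nu>) \<mu> = shifted_schur_value \<nu> \<mu>"
    "m \<in> Poly_Mapping.keys (FS \<nu>) \<Longrightarrow> weight m \<le> card \<nu>"
    using F wt by auto
qed

section \<open>The Frobenius--Schur functions span\<close>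

lemma monomial_FS_expansion:
  "\<exists>A c. finite A \<and> A \<subseteq> young_diagrams \<and>
    Poly_Mapping.single m 1 = (\<Sum>\<nu>\<in>A. pconst (c \<nu>) * FS \<nu>)"
proof -
  let ?N = "weight m"
  let ?D = "small_diagrams ?N ?N"
  obtain c where c: "\<And>\<mu>. \<mu> \<in> young_diagrams \<Longrightarrow> num_rows \<mu> \<le> ?N \<Longrightarrow>
    monom_val (\<lambda>n. power_sum_fun (n + 1) \<mu>) m = (\<Sum>\<nu>\<in>?D. c \<nu> * shifted_schur_value \<nu> \<mu>)"
    using monomial_schur_expansion[OF order.refl, where m = m and N = ?N] by blast
  have D: "\<nu> \<in> young_diagrams" "card \<nu> \<le> ?N" if "\<nu> \<in> ?D" for \<nu>
    using that by (auto simp: small_diagrams_def)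
  have "Poly_Mapping.single m 1 = (\<Sum>\<nu>\<in>?D. pconst (c \<nu>) * FS \<nu>)"
  proof (rule sym_eqI_weight)
    fix m' assume "m' \<in> Poly_Mapping.keys (\<Sum>\<nu>\<in>?D. pconst (c \<nu>) * FS \<nu>)"
    from subsetD[OF Poly_Mapping.keys_sum this] obtain \<nu>
      where \<nu>: "\<nu> \<in> ?D" "m' \<in> Poly_Mapping.keys (pconst (c \<nu>) * FS \<nu>)"
      by (rule UN_E)
    hence "m' \<in> Poly_Mapping.keys (FS \<nu>)"
      using Poly_Mapping.keys_mult[of "pconst (c \<nu>)" "FS \<nu>"]
      by (auto simp: pconst_def split: if_splits)
    thus "weight m' \<le> ?N" using FS_properties(2) D \<nu>(1) order_trans by blast
  next
    fix \<mu> assume \<mu>: "\<mu> \<in> young_diagrams" "num_rows \<mu> \<le> ?N"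
    have "sym_value (\<Sum>\<nu>\<in>?D. pconst (c \<nu>) * FS \<nu>) \<mu> = (\<Sum>\<nu>\<in>?D. c \<nu> * shifted_schur_value \<nu> \<mu>)"
      unfolding sym_value_sum sym_value_mult sym_value_const
      using FS_properties(1) D \<mu> by (intro sum.cong) auto
    thus "sym_value (Poly_Mapping.single m 1) \<mu> = sym_value (\<Sum>\<nu>\<in>?D. pconst (c \<nu>) * FS \<nu>) \<mu>"
      using c[OF \<mu>] by (simp add: sym_value_single)
  qed auto
  thus ?thesis using finite_small_diagrams D by blast
qed

section \<open>The Meixner difference operator\<close>

lemma fun_on_young_add: "fun_on_young (F + G) \<mu> = fun_on_young F \<mu> + fun_on_young G \<mu>"
  by (simp add: fun_on_young_def peval_id_simps)

lemma fun_on_young_sum: "fun_on_young (\<Sum>x\<in>A. F x) \<mu> = (\<Sum>x\<in>A. fun_on_young (F x) \<mu>)"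
  by (simp add: fun_on_young_def peval_id_simps)

lemma fun_on_young_minus: "fun_on_young (F - G) \<mu> = fun_on_young F \<mu> - fun_on_young G \<mu>"
  using fun_on_young_add[of "F - G" G] by simp

lemma fun_on_young_uminus: "fun_on_young (- F) \<mu> = - fun_on_young F \<mu>"
  using fun_on_young_minus[of F F \<mu>] fun_on_young_minus[of "F - F" F \<mu>] by simp

lemma fun_on_young_scale: "fun_on_young (sym_scale c F) \<mu> = c * fun_on_young F \<mu>"
  by (simp add: fun_on_young_def sym_scale_def peval_id_simps)

lemmas fun_on_young_linear_simps =
  fun_on_young_add fun_on_young_sum fun_on_young_minus fun_on_young_uminus fun_on_young_scale

lemma fun_on_young_complexify: "fun_on_young (complexify F) \<mu> = of_real (sym_value F \<mu>)"
  by (simp add: fun_on_young_def complexify_def comm_ring_hom.hom_peval[OF peval_id_hom] peval_id_simps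
      sym_value_def comm_ring_hom.hom_peval[OF comm_ring_hom_of_real])

text \<open>Real and imaginary parts of the coefficients are treated separately, since the values of the power sums are real.\<close>
lemma fun_on_young_inj:
  assumes "\<And>\<mu>. \<mu> \<in> young_diagrams \<Longrightarrow> fun_on_young F \<mu> = fun_on_young G \<mu>"
  shows "F = G"
proof -
  let ?H = "F - G" and ?p = "\<lambda>\<mu> n. power_sum_fun (n + 1) \<mu>"
  let ?K = "Poly_Mapping.keys ?H" and ?l = "Poly_Mapping.lookup ?H"
  define part :: "(complex \<Rightarrow> real) \<Rightarrow> sym"
    where "part r = (\<Sum>m\<in>?K. Poly_Mapping.single m (r (?l m)))" for r
  have val: "fun_on_young ?H \<mu> = of_real (sym_value (part Re) \<mu>) + \<i> * of_real (sym_value (part Im) \<mu>)" for \<mu>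
  proof -
    have mono: "monom_val (\<lambda>n. complex_of_real (?p \<mu> n)) m = of_real (monom_val (?p \<mu>) m)" for m
      by (simp add: monom_val_def)
    have "fun_on_young ?H \<mu> = (\<Sum>m\<in>?K. ?l m * of_real (monom_val (?p \<mu>) m))"
      by (simp only: fun_on_young_def peval_monom_val mono id_apply)
    also have "\<dots> = (\<Sum>m\<in>?K. of_real (Re (?l m) * monom_val (?p \<mu>) m) +
        \<i> * of_real (Im (?l m) * monom_val (?p \<mu>) m))"
      by (intro sum.cong refl) (simp add: complex_eq_iff)
    finally show ?thesis
      unfolding part_def sym_value_sum sym_value_single
      by (simp add: sum.distrib sum_distrib_left)
  qed
  have "sym_value (part Re) \<mu> = 0" "sym_value (part Im) \<mu> = 0" if "\<mu> \<in> young_diagrams" for \<mu>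
  proof -
    have "of_real (sym_value (part Re) \<mu>) + \<i> * of_real (sym_value (part Im) \<mu>) = 0"
      using assms[OF that] by (simp only: val[symmetric] fun_on_young_minus diff_self)
    thus "sym_value (part Re) \<mu> = 0" "sym_value (part Im) \<mu> = 0"
      by (simp_all add: complex_eq_iff)
  qed
  hence zero: "part Re = 0" "part Im = 0"
    by (auto intro!: sym_eqI simp: sym_value_def comm_ring_hom.peval_0[OF comm_ring_hom_id])
  have coeff: "Poly_Mapping.lookup (part r) m = r (?l m)" if "m \<in> ?K" for r m
  proof -
    have "Poly_Mapping.lookup (part r) m = (\<Sum>m'\<in>?K. if m' = m then r (?l m') else 0)"
      unfolding part_def lookup_sum by (intro sum.cong) (auto simp: lookup_single when_def)
    thus ?thesis using that by simp
  qed
  have "?l m = 0" if "m \<in> ?K" for m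
    using coeff[OF that, of Re] coeff[OF that, of Im] zero by (simp add: complex_eq_iff)
  hence "Poly_Mapping.lookup ?H m = Poly_Mapping.lookup 0 m" for m
    by (cases "m \<in> ?K") (auto simp: in_keys_iff)
  hence "?H = 0" by (rule poly_mapping_eqI)
  thus ?thesis by simp
qed

lemma complexify_ring_hom: "comm_ring_hom complexify"
  unfolding complexify_def by (rule comm_ring_hom.peval_hom[OF comm_ring_hom_pconst_of_real])

lemma sym_complex_FS_expansion:
  "\<exists>A c. finite A \<and> A \<subseteq> young_diagrams \<and> F = (\<Sum>\<nu>\<in>A. sym_scale (c \<nu>) (complexify (FS \<nu>)))"
proof -
  let ?Q = "\<lambda>F. \<exists>A c. finite A \<and> A \<subseteq> young_diagrams \<and> F = (\<Sum>\<nu>\<in>A. sym_scale (c \<nu>) (complexify (FS \<nu>)))"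
  have scale_add: "sym_scale (a + b) G = sym_scale a G + sym_scale b G" for a b G
    by (simp add: sym_scale_def pconst_def single_add distrib_right)
  have zero_scale: "sym_scale 0 G = 0" for G
    by (simp add: sym_scale_def pconst_def)
  have add: "?Q (F + G)" if FG: "?Q F" "?Q G" for F G
  proof -
    obtain A c where A: "finite A" "A \<subseteq> young_diagrams" "F = (\<Sum>\<nu>\<in>A. sym_scale (c \<nu>) (complexify (FS \<nu>)))"
      using FG(1) by blast
    obtain B e where B: "finite B" "B \<subseteq> young_diagrams" "G = (\<Sum>\<nu>\<in>B. sym_scale (e \<nu>) (complexify (FS \<nu>)))"
      using FG(2) by blast
    let ?c = "\<lambda>\<nu>. (if \<nu> \<in> A then c \<nu> else 0)" and ?e = "\<lambda>\<nu>. (if \<nu> \<in> B then e \<nu> else 0)"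
    have F: "F = (\<Sum>\<nu>\<in>A \<union> B. sym_scale (?c \<nu>) (complexify (FS \<nu>)))"
      unfolding A(3) using A(1) B(1) by (intro sum.mono_neutral_cong_left) (auto simp: zero_scale)
    have G: "G = (\<Sum>\<nu>\<in>A \<union> B. sym_scale (?e \<nu>) (complexify (FS \<nu>)))"
      unfolding B(3) using A(1) B(1) by (intro sum.mono_neutral_cong_left) (auto simp: zero_scale)
    have "F + G = (\<Sum>\<nu>\<in>A \<union> B. sym_scale (?c \<nu> + ?e \<nu>) (complexify (FS \<nu>)))"
      unfolding F G scale_add sum.distrib ..
    thus ?thesis using A B by (intro exI[of _ "A \<union> B"] exI[of _ "\<lambda>\<nu>. ?c \<nu> + ?e \<nu>"]) auto
  qed
  have single: "?Q (Poly_Mapping.single m a)" for m a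
  proof -
    obtain A c where A: "finite A" "A \<subseteq> young_diagrams" "Poly_Mapping.single m 1 = (\<Sum>\<nu>\<in>A. pconst (c \<nu>) * FS \<nu>)"
      using monomial_FS_expansion by blast
    interpret comm_ring_hom complexify by (rule complexify_ring_hom)
    have mono: "monom_val pvar m = (Poly_Mapping.single m 1 :: sym_complex)"
    proof (rule poly_ring_eqI)
      fix \<sigma> :: "nat \<Rightarrow> nat"
      show "peval id (\<lambda>n. of_nat (\<sigma> n)) (monom_val pvar m :: sym_complex) =
          peval id (\<lambda>n. of_nat (\<sigma> n)) (Poly_Mapping.single m 1)"
        unfolding monom_val_def peval_id_prod peval_id_power
        by (simp add: comm_ring_hom.peval_single[OF comm_ring_hom_id] peval_id_simps monom_val_def)
    qed
    have const: "complexify (pconst x) = pconst (of_real x)" for x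
      by (simp add: complexify_def comm_ring_hom.peval_const[OF comm_ring_hom_pconst_of_real])
    have "complexify (Poly_Mapping.single m 1) = Poly_Mapping.single m 1"
      unfolding complexify_def comm_ring_hom.peval_single[OF comm_ring_hom_pconst_of_real] mono
      by (simp add: pconst_def)
    hence "Poly_Mapping.single m a = pconst a * complexify (Poly_Mapping.single m 1)"
      by (simp add: pconst_def mult_single)
    also have "\<dots> = (\<Sum>\<nu>\<in>A. sym_scale (a * of_real (c \<nu>)) (complexify (FS \<nu>)))"
      unfolding A(3)
      by (simp add: hom_sum hom_mult const sum_distrib_left sym_scale_def mult.assoc[symmetric])
         (simp add: pconst_def mult_single)
    finally have "Poly_Mapping.single m a = \<dots>" .
    with A(1,2) show ?thesis by (intro exI conjI)
  qed
  have "?Q (\<Sum>m\<in>K. Poly_Mapping.single m (l m))" if "finite K" for K l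
    using that
  proof (induction K rule: finite_induct)
    case empty
    show ?case by (intro exI[of _ "{}"]) simp
  next
    case (insert m K)
    show ?case using add[OF single insert.IH] insert.hyps by simp
  qed
  from this[where K = "Poly_Mapping.keys F" and l = "Poly_Mapping.lookup F"] show ?thesis
    unfolding poly_ring_sum_monomials[symmetric] by simp
qed

text \<open>The difference operator on functions of diagrams in its first form.\<close>
definition meixner_difference ::
    "complex \<Rightarrow> complex \<Rightarrow> complex \<Rightarrow> (box set \<Rightarrow> complex) \<Rightarrow> box set \<Rightarrow> complex" where
  "meixner_difference z z' \<xi> f \<mu> = (\<Sum>b\<in>addable \<mu>. coeff_A z z' \<xi> \<mu> b * f (insert b \<mu>)) +
    (\<Sum>b\<in>removable \<mu>. coeff_B \<xi> \<mu> b * f (\<mu> - {b})) - coeff_C z z' \<xi> \<mu> * f \<mu>"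

text \<open>After multiplication by \<open>1 - \<xi>\<close>, the terms without \<open>\<xi>\<close> combine by \<open>Phi_remove_boxes\<close> and those with \<open>\<xi>\<close> by \<open>Phi_add_boxes\<close>.\<close>
lemma meixner_difference_schur:
  fixes z z' \<xi> :: complex
  assumes \<mu>: "\<mu> \<in> young_diagrams" and \<nu>: "\<nu> \<in> young_diagrams" and \<xi>: "\<xi> \<noteq> 1"
  defines "S \<equiv> \<lambda>\<nu> \<mu>. complex_of_real (shifted_schur_value \<nu> \<mu>)"
  shows "meixner_difference z z' \<xi> (S \<nu>) \<mu> = - of_nat (card \<nu>) * S \<nu> \<mu> +
    \<xi> / (1 - \<xi>) * (\<Sum>b\<in>removable \<nu>. (z + of_int (content b)) * (z' + of_int (content b)) * S (\<nu> - {b}) \<mu>)"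
proof -
  define N where "N = Suc (max (num_rows \<mu>) (num_rows \<nu>))"
  have N: "num_rows \<mu> < N" "num_rows \<nu> < N" by (auto simp: N_def)
  define w where "w b = (z + of_int (content b)) * (z' + of_int (content b))" for b
  let ?P = "\<lambda>\<mu> \<nu>. complex_of_real (Phi N \<mu> \<nu>)"
  let ?n = "of_nat (card \<mu>) :: complex" and ?k = "of_nat (card \<nu>) :: complex"
  let ?R = "\<Sum>b\<in>removable \<nu>. w b * ?P \<mu> (\<nu> - {b})"
  have P0: "?P \<mu>' {} \<noteq> 0" if "\<mu>' \<in> young_diagrams" for \<mu>'
    using Phi_empty_nonzero[OF that] by simp
  have dim: "of_nat (dim_young \<mu>') = fact (card \<mu>') * ?P \<mu>' {}"
    if "\<mu>' \<in> young_diagrams" "num_rows \<mu>' \<le> N" for \<mu>'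
    using arg_cong[OF dim_young_eq_Phi[OF that], of complex_of_real] by simp
  have S: "S \<nu>' \<mu>' = ?P \<mu>' \<nu>' / ?P \<mu>' {}"
    if "\<mu>' \<in> young_diagrams" "\<nu>' \<in> young_diagrams" "num_rows \<mu>' \<le> N" "num_rows \<nu>' \<le> N" for \<mu>' \<nu>'
    by (simp add: S_def shifted_schur_value_eq[OF that])
  have A: "coeff_A z z' \<xi> \<mu> b * S \<nu> (insert b \<mu>) = \<xi> / (1 - \<xi>) / ?P \<mu> {} * (w b * ?P (insert b \<mu>) \<nu>)"
    if b: "b \<in> addable \<mu>" for b
  proof -
    note ins = addable_facts[OF \<mu> b] num_rows_insert[OF \<mu> b N(1)]
    have "of_nat (dim_young (insert b \<mu>)) / ((?n + 1) * of_nat (dim_young \<mu>)) = ?P (insert b \<mu>) {} / ?P \<mu> {}"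
    proof -
      have "of_nat (dim_young (insert b \<mu>)) = ((?n + 1) * fact (card \<mu>)) * ?P (insert b \<mu>) {}"
        using dim[OF ins(1,3)] by (simp add: ins(2) add.commute)
      moreover have "(?n + 1) * of_nat (dim_young \<mu>) = ((?n + 1) * fact (card \<mu>)) * ?P \<mu> {}"
        using dim[OF \<mu>] N by simp
      moreover have "(?n + 1) * fact (card \<mu>) \<noteq> (0 :: complex)"
        by (metis fact_Suc fact_nonzero of_nat_Suc add.commute)
      ultimately show ?thesis by simp
    qed
    moreover have "S \<nu> (insert b \<mu>) = ?P (insert b \<mu>) \<nu> / ?P (insert b \<mu>) {}"
      using S[OF ins(1) \<nu> ins(3)] N by simp
    ultimately show ?thesis
      using P0[OF ins(1)] by (simp add: coeff_A_def w_def mult_ac)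
  qed
  have B: "coeff_B \<xi> \<mu> b * S \<nu> (\<mu> - {b}) = 1 / (1 - \<xi>) / ?P \<mu> {} * ?P (\<mu> - {b}) \<nu>"
    if b: "b \<in> removable \<mu>" for b
  proof -
    note rem = removable_facts[OF \<mu> b] num_rows_remove[OF \<mu> b less_imp_le[OF N(1)]]
    have "?n * of_nat (dim_young (\<mu> - {b})) / of_nat (dim_young \<mu>) = ?P (\<mu> - {b}) {} / ?P \<mu> {}"
    proof -
      have "?n * of_nat (dim_young (\<mu> - {b})) = fact (card \<mu>) * ?P (\<mu> - {b}) {}"
        using dim[OF rem(1,3)] by (simp add: rem(2) mult_ac)
      moreover have "of_nat (dim_young \<mu>) = fact (card \<mu>) * ?P \<mu> {}"
        using dim[OF \<mu>] N by simp
      ultimately show ?thesis by simp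
    qed
    moreover have "S \<nu> (\<mu> - {b}) = ?P (\<mu> - {b}) \<nu> / ?P (\<mu> - {b}) {}"
      using S[OF rem(1) \<nu> rem(3)] N by simp
    ultimately show ?thesis
      using P0[OF rem(1)] by (simp add: coeff_B_def)
  qed
  have sumA: "(\<Sum>b\<in>addable \<mu>. coeff_A z z' \<xi> \<mu> b * S \<nu> (insert b \<mu>)) =
      \<xi> / (1 - \<xi>) / ?P \<mu> {} * (?R + (?n + ?k + z * z') * ?P \<mu> \<nu>)"
  proof -
    have "(\<Sum>b\<in>addable \<mu>. w b * ?P (insert b \<mu>) \<nu>) = ?R + (?n + ?k + z * z') * ?P \<mu> \<nu>"
      using Phi_add_boxes[OF \<mu> \<nu> N, of z z'] by (simp add: w_def algebra_simps)
    moreover have "(\<Sum>b\<in>addable \<mu>. coeff_A z z' \<xi> \<mu> b * S \<nu> (insert b \<mu>)) =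
        (\<Sum>b\<in>addable \<mu>. \<xi> / (1 - \<xi>) / ?P \<mu> {} * (w b * ?P (insert b \<mu>) \<nu>))"
      by (intro sum.cong refl A)
    ultimately show ?thesis by (simp only: sum_distrib_left[symmetric])
  qed
  have sumB: "(\<Sum>b\<in>removable \<mu>. coeff_B \<xi> \<mu> b * S \<nu> (\<mu> - {b})) =
      1 / (1 - \<xi>) / ?P \<mu> {} * ((?n - ?k) * ?P \<mu> \<nu>)"
  proof -
    have "(\<Sum>b\<in>removable \<mu>. ?P (\<mu> - {b}) \<nu>) = (?n - ?k) * ?P \<mu> \<nu>"
      using arg_cong[OF Phi_remove_boxes[OF \<mu> \<nu>, of N], of complex_of_real] N by simp
    moreover have "(\<Sum>b\<in>removable \<mu>. coeff_B \<xi> \<mu> b * S \<nu> (\<mu> - {b})) =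
        (\<Sum>b\<in>removable \<mu>. 1 / (1 - \<xi>) / ?P \<mu> {} * ?P (\<mu> - {b}) \<nu>)"
      by (intro sum.cong refl B)
    ultimately show ?thesis by (simp only: sum_distrib_left[symmetric])
  qed
  have sumR: "(\<Sum>b\<in>removable \<nu>. w b * S (\<nu> - {b}) \<mu>) = 1 / ?P \<mu> {} * ?R"
  proof -
    have "w b * S (\<nu> - {b}) \<mu> = 1 / ?P \<mu> {} * (w b * ?P \<mu> (\<nu> - {b}))" if b: "b \<in> removable \<nu>" for b
      using S[OF \<mu> removable_facts(1)[OF \<nu> b]] num_rows_remove[OF \<nu> b less_imp_le[OF N(2)]] N by simp
    thus ?thesis by (simp add: sum_distrib_left)
  qed
  have S\<mu>: "S \<nu> \<mu> = ?P \<mu> \<nu> / ?P \<mu> {}" using S[OF \<mu> \<nu>] N by simp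
  have "1 - \<xi> \<noteq> 0" using \<xi> by simp
  hence "\<xi> / (1 - \<xi>) / p * (r + (n + k + z * z') * q) + 1 / (1 - \<xi>) / p * ((n - k) * q) -
      1 / (1 - \<xi>) * ((1 + \<xi>) * n + \<xi> * z * z') * (q / p) =
      - k * (q / p) + \<xi> / (1 - \<xi>) * (1 / p * r)" if "p \<noteq> 0" for p q r n k
    using that by (simp add: divide_simps) (simp add: algebra_simps)
  from this[OF P0[OF \<mu>]] have "\<xi> / (1 - \<xi>) / ?P \<mu> {} * (?R + (?n + ?k + z * z') * ?P \<mu> \<nu>) +
      1 / (1 - \<xi>) / ?P \<mu> {} * ((?n - ?k) * ?P \<mu> \<nu>) - coeff_C z z' \<xi> \<mu> * S \<nu> \<mu> =
      - ?k * S \<nu> \<mu> + \<xi> / (1 - \<xi>) * (1 / ?P \<mu> {} * ?R)"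
    unfolding S\<mu> coeff_C_def by blast
  thus ?thesis
    unfolding meixner_difference_def sumA sumB using sumR by (simp add: w_def)
qed

lemma meixner_difference_sum:
  assumes "\<And>\<kappa>. f \<kappa> = (\<Sum>x\<in>A. c x * g x \<kappa>)"
  shows "meixner_difference z z' \<xi> f \<mu> = (\<Sum>x\<in>A. c x * meixner_difference z z' \<xi> (g x) \<mu>)"
proof -
  have "(\<Sum>b\<in>D. h b * (\<Sum>x\<in>A. c x * g x (k b))) = (\<Sum>x\<in>A. c x * (\<Sum>b\<in>D. h b * g x (k b)))"
    for D and h :: "box \<Rightarrow> complex" and k
    unfolding sum_distrib_left by (subst sum.swap) (simp add: mult_ac)
  moreover have "h * (\<Sum>x\<in>A. c x * g x \<mu>) = (\<Sum>x\<in>A. c x * (h * g x \<mu>))" for h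
    by (simp add: sum_distrib_left mult_ac)
  ultimately show ?thesis
    unfolding meixner_difference_def assms
    by (simp add: sum.distrib sum_subtractf algebra_simps)
qed

lemma meixner_difference_cong:
  assumes "\<mu> \<in> young_diagrams" "\<And>\<kappa>. \<kappa> \<in> young_diagrams \<Longrightarrow> f \<kappa> = g \<kappa>"
  shows "meixner_difference z z' \<xi> f \<mu> = meixner_difference z z' \<xi> g \<mu>"
  unfolding meixner_difference_def
  using assms addable_facts(1)[OF assms(1)] removable_facts(1)[OF assms(1)]
  by (intro arg_cong2[where f = "(-)"] arg_cong2[where f = "(+)"] sum.cong arg_cong2[where f = "(*)"]) auto

lemma vector_space_sym_scale: "vector_space sym_scale"
proof -
  have hom: "pconst (a + b) = pconst a + pconst b" "pconst (a * b) = pconst a * pconst b" "pconst 1 = 1"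
    for a b :: complex
    by (auto simp: pconst_def single_add mult_single)
  show ?thesis by unfold_locales (simp_all add: sym_scale_def hom algebra_simps)
qed

text \<open>The difference operator maps the functions of symmetric functions to such functions because it does so on the
  spanning set \<open>FS \<nu>\<close>. As a symmetric function is determined by its values, this defines a linear operator \<open>D\<close> on
  symmetric functions; it has the prescribed values on the spanning set, so it is the Meixner operator.\<close>
lemma fun_on_young_meixner_operator:
  assumes \<xi>: "\<xi> \<noteq> 1" and \<mu>: "\<mu> \<in> young_diagrams"
  shows "fun_on_young (meixner_operator z z' \<xi> F) \<mu> = meixner_difference z z' \<xi> (fun_on_young F) \<mu>"
proof -
  let ?FS = "\<lambda>\<nu>. complexify (FS \<nu>)"
  define L where "L \<nu> = - sym_scale (of_nat (card \<nu>)) (?FS \<nu>) + sym_scale (\<xi> / (1 - \<xi>))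
    (\<Sum>b\<in>removable \<nu>. sym_scale ((z + of_int (content b)) * (z' + of_int (content b))) (?FS (\<nu> - {b})))" for \<nu>
  have L: "fun_on_young (L \<nu>) \<kappa> = meixner_difference z z' \<xi> (fun_on_young (?FS \<nu>)) \<kappa>"
    if "\<nu> \<in> young_diagrams" "\<kappa> \<in> young_diagrams" for \<nu> \<kappa>
  proof -
    have FS: "fun_on_young (?FS \<nu>') \<kappa>' = of_real (shifted_schur_value \<nu>' \<kappa>')"
      if "\<nu>' \<in> young_diagrams" "\<kappa>' \<in> young_diagrams" for \<nu>' \<kappa>'
      by (simp add: fun_on_young_complexify FS_properties(1) that)
    have "meixner_difference z z' \<xi> (fun_on_young (?FS \<nu>)) \<kappa> =
        meixner_difference z z' \<xi> (\<lambda>\<kappa>'. of_real (shifted_schur_value \<nu> \<kappa>')) \<kappa>"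
      by (rule meixner_difference_cong) (use that FS in auto)
    thus ?thesis
      using that removable_facts(1)[OF that(1)]
      by (simp add: L_def fun_on_young_linear_simps FS meixner_difference_schur[OF that(2,1) \<xi>])
  qed
  have "\<exists>G. \<forall>\<kappa>\<in>young_diagrams. fun_on_young G \<kappa> = meixner_difference z z' \<xi> (fun_on_young F) \<kappa>" for F
  proof -
    obtain A c where A: "A \<subseteq> young_diagrams" "F = (\<Sum>\<nu>\<in>A. sym_scale (c \<nu>) (?FS \<nu>))"
      using sym_complex_FS_expansion by blast
    have "fun_on_young (\<Sum>\<nu>\<in>A. sym_scale (c \<nu>) (L \<nu>)) \<kappa> = meixner_difference z z' \<xi> (fun_on_young F) \<kappa>"
      if \<kappa>: "\<kappa> \<in> young_diagrams" for \<kappa>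
    proof -
      have "meixner_difference z z' \<xi> (fun_on_young F) \<kappa> =
          (\<Sum>\<nu>\<in>A. c \<nu> * meixner_difference z z' \<xi> (fun_on_young (?FS \<nu>)) \<kappa>)"
        by (rule meixner_difference_sum) (simp add: A(2) fun_on_young_linear_simps)
      also have "\<dots> = (\<Sum>\<nu>\<in>A. c \<nu> * fun_on_young (L \<nu>) \<kappa>)"
        using A(1) L \<kappa> by (intro sum.cong) auto
      finally show ?thesis by (simp add: fun_on_young_linear_simps)
    qed
    thus ?thesis by blast
  qed
  then obtain D where D: "\<And>F \<kappa>. \<kappa> \<in> young_diagrams \<Longrightarrow>
      fun_on_young (D F) \<kappa> = meixner_difference z z' \<xi> (fun_on_young F) \<kappa>"
    by metis
  interpret vector_space sym_scale by (rule vector_space_sym_scale)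
  have lin: "Vector_Spaces.linear sym_scale sym_scale D"
  proof
    fix F G a
    show "D (F + G) = D F + D G"
    proof (rule fun_on_young_inj)
      fix \<kappa> assume \<kappa>: "\<kappa> \<in> young_diagrams"
      have "meixner_difference z z' \<xi> (fun_on_young (F + G)) \<kappa> =
          (\<Sum>x\<in>{True, False}. 1 * meixner_difference z z' \<xi> (fun_on_young (if x then F else G)) \<kappa>)"
        by (rule meixner_difference_sum) (simp add: fun_on_young_add)
      thus "fun_on_young (D (F + G)) \<kappa> = fun_on_young (D F + D G) \<kappa>"
        by (simp add: D[OF \<kappa>] fun_on_young_add)
    qed
    show "D (sym_scale a F) = sym_scale a (D F)"
    proof (rule fun_on_young_inj)
      fix \<kappa> assume \<kappa>: "\<kappa> \<in> young_diagrams"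
      have "meixner_difference z z' \<xi> (fun_on_young (sym_scale a F)) \<kappa> =
          (\<Sum>x\<in>{()}. a * meixner_difference z z' \<xi> (fun_on_young F) \<kappa>)"
        by (rule meixner_difference_sum) (simp add: fun_on_young_scale)
      thus "fun_on_young (D (sym_scale a F)) \<kappa> = fun_on_young (sym_scale a (D F)) \<kappa>"
        by (simp add: D[OF \<kappa>] fun_on_young_scale)
    qed
  qed
  have DFS: "D (?FS \<nu>) = L \<nu>" if "\<nu> \<in> young_diagrams" for \<nu>
    by (rule fun_on_young_inj) (simp add: D L that)
  have "meixner_operator z z' \<xi> = D"
    unfolding meixner_operator_def L_def[symmetric]
  proof (rule the_equality)
    fix D' assume D': "Vector_Spaces.linear sym_scale sym_scale D' \<and> (\<forall>\<nu>\<in>young_diagrams. D' (?FS \<nu>) = L \<nu>)"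
    have expand: "E (\<Sum>\<nu>\<in>A. sym_scale (c \<nu>) (?FS \<nu>)) = (\<Sum>\<nu>\<in>A. sym_scale (c \<nu>) (L \<nu>))"
      if E: "Vector_Spaces.linear sym_scale sym_scale E" "\<forall>\<nu>\<in>young_diagrams. E (?FS \<nu>) = L \<nu>"
        and A: "A \<subseteq> young_diagrams" for E A c
    proof -
      interpret E: Vector_Spaces.linear sym_scale sym_scale E by (rule E(1))
      show ?thesis
        unfolding E.sum E.scale using E(2) A by (intro sum.cong) auto
    qed
    show "D' = D"
    proof
      fix F
      obtain A c where A: "A \<subseteq> young_diagrams" "F = (\<Sum>\<nu>\<in>A. sym_scale (c \<nu>) (?FS \<nu>))"
        using sym_complex_FS_expansion by blast
      show "D' F = D F"
        unfolding A(2) using D' lin DFS A(1) by (simp add: expand)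
    qed
  qed (use lin DFS in blast)
  thus ?thesis using D[OF \<mu>] by simp
qed

text \<open>The case of the constant function 1, the shifted Schur function of the empty diagram.\<close>
lemma coeff_sum:
  assumes "\<mu> \<in> young_diagrams" "\<xi> \<noteq> 1"
  shows "(\<Sum>b\<in>addable \<mu>. coeff_A z z' \<xi> \<mu> b) + (\<Sum>b\<in>removable \<mu>. coeff_B \<xi> \<mu> b) = coeff_C z z' \<xi> \<mu>"
proof -
  have one: "shifted_schur_value {} \<kappa> = 1" if "\<kappa> \<in> young_diagrams" for \<kappa>
    using Phi_empty_nonzero[OF that] by (simp add: shifted_schur_value_eq[OF that empty_young order.refl])
  have "removable {} = {}" by (auto simp: removable_def)
  hence "meixner_difference z z' \<xi> (\<lambda>\<kappa>. of_real (shifted_schur_value {} \<kappa>)) \<mu> = 0"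
    using meixner_difference_schur[OF assms(1) empty_young assms(2), of z z'] by simp
  moreover have "meixner_difference z z' \<xi> (\<lambda>\<kappa>. of_real (shifted_schur_value {} \<kappa>)) \<mu> =
      meixner_difference z z' \<xi> (\<lambda>_. 1) \<mu>"
    by (rule meixner_difference_cong) (simp_all add: assms one)
  ultimately show ?thesis by (simp add: meixner_difference_def)
qed

theorem proposition4p25:
  fixes z z' \<xi> :: complex
  assumes "\<xi> \<noteq> 1"
  shows "(\<forall>F :: sym_complex. \<forall>\<mu>\<in>young_diagrams.
      fun_on_young (meixner_operator z z' \<xi> F) \<mu> =
        (\<Sum>b\<in>addable \<mu>. coeff_A z z' \<xi> \<mu> b * fun_on_young F (insert b \<mu>)) +
        (\<Sum>b\<in>removable \<mu>. coeff_B \<xi> \<mu> b * fun_on_young F (\<mu> - {b})) -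
        coeff_C z z' \<xi> \<mu> * fun_on_young F \<mu>) \<and>
    (\<forall>f :: box set \<Rightarrow> complex. \<forall>\<mu>\<in>young_diagrams.
      (\<Sum>b\<in>addable \<mu>. coeff_A z z' \<xi> \<mu> b * f (insert b \<mu>)) +
        (\<Sum>b\<in>removable \<mu>. coeff_B \<xi> \<mu> b * f (\<mu> - {b})) -
        coeff_C z z' \<xi> \<mu> * f \<mu> =
      (\<Sum>b\<in>addable \<mu>. coeff_A z z' \<xi> \<mu> b * (f (insert b \<mu>) - f \<mu>)) +
        (\<Sum>b\<in>removable \<mu>. coeff_B \<xi> \<mu> b * (f (\<mu> - {b}) - f \<mu>)))"
proof (intro conjI allI ballI)
  fix F and \<mu> assume "\<mu> \<in> young_diagrams"
  from fun_on_young_meixner_operator[OF assms this, of z z' F]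
  show "fun_on_young (meixner_operator z z' \<xi> F) \<mu> =
        (\<Sum>b\<in>addable \<mu>. coeff_A z z' \<xi> \<mu> b * fun_on_young F (insert b \<mu>)) +
        (\<Sum>b\<in>removable \<mu>. coeff_B \<xi> \<mu> b * fun_on_young F (\<mu> - {b})) -
        coeff_C z z' \<xi> \<mu> * fun_on_young F \<mu>"
    unfolding meixner_difference_def .
next
  fix f :: "box set \<Rightarrow> complex" and \<mu> assume "\<mu> \<in> young_diagrams"
  from coeff_sum[OF this assms, of z z', symmetric]
  show "(\<Sum>b\<in>addable \<mu>. coeff_A z z' \<xi> \<mu> b * f (insert b \<mu>)) +
        (\<Sum>b\<in>removable \<mu>. coeff_B \<xi> \<mu> b * f (\<mu> - {b})) -
        coeff_C z z' \<xi> \<mu> * f \<mu> =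
      (\<Sum>b\<in>addable \<mu>. coeff_A z z' \<xi> \<mu> b * (f (insert b \<mu>) - f \<mu>)) +
        (\<Sum>b\<in>removable \<mu>. coeff_B \<xi> \<mu> b * (f (\<mu> - {b}) - f \<mu>))"
    by (simp add: right_diff_distrib sum_subtractf distrib_right sum_distrib_right)
qed

end
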